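(* Let $R$ be a (von Neumann) regular ring. Then for every integer $n\geq2$, the natural monoid homomorphism $\pi_{nR}\colon\operatorname{Dim}\mathcal{L}(nR_R)\to V(R)$, determined by $\pi_{nR}(\Delta(X))=[X]$ for all $X\in\mathcal{L}(nR_R)$, is an isomorphism from $\operatorname{Dim}\mathcal{L}(nR_R)$ onto $V(R)$.
   Context: Rings are associative and unital, not necessarily commutative. For a regular ring $R$, $R_R$ is $R$ viewed as a right module over itself and $nR_R$ is the direct sum of $n$ copies of $R_R$. For a finitely generated projective right $R$-module $M$, $\mathcal{L}(M)$ denotes the complemented modular lattice of all finitely generated right submodules of $M$ (all of which are again finitely generated projective). $V(R)$ is the commutative monoid of isomorphism classes $[A]$ of finitely generated projective right $R$-modules, with $[A]+[B]=[A\oplus B]$. For a lattice $L$, the dimension monoid $\operatorname{Dim}L$ is the commutative monoid defined by generators $\Delta(a,b)$ (for $a\leq b$ in $L$) and the relations: (D0) $\Delta(a,a)=0$; (D1) $\Delta(a,c)=\Delta(a,b)+\Delta(b,c)$ for $a\leq b\leq c$; (D2) $\Delta(a,a\vee b)=\Delta(a\wedge b,b)$ for all $a,b\in L$. If $L$ has a least element $0$, write $\Delta(x)=\Delta(0,x)$. If $L$ is sectionally complemented, $\operatorname{Dim}L$ is generated by the elements $\Delta(x)$, $x\in L$. *)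

theory Defs
  imports "HOL-Library.Multiset" "HOL-Algebra.Ring" "HOL-Algebra.Lattice"
begin

section \<open>Right modules over a not necessarily commutative ring\<close>

text \<open>
  As for the library's modules over commutative rings, extending the ring record makes
  \<^locale>\<open>abelian_group\<close> applicable, while the multiplicative fields of \<open>M\<close> carry no meaning
  (no definition below depends on them).
\<close>

record ('a, 'm) rmodule = "'m ring" +
  ract :: "['m, 'a] \<Rightarrow> 'm" (infixl \<open>\<bullet>\<index>\<close> 70)

locale right_module = R?: ring R + M?: abelian_group M
  for R :: "('a, 'r) ring_scheme" (structure) and M :: "('a, 'm, 's) rmodule_scheme" (structure) +
  assumes ract_closed [simp, intro]:
      "\<lbrakk>x \<in> carrier M; a \<in> carrier R\<rbrakk> \<Longrightarrow> x \<bullet>\<^bsub>M\<^esub> a \<in> carrier M"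
    and ract_l_distr:
      "\<lbrakk>x \<in> carrier M; y \<in> carrier M; a \<in> carrier R\<rbrakk> \<Longrightarrow>
        (x \<oplus>\<^bsub>M\<^esub> y) \<bullet>\<^bsub>M\<^esub> a = x \<bullet>\<^bsub>M\<^esub> a \<oplus>\<^bsub>M\<^esub> y \<bullet>\<^bsub>M\<^esub> a"
    and ract_r_distr:
      "\<lbrakk>x \<in> carrier M; a \<in> carrier R; b \<in> carrier R\<rbrakk> \<Longrightarrow>
        x \<bullet>\<^bsub>M\<^esub> (a \<oplus> b) = x \<bullet>\<^bsub>M\<^esub> a \<oplus>\<^bsub>M\<^esub> x \<bullet>\<^bsub>M\<^esub> b"
    and ract_assoc:
      "\<lbrakk>x \<in> carrier M; a \<in> carrier R; b \<in> carrier R\<rbrakk> \<Longrightarrow>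
        x \<bullet>\<^bsub>M\<^esub> (a \<otimes> b) = (x \<bullet>\<^bsub>M\<^esub> a) \<bullet>\<^bsub>M\<^esub> b"
    and ract_one [simp]: "x \<in> carrier M \<Longrightarrow> x \<bullet>\<^bsub>M\<^esub> \<one> = x"

definition rsubmodule :: "[('a, 'r) ring_scheme, ('a, 'm, 's) rmodule_scheme, 'm set] \<Rightarrow> bool"
  where "rsubmodule R M X \<longleftrightarrow>
    subgroup X (add_monoid M) \<and> (\<forall>x\<in>X. \<forall>a\<in>carrier R. x \<bullet>\<^bsub>M\<^esub> a \<in> X)"

definition rspan :: "[('a, 'r) ring_scheme, ('a, 'm, 's) rmodule_scheme, 'm set] \<Rightarrow> 'm set"
  where "rspan R M S = \<Inter>{X. rsubmodule R M X \<and> S \<subseteq> X}"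

definition finitely_generated :: "[('a, 'r) ring_scheme, ('a, 'm, 's) rmodule_scheme] \<Rightarrow> bool"
  where "finitely_generated R M \<longleftrightarrow>
    (\<exists>S. finite S \<and> S \<subseteq> carrier M \<and> rspan R M S = carrier M)"

definition rmod_hom ::
  "[('a, 'r) ring_scheme, ('a, 'm, 's) rmodule_scheme, ('a, 'n, 't) rmodule_scheme]
    \<Rightarrow> ('m \<Rightarrow> 'n) set"
  where "rmod_hom R M N = {f \<in> carrier M \<rightarrow> carrier N.
    (\<forall>x\<in>carrier M. \<forall>y\<in>carrier M. f (x \<oplus>\<^bsub>M\<^esub> y) = f x \<oplus>\<^bsub>N\<^esub> f y) \<and>
    (\<forall>x\<in>carrier M. \<forall>a\<in>carrier R. f (x \<bullet>\<^bsub>M\<^esub> a) = f x \<bullet>\<^bsub>N\<^esub> a)}"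

definition rmod_isomorphic ::
  "[('a, 'r) ring_scheme, ('a, 'm, 's) rmodule_scheme, ('a, 'n, 't) rmodule_scheme] \<Rightarrow> bool"
  where "rmod_isomorphic R M N \<longleftrightarrow>
    (\<exists>f \<in> rmod_hom R M N. bij_betw f (carrier M) (carrier N))"

definition rmod_sum ::
  "[('a, 'm, 's) rmodule_scheme, ('a, 'n, 't) rmodule_scheme] \<Rightarrow> ('a, 'm \<times> 'n) rmodule"
  where "rmod_sum M N =
    \<lparr>carrier = carrier M \<times> carrier N, mult = undefined, one = undefined,
     zero = (\<zero>\<^bsub>M\<^esub>, \<zero>\<^bsub>N\<^esub>),
     add = (\<lambda>(x, y) (x', y'). (x \<oplus>\<^bsub>M\<^esub> x', y \<oplus>\<^bsub>N\<^esub> y')),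
     ract = (\<lambda>(x, y) a. (x \<bullet>\<^bsub>M\<^esub> a, y \<bullet>\<^bsub>N\<^esub> a))\<rparr>"

definition free_rmod :: "[('a, 'r) ring_scheme, nat] \<Rightarrow> ('a, nat \<Rightarrow> 'a) rmodule"
  where "free_rmod R n =
    \<lparr>carrier = {..<n} \<rightarrow>\<^sub>E carrier R, mult = undefined, one = undefined,
     zero = (\<lambda>i\<in>{..<n}. \<zero>\<^bsub>R\<^esub>),
     add = (\<lambda>x y. \<lambda>i\<in>{..<n}. x i \<oplus>\<^bsub>R\<^esub> y i),
     ract = (\<lambda>x a. \<lambda>i\<in>{..<n}. x i \<otimes>\<^bsub>R\<^esub> a)\<rparr>"

text \<open>
  HOL cannot quantify over all types, so the lifting property is tested on modules whose
  elements have type \<^typ>\<open>nat \<Rightarrow> 'a\<close>. For a finitely generated module \<open>P\<close>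
  of that element type this is no restriction: it provides a splitting of an epimorphism from
  some \<^term>\<open>free_rmod R n\<close> onto \<open>P\<close>.
\<close>

definition projective :: "[('a, 'r) ring_scheme, ('a, 'm, 's) rmodule_scheme] \<Rightarrow> bool"
  where "projective R P \<longleftrightarrow>
    (\<forall>(A :: ('a, nat \<Rightarrow> 'a) rmodule) (B :: ('a, nat \<Rightarrow> 'a) rmodule).
      right_module R A \<longrightarrow> right_module R B \<longrightarrow>
      (\<forall>g \<in> rmod_hom R A B. g ` carrier A = carrier B \<longrightarrow>
        (\<forall>f \<in> rmod_hom R P B. \<exists>h \<in> rmod_hom R P A. \<forall>x\<in>carrier P. g (h x) = f x)))"

definition fg_projective :: "[('a, 'r) ring_scheme, ('a, 'm, 's) rmodule_scheme] \<Rightarrow> bool"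
  where "fg_projective R P \<longleftrightarrow>
    right_module R P \<and> finitely_generated R P \<and> projective R P"

definition vn_regular :: "('a, 'r) ring_scheme \<Rightarrow> bool"
  where "vn_regular R \<longleftrightarrow>
    ring R \<and> (\<forall>x\<in>carrier R. \<exists>y\<in>carrier R. x \<otimes>\<^bsub>R\<^esub> y \<otimes>\<^bsub>R\<^esub> x = x)"


section \<open>The monoid of finitely generated projective modules\<close>

text \<open>
  Every finitely generated projective right \<open>R\<close>-module is isomorphic to a direct summand of
  some \<^term>\<open>free_rmod R n\<close>, hence to a module with elements of type
  \<^typ>\<open>nat \<Rightarrow> 'a\<close>. Isomorphism classes are therefore formed inside that type.
  The operation \<open>[A] + [B]\<close> is the \<open>mult\<close> field of the monoid record.
  As a direct sum has a different element type, the sum of two classes collects all modules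
  isomorphic to a sum of representatives.
\<close>

definition rmod_class ::
  "[('a, 'r) ring_scheme, ('a, 'm, 's) rmodule_scheme] \<Rightarrow> ('a, nat \<Rightarrow> 'a) rmodule set"
  where "rmod_class R M = {C. fg_projective R C \<and> rmod_isomorphic R C M}"

definition V_monoid :: "('a, 'r) ring_scheme \<Rightarrow> ('a, nat \<Rightarrow> 'a) rmodule set monoid"
  where "V_monoid R =
    \<lparr>carrier = {rmod_class R A | A :: ('a, nat \<Rightarrow> 'a) rmodule. fg_projective R A},
     mult = (\<lambda>\<A> \<B>. \<Union>A\<in>\<A>. \<Union>B\<in>\<B>. rmod_class R (rmod_sum A B)),
     one = rmod_class R (free_rmod R 0)\<rparr>"


section \<open>The dimension monoid of a lattice\<close>

definition dim_gens :: "('l, 's) gorder_scheme \<Rightarrow> ('l \<times> 'l) set"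
  where "dim_gens L = {(a, b). a \<in> carrier L \<and> b \<in> carrier L \<and> a \<sqsubseteq>\<^bsub>L\<^esub> b}"

text \<open>
  The free commutative monoid on the generators consists of the finite multisets of
  generators; \<open>dim_cong\<close> is the congruence generated by the defining relations.
  Addition in \<open>Dim L\<close> is again the \<open>mult\<close> field.
\<close>

inductive dim_cong :: "('l, 's) gorder_scheme \<Rightarrow> ('l \<times> 'l) multiset \<Rightarrow> ('l \<times> 'l) multiset \<Rightarrow> bool"
  for L (structure)
  where
    D0: "a \<in> carrier L \<Longrightarrow> dim_cong L {#(a, a)#} {#}"
  | D1: "\<lbrakk>a \<in> carrier L; b \<in> carrier L; c \<in> carrier L; a \<sqsubseteq> b; b \<sqsubseteq> c\<rbrakk> \<Longrightarrow>
      dim_cong L {#(a, c)#} {#(a, b), (b, c)#}"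
  | D2: "\<lbrakk>a \<in> carrier L; b \<in> carrier L\<rbrakk> \<Longrightarrow>
      dim_cong L {#(a, a \<squnion> b)#} {#(a \<sqinter> b, b)#}"
  | refl: "set_mset m \<subseteq> dim_gens L \<Longrightarrow> dim_cong L m m"
  | sym: "dim_cong L m m' \<Longrightarrow> dim_cong L m' m"
  | trans: "\<lbrakk>dim_cong L m m'; dim_cong L m' m''\<rbrakk> \<Longrightarrow> dim_cong L m m''"
  | add: "\<lbrakk>dim_cong L m m'; dim_cong L k k'\<rbrakk> \<Longrightarrow> dim_cong L (m + k) (m' + k')"

definition dim_class :: "('l, 's) gorder_scheme \<Rightarrow> ('l \<times> 'l) multiset \<Rightarrow> ('l \<times> 'l) multiset set"
  where "dim_class L m = {m'. dim_cong L m m'}"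

definition Dim :: "('l, 's) gorder_scheme \<Rightarrow> ('l \<times> 'l) multiset set monoid"
  where "Dim L =
    \<lparr>carrier = {dim_class L m | m. set_mset m \<subseteq> dim_gens L},
     mult = (\<lambda>X Y. \<Union>m\<in>X. \<Union>k\<in>Y. dim_class L (m + k)),
     one = dim_class L {#}\<rparr>"

definition dim_interval :: "[('l, 's) gorder_scheme, 'l, 'l] \<Rightarrow> ('l \<times> 'l) multiset set"
  where "dim_interval L a b = dim_class L {#(a, b)#}"

definition dim_elem :: "[('l, 's) gorder_scheme, 'l] \<Rightarrow> ('l \<times> 'l) multiset set"
  where "dim_elem L x = dim_interval L \<bottom>\<^bsub>L\<^esub> x"


section \<open>The natural homomorphism\<close>

definition fg_submodules ::
  "[('a, 'r) ring_scheme, ('a, 'm, 's) rmodule_scheme] \<Rightarrow> 'm set gorder"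
  where "fg_submodules R M =
    \<lparr>carrier = {X. rsubmodule R M X \<and> finitely_generated R (M\<lparr>carrier := X\<rparr>)},
     eq = (=), le = (\<subseteq>)\<rparr>"

text \<open>
  In \<^const>\<open>Group.hom\<close> preservation of the unit is not required, so it is added here.
  Extensionality makes a homomorphism unique as a HOL function.
\<close>

definition is_natural_hom ::
  "[('a, 'r) ring_scheme, nat,
    ((nat \<Rightarrow> 'a) set \<times> (nat \<Rightarrow> 'a) set) multiset set \<Rightarrow> ('a, nat \<Rightarrow> 'a) rmodule set] \<Rightarrow> bool"
  where "is_natural_hom R n \<pi> \<longleftrightarrow>
    (let L = fg_submodules R (free_rmod R n) in
      \<pi> \<in> extensional (carrier (Dim L)) \<and>
      \<pi> \<in> hom (Dim L) (V_monoid R) \<and>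
      \<pi> \<one>\<^bsub>Dim L\<^esub> = \<one>\<^bsub>V_monoid R\<^esub> \<and>
      (\<forall>X \<in> carrier L. \<pi> (dim_elem L X) = rmod_class R ((free_rmod R n)\<lparr>carrier := X\<rparr>)))"

end

theory Submission
  imports Defs "HOL-Algebra.AbelCoset"
begin

text \<open>
  Over a regular ring \<open>R\<close> every homomorphism \<open>f\<close> between finitely generated free modules has a
  quasi-inverse \<open>g\<close> with \<open>f g f = f\<close> (\<open>free_hom_quasi_inverse\<close>), and the same then holds for
  finitely generated projective modules. Hence images, kernels, sums and intersections of finitely
  generated submodules are direct summands, and the submodule lattice is complemented.

  Sending \<open>\<Delta>(A, B)\<close> to the class of a complement of \<open>A\<close> in \<open>B\<close>, a model of \<open>B / A\<close>, respects
  the defining relations: (D1) says that complements can be composed (\<open>dsum_assoc\<close>), and (D2) that a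
  complement of \<open>A \<inter> B\<close> in \<open>B\<close> is also one of \<open>A\<close> in \<open>A + B\<close> (\<open>dsum_join\<close>). This
  gives the natural homomorphism; it is unique because each \<open>\<Delta>(A, B)\<close> equals \<open>\<Delta>(C)\<close> for a
  complement \<open>C\<close>.

  Surjectivity: cutting a submodule of a free module along the coordinates writes it as a direct
  sum of modules isomorphic to right ideals, and those embed in \<open>nR\<close>.

  Injectivity rests on two facts. First, isomorphic submodules \<open>X\<close> and \<open>Y\<close> of \<open>nR\<close> satisfy
  \<open>\<Delta>(X) = \<Delta>(Y)\<close> if \<open>n \<ge> 2\<close> (\<open>isomorphic_submodule_cong\<close>). If \<open>X \<inter> Y = 0\<close>, the graph
  of an isomorphism is a common complement of \<open>X\<close> and \<open>Y\<close> in \<open>X + Y\<close>, and (D2) applies twice.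
  In general \<open>X\<close> and \<open>Y\<close> are cut into isomorphic pieces on which some coordinate is injective; such
  a piece is disjoint from its copy in any other coordinate, and a second coordinate is exactly
  what \<open>n \<ge> 2\<close> provides. Secondly, \<open>V(R)\<close> is a refinement monoid (\<open>V_refinement\<close>): two
  decompositions of one module have a common refinement. So if \<open>[X\<^sub>1] + \<dots> + [X\<^sub>k]\<close> and
  \<open>[Y\<^sub>1] + \<dots> + [Y\<^sub>l]\<close> agree in \<open>V(R)\<close>, all \<open>X\<^sub>i\<close> and \<open>Y\<^sub>j\<close> can be cut into pairwise isomorphic
  pieces, and the first fact identifies \<open>\<Delta>(X\<^sub>1) + \<dots> + \<Delta>(X\<^sub>k)\<close> with
  \<open>\<Delta>(Y\<^sub>1) + \<dots> + \<Delta>(Y\<^sub>l)\<close>.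
\<close>

section \<open>Right modules and their homomorphisms\<close>

abbreviation restr :: "('a, 'm, 's) rmodule_scheme \<Rightarrow> 'm set \<Rightarrow> ('a, 'm, 's) rmodule_scheme"
    (infixl \<open>\<restriction>\<close> 72)
  where "M \<restriction> X \<equiv> M\<lparr>carrier := X\<rparr>"

lemma rmod_homI:
  assumes "\<And>x. x \<in> carrier M \<Longrightarrow> f x \<in> carrier N"
    and "\<And>x y. \<lbrakk>x \<in> carrier M; y \<in> carrier M\<rbrakk> \<Longrightarrow> f (x \<oplus>\<^bsub>M\<^esub> y) = f x \<oplus>\<^bsub>N\<^esub> f y"
    and "\<And>x a. \<lbrakk>x \<in> carrier M; a \<in> carrier R\<rbrakk> \<Longrightarrow> f (x \<bullet>\<^bsub>M\<^esub> a) = f x \<bullet>\<^bsub>N\<^esub> a"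
  shows "f \<in> rmod_hom R M N"
  using assms unfolding rmod_hom_def by blast

lemma rmod_hom_closed: "\<lbrakk>f \<in> rmod_hom R M N; x \<in> carrier M\<rbrakk> \<Longrightarrow> f x \<in> carrier N"
  unfolding rmod_hom_def by blast

lemma rmod_hom_add:
  "\<lbrakk>f \<in> rmod_hom R M N; x \<in> carrier M; y \<in> carrier M\<rbrakk> \<Longrightarrow> f (x \<oplus>\<^bsub>M\<^esub> y) = f x \<oplus>\<^bsub>N\<^esub> f y"
  unfolding rmod_hom_def by blast

lemma rmod_hom_ract:
  "\<lbrakk>f \<in> rmod_hom R M N; x \<in> carrier M; a \<in> carrier R\<rbrakk> \<Longrightarrow> f (x \<bullet>\<^bsub>M\<^esub> a) = f x \<bullet>\<^bsub>N\<^esub> a"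
  unfolding rmod_hom_def by blast

lemma rmod_hom_id: "(\<lambda>x. x) \<in> rmod_hom R M M"
  by (rule rmod_homI) auto

lemma rmod_hom_comp:
  assumes "f \<in> rmod_hom R M N" "g \<in> rmod_hom R N P"
  shows "(\<lambda>x. g (f x)) \<in> rmod_hom R M P"
  using assms unfolding rmod_hom_def by (auto simp: Pi_iff)

lemma rmod_hom_restr:
  "\<lbrakk>f \<in> rmod_hom R M N; X \<subseteq> carrier M\<rbrakk> \<Longrightarrow> f \<in> rmod_hom R (M \<restriction> X) N"
  by (rule rmod_homI) (auto simp: rmod_hom_closed rmod_hom_add rmod_hom_ract subset_iff)

lemma rmod_hom_corestr:
  "\<lbrakk>f \<in> rmod_hom R M N; f ` carrier M \<subseteq> Y\<rbrakk> \<Longrightarrow> f \<in> rmod_hom R M (N \<restriction> Y)"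
  by (rule rmod_homI) (auto simp: rmod_hom_closed rmod_hom_add rmod_hom_ract subset_iff)

lemma rmod_hom_incl:
  "\<lbrakk>f \<in> rmod_hom R M (N \<restriction> Y); Y \<subseteq> carrier N\<rbrakk> \<Longrightarrow> f \<in> rmod_hom R M N"
  using rmod_hom_comp[of f R M "N \<restriction> Y" "\<lambda>x. x" N] rmod_hom_restr[OF rmod_hom_id, of Y N R] by simp

context right_module
begin

lemma ract_zero [simp]: "x \<in> carrier M \<Longrightarrow> x \<bullet>\<^bsub>M\<^esub> \<zero> = \<zero>\<^bsub>M\<^esub>"
proof -
  assume x: "x \<in> carrier M"
  have "x \<bullet>\<^bsub>M\<^esub> \<zero> \<oplus>\<^bsub>M\<^esub> x \<bullet>\<^bsub>M\<^esub> \<zero> = x \<bullet>\<^bsub>M\<^esub> \<zero>"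
    using ract_r_distr[OF x, of \<zero> \<zero>] by simp
  then show ?thesis using M.add.l_cancel_one[of "x \<bullet>\<^bsub>M\<^esub> \<zero>" "x \<bullet>\<^bsub>M\<^esub> \<zero>"] x by simp
qed

lemma ract_minus_one: "x \<in> carrier M \<Longrightarrow> x \<bullet>\<^bsub>M\<^esub> (\<ominus> \<one>) = \<ominus>\<^bsub>M\<^esub> x"
proof -
  assume x: "x \<in> carrier M"
  have "x \<bullet>\<^bsub>M\<^esub> (\<ominus> \<one>) \<oplus>\<^bsub>M\<^esub> x = x \<bullet>\<^bsub>M\<^esub> (\<ominus> \<one> \<oplus> \<one>)"
    using x by (subst ract_r_distr) auto
  also have "\<dots> = \<zero>\<^bsub>M\<^esub>" using x by (simp add: R.l_neg)
  finally show ?thesis using x by (intro M.minus_equality[symmetric]) auto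
qed

lemma zero_ract [simp]: "a \<in> carrier R \<Longrightarrow> \<zero>\<^bsub>M\<^esub> \<bullet>\<^bsub>M\<^esub> a = \<zero>\<^bsub>M\<^esub>"
  using ract_zero[of "\<zero>\<^bsub>M\<^esub>"] ract_assoc[of "\<zero>\<^bsub>M\<^esub>" \<zero> a] by simp

lemma minus_ract: "\<lbrakk>x \<in> carrier M; a \<in> carrier R\<rbrakk> \<Longrightarrow> (\<ominus>\<^bsub>M\<^esub> x) \<bullet>\<^bsub>M\<^esub> a = \<ominus>\<^bsub>M\<^esub> (x \<bullet>\<^bsub>M\<^esub> a)"
proof -
  assume x: "x \<in> carrier M" and a: "a \<in> carrier R"
  have "(\<ominus>\<^bsub>M\<^esub> x) \<bullet>\<^bsub>M\<^esub> a \<oplus>\<^bsub>M\<^esub> x \<bullet>\<^bsub>M\<^esub> a = (\<ominus>\<^bsub>M\<^esub> x \<oplus>\<^bsub>M\<^esub> x) \<bullet>\<^bsub>M\<^esub> a"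
    using x a by (subst ract_l_distr) auto
  also have "\<dots> = \<zero>\<^bsub>M\<^esub>" using x a by (simp add: M.l_neg)
  finally show ?thesis using x a by (intro M.minus_equality[symmetric]) auto
qed

lemma add_diff_cancel: "\<lbrakk>x \<in> carrier M; y \<in> carrier M\<rbrakk> \<Longrightarrow> x \<oplus>\<^bsub>M\<^esub> (y \<ominus>\<^bsub>M\<^esub> x) = y"
  using M.a_comm[of y "\<ominus>\<^bsub>M\<^esub> x"] by (simp add: a_minus_def M.r_neg2)

lemma diff_self [simp]: "x \<in> carrier M \<Longrightarrow> x \<ominus>\<^bsub>M\<^esub> x = \<zero>\<^bsub>M\<^esub>"
  by (simp add: a_minus_def M.r_neg)

lemma diff_zero [simp]: "x \<in> carrier M \<Longrightarrow> x \<ominus>\<^bsub>M\<^esub> \<zero>\<^bsub>M\<^esub> = x"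
  by (simp add: a_minus_def)

lemma diff_eq_zeroD: "\<lbrakk>x \<ominus>\<^bsub>M\<^esub> y = \<zero>\<^bsub>M\<^esub>; x \<in> carrier M; y \<in> carrier M\<rbrakk> \<Longrightarrow> x = y"
  using add_diff_cancel[of y x] by simp

lemma add_diff_add:
  "\<lbrakk>x \<in> carrier M; y \<in> carrier M; x' \<in> carrier M; y' \<in> carrier M\<rbrakk> \<Longrightarrow>
    (x \<oplus>\<^bsub>M\<^esub> y) \<ominus>\<^bsub>M\<^esub> (x' \<oplus>\<^bsub>M\<^esub> y') = (x \<ominus>\<^bsub>M\<^esub> x') \<oplus>\<^bsub>M\<^esub> (y \<ominus>\<^bsub>M\<^esub> y')"
  by (simp add: a_minus_def M.minus_add M.a_ac)

lemma diff_ract: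
  "\<lbrakk>x \<in> carrier M; y \<in> carrier M; a \<in> carrier R\<rbrakk> \<Longrightarrow>
    (x \<ominus>\<^bsub>M\<^esub> y) \<bullet>\<^bsub>M\<^esub> a = x \<bullet>\<^bsub>M\<^esub> a \<ominus>\<^bsub>M\<^esub> y \<bullet>\<^bsub>M\<^esub> a"
  by (simp add: a_minus_def ract_l_distr minus_ract)

lemma rsubmoduleI:
  assumes sub: "X \<subseteq> carrier M" and z: "\<zero>\<^bsub>M\<^esub> \<in> X"
    and add: "\<And>x y. \<lbrakk>x \<in> X; y \<in> X\<rbrakk> \<Longrightarrow> x \<oplus>\<^bsub>M\<^esub> y \<in> X"
    and act: "\<And>x a. \<lbrakk>x \<in> X; a \<in> carrier R\<rbrakk> \<Longrightarrow> x \<bullet>\<^bsub>M\<^esub> a \<in> X"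
  shows "rsubmodule R M X"
proof -
  \<comment> \<open>negation is the action of \<open>-1\<close>\<close>
  have "inv\<^bsub>add_monoid M\<^esub> x \<in> X" if "x \<in> X" for x
    using act[OF that, of "\<ominus> \<one>"] ract_minus_one[of x] that sub
    by (auto simp: a_inv_def[symmetric, of M])
  then show ?thesis
    unfolding rsubmodule_def using assms by (auto intro!: M.add.subgroupI simp: a_inv_def)
qed

end

lemma rsubmoduleD:
  assumes "rsubmodule R M X"
  shows rsubmodule_subset: "X \<subseteq> carrier M"
    and rsubmodule_zero: "\<zero>\<^bsub>M\<^esub> \<in> X"
    and rsubmodule_add: "\<And>x y. \<lbrakk>x \<in> X; y \<in> X\<rbrakk> \<Longrightarrow> x \<oplus>\<^bsub>M\<^esub> y \<in> X"
    and rsubmodule_ract: "\<And>x a. \<lbrakk>x \<in> X; a \<in> carrier R\<rbrakk> \<Longrightarrow> x \<bullet>\<^bsub>M\<^esub> a \<in> X"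
    and rsubmodule_neg: "\<And>x. x \<in> X \<Longrightarrow> \<ominus>\<^bsub>M\<^esub> x \<in> X"
    and rsubmodule_diff: "\<And>x y. \<lbrakk>x \<in> X; y \<in> X\<rbrakk> \<Longrightarrow> x \<ominus>\<^bsub>M\<^esub> y \<in> X"
proof -
  have S: "subgroup X (add_monoid M)" and act: "\<forall>x\<in>X. \<forall>a\<in>carrier R. x \<bullet>\<^bsub>M\<^esub> a \<in> X"
    using assms unfolding rsubmodule_def by blast+
  show "X \<subseteq> carrier M" "\<zero>\<^bsub>M\<^esub> \<in> X" using subgroup.subset[OF S] subgroup.one_closed[OF S] by simp_all
  show add: "x \<oplus>\<^bsub>M\<^esub> y \<in> X" if "x \<in> X" "y \<in> X" for x y
    using subgroup.m_closed[OF S that] by simp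
  show "x \<bullet>\<^bsub>M\<^esub> a \<in> X" if "x \<in> X" "a \<in> carrier R" for x a using act that by blast
  show neg: "\<ominus>\<^bsub>M\<^esub> x \<in> X" if "x \<in> X" for x
    using subgroup.m_inv_closed[OF S that] by (simp add: a_inv_def)
  show "x \<ominus>\<^bsub>M\<^esub> y \<in> X" if "x \<in> X" "y \<in> X" for x y
    using add neg that by (simp add: a_minus_def)
qed

lemma rsubmodule_carrier: "right_module R M \<Longrightarrow> rsubmodule R M (carrier M)"
proof -
  assume "right_module R M"
  then interpret right_module R M .
  show ?thesis by (rule rsubmoduleI) auto
qed

lemma rsubmodule_zero_set: "right_module R M \<Longrightarrow> rsubmodule R M {\<zero>\<^bsub>M\<^esub>}"
proof -
  assume "right_module R M"
  then interpret right_module R M .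
  show ?thesis by (rule rsubmoduleI) auto
qed

lemma right_module_restr:
  assumes M: "right_module R M" and X: "rsubmodule R M X"
  shows "right_module R (M \<restriction> X)"
proof -
  interpret right_module R M by fact
  have sub: "\<And>x. x \<in> X \<Longrightarrow> x \<in> carrier M" using rsubmodule_subset[OF X] by blast
  have "abelian_group (M \<restriction> X)"
  proof (rule abelian_groupI)
    fix x y z
    assume "x \<in> carrier (M \<restriction> X)" "y \<in> carrier (M \<restriction> X)"
    then show "x \<oplus>\<^bsub>M \<restriction> X\<^esub> y = y \<oplus>\<^bsub>M \<restriction> X\<^esub> x" using sub M.a_comm by simp
  next
    fix x assume "x \<in> carrier (M \<restriction> X)"
    then show "\<exists>y\<in>carrier (M \<restriction> X). y \<oplus>\<^bsub>M \<restriction> X\<^esub> x = \<zero>\<^bsub>M \<restriction> X\<^esub>"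
      using rsubmodule_neg[OF X, of x] sub M.l_neg by auto
  qed (auto simp: rsubmodule_add[OF X] rsubmodule_zero[OF X] M.a_assoc sub)
  then show ?thesis
    by (intro right_module.intro right_module_axioms.intro)
      (auto simp: R.ring_axioms rsubmodule_ract[OF X] sub ract_l_distr ract_r_distr ract_assoc)
qed

lemma rsubmodule_restr_iff:
  assumes M: "right_module R M" and X: "rsubmodule R M X"
  shows "rsubmodule R (M \<restriction> X) Y \<longleftrightarrow> rsubmodule R M Y \<and> Y \<subseteq> X"
proof -
  interpret M: right_module R M by fact
  interpret X: right_module R "M \<restriction> X" using right_module_restr[OF assms] .
  show ?thesis
  proof safe
    assume Y: "rsubmodule R (M \<restriction> X) Y"
    show "rsubmodule R M Y"
      using rsubmoduleD[OF Y] rsubmodule_subset[OF X] by (intro M.rsubmoduleI) auto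
    show "\<And>y. y \<in> Y \<Longrightarrow> y \<in> X" using rsubmodule_subset[OF Y] by auto
  next
    assume Y: "rsubmodule R M Y" "Y \<subseteq> X"
    show "rsubmodule R (M \<restriction> X) Y"
      using rsubmoduleD[OF Y(1)] Y(2) by (intro X.rsubmoduleI) auto
  qed
qed

locale two_modules = M?: right_module R M + N?: right_module R N
  for R :: "('a, 'r) ring_scheme" (structure)
    and M :: "('a, 'm, 's) rmodule_scheme" and N :: "('a, 'n, 't) rmodule_scheme"
begin

lemma hom_zero: "f \<in> rmod_hom R M N \<Longrightarrow> f \<zero>\<^bsub>M\<^esub> = \<zero>\<^bsub>N\<^esub>"
  using rmod_hom_ract[of f R M N "\<zero>\<^bsub>M\<^esub>" \<zero>] by (simp add: rmod_hom_closed)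

lemma hom_neg: "\<lbrakk>f \<in> rmod_hom R M N; x \<in> carrier M\<rbrakk> \<Longrightarrow> f (\<ominus>\<^bsub>M\<^esub> x) = \<ominus>\<^bsub>N\<^esub> f x"
  using rmod_hom_ract[of f R M N x "\<ominus> \<one>"]
  by (simp add: rmod_hom_closed M.ract_minus_one N.ract_minus_one)

lemma hom_diff:
  "\<lbrakk>f \<in> rmod_hom R M N; x \<in> carrier M; y \<in> carrier M\<rbrakk> \<Longrightarrow>
    f (x \<ominus>\<^bsub>M\<^esub> y) = f x \<ominus>\<^bsub>N\<^esub> f y"
  by (simp add: a_minus_def rmod_hom_add hom_neg)

lemma sum_hom:
  "\<lbrakk>f \<in> rmod_hom R M N; g \<in> rmod_hom R M N\<rbrakk> \<Longrightarrow> (\<lambda>x. f x \<oplus>\<^bsub>N\<^esub> g x) \<in> rmod_hom R M N"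
  by (rule rmod_homI) (auto simp: rmod_hom_closed rmod_hom_add rmod_hom_ract N.ract_l_distr N.M.a_assoc N.M.a_lcomm)

lemma diff_hom:
  "\<lbrakk>f \<in> rmod_hom R M N; g \<in> rmod_hom R M N\<rbrakk> \<Longrightarrow> (\<lambda>x. f x \<ominus>\<^bsub>N\<^esub> g x) \<in> rmod_hom R M N"
  by (rule rmod_homI)
    (auto simp: rmod_hom_closed rmod_hom_add rmod_hom_ract N.diff_ract N.add_diff_add)

lemma zero_hom: "(\<lambda>x. \<zero>\<^bsub>N\<^esub>) \<in> rmod_hom R M N"
  by (rule rmod_homI) auto

lemma image_rsubmodule:
  assumes f: "f \<in> rmod_hom R M N" and X: "rsubmodule R M X"
  shows "rsubmodule R N (f ` X)"
proof (rule N.rsubmoduleI)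
  note D = rsubmoduleD[OF X]
  show "f ` X \<subseteq> carrier N" using rmod_hom_closed[OF f] D(1) by blast
  show "\<zero>\<^bsub>N\<^esub> \<in> f ` X" using hom_zero[OF f] D(2) by (metis imageI)
  show "x \<oplus>\<^bsub>N\<^esub> y \<in> f ` X" if "x \<in> f ` X" "y \<in> f ` X" for x y
    using that rmod_hom_add[OF f] D(1,3) by (smt (verit) imageE imageI subsetD)
  show "x \<bullet>\<^bsub>N\<^esub> a \<in> f ` X" if "x \<in> f ` X" "a \<in> carrier R" for x a
    using that rmod_hom_ract[OF f] D(1,4) by (smt (verit) imageE imageI subsetD)
qed

lemma inj_on_hom_iff:
  assumes f: "f \<in> rmod_hom R M N" and X: "rsubmodule R M X"
  shows "inj_on f X \<longleftrightarrow> (\<forall>x\<in>X. f x = \<zero>\<^bsub>N\<^esub> \<longrightarrow> x = \<zero>\<^bsub>M\<^esub>)"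
proof
  assume "inj_on f X"
  then show "\<forall>x\<in>X. f x = \<zero>\<^bsub>N\<^esub> \<longrightarrow> x = \<zero>\<^bsub>M\<^esub>"
    using hom_zero[OF f] rsubmodule_zero[OF X] by (metis inj_onD)
next
  assume *: "\<forall>x\<in>X. f x = \<zero>\<^bsub>N\<^esub> \<longrightarrow> x = \<zero>\<^bsub>M\<^esub>"
  show "inj_on f X"
  proof (rule inj_onI)
    fix x y assume xy: "x \<in> X" "y \<in> X" "f x = f y"
    then have c: "x \<in> carrier M" "y \<in> carrier M" using rsubmodule_subset[OF X] by auto
    then have "f (x \<ominus>\<^bsub>M\<^esub> y) = \<zero>\<^bsub>N\<^esub>" using xy hom_diff[OF f c] rmod_hom_closed[OF f] by simp
    then have "x \<ominus>\<^bsub>M\<^esub> y = \<zero>\<^bsub>M\<^esub>" using * rsubmodule_diff[OF X] xy by blast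
    then show "x = y" using M.diff_eq_zeroD c by blast
  qed
qed

end

lemma rmod_isomorphicI:
  "\<lbrakk>f \<in> rmod_hom R M N; bij_betw f (carrier M) (carrier N)\<rbrakk> \<Longrightarrow> rmod_isomorphic R M N"
  unfolding rmod_isomorphic_def by blast

lemma rmod_isomorphic_trans:
  "\<lbrakk>rmod_isomorphic R M N; rmod_isomorphic R N P\<rbrakk> \<Longrightarrow> rmod_isomorphic R M P"
proof -
  assume "rmod_isomorphic R M N" "rmod_isomorphic R N P"
  then obtain f g where f: "f \<in> rmod_hom R M N" "bij_betw f (carrier M) (carrier N)"
    and g: "g \<in> rmod_hom R N P" "bij_betw g (carrier N) (carrier P)"
    unfolding rmod_isomorphic_def by blast
  show ?thesis
    using rmod_isomorphicI[OF rmod_hom_comp[OF f(1) g(1)]] bij_betw_trans[OF f(2) g(2)]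
    by (simp add: comp_def)
qed

lemma inv_rmod_hom:
  assumes "right_module R M" and f: "f \<in> rmod_hom R M N" and b: "bij_betw f (carrier M) (carrier N)"
  shows "inv_into (carrier M) f \<in> rmod_hom R N M"
proof -
  interpret right_module R M by fact
  have inj: "inj_on f (carrier M)" and im: "f ` carrier M = carrier N"
    using b by (auto simp: bij_betw_def)
  show ?thesis
  proof (rule rmod_homI)
    fix x assume "x \<in> carrier N"
    then show "inv_into (carrier M) f x \<in> carrier M" using im by (auto intro: inv_into_into)
  next
    fix x y assume "x \<in> carrier N" "y \<in> carrier N"
    then obtain x' y' where "x = f x'" "y = f y'" "x' \<in> carrier M" "y' \<in> carrier M"
      using im by blast
    then show "inv_into (carrier M) f (x \<oplus>\<^bsub>N\<^esub> y)
        = inv_into (carrier M) f x \<oplus>\<^bsub>M\<^esub> inv_into (carrier M) f y"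
      by (simp add: rmod_hom_add[OF f, symmetric] inj)
  next
    fix x a assume "x \<in> carrier N" "a \<in> carrier R"
    then obtain x' where "x = f x'" "x' \<in> carrier M" "a \<in> carrier R"
      using im by blast
    then show "inv_into (carrier M) f (x \<bullet>\<^bsub>N\<^esub> a) = inv_into (carrier M) f x \<bullet>\<^bsub>M\<^esub> a"
      by (simp add: rmod_hom_ract[OF f, symmetric] inj)
  qed
qed

lemma rmod_isomorphic_sym:
  "\<lbrakk>right_module R M; rmod_isomorphic R M N\<rbrakk> \<Longrightarrow> rmod_isomorphic R N M"
  unfolding rmod_isomorphic_def by (blast intro: inv_rmod_hom bij_betw_inv_into)

section \<open>Free modules\<close>

text \<open>
  The module \<open>R\<^sub>R\<close>. Unlike the isomorphic free module of rank one it has ring elements as elements,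
  so that the image of a submodule under a coordinate projection is a right ideal.
\<close>

definition ring_rmod :: "('a, 'r) ring_scheme \<Rightarrow> ('a, 'a) rmodule"
  where "ring_rmod R =
    \<lparr>carrier = carrier R, mult = undefined, one = undefined, zero = \<zero>\<^bsub>R\<^esub>, add = (\<oplus>\<^bsub>R\<^esub>), ract = (\<otimes>\<^bsub>R\<^esub>)\<rparr>"

lemma ring_rmod_simps [simp]:
  "carrier (ring_rmod R) = carrier R" "\<zero>\<^bsub>ring_rmod R\<^esub> = \<zero>\<^bsub>R\<^esub>"
  "x \<oplus>\<^bsub>ring_rmod R\<^esub> y = x \<oplus>\<^bsub>R\<^esub> y" "x \<bullet>\<^bsub>ring_rmod R\<^esub> a = x \<otimes>\<^bsub>R\<^esub> a"
  by (simp_all add: ring_rmod_def)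

lemma free_rmod_carrier: "carrier (free_rmod R n) = {..<n} \<rightarrow>\<^sub>E carrier R"
  by (simp add: free_rmod_def)

lemma free_rmod_simps [simp]:
  "i < n \<Longrightarrow> \<zero>\<^bsub>free_rmod R n\<^esub> i = \<zero>\<^bsub>R\<^esub>"
  "i < n \<Longrightarrow> (x \<oplus>\<^bsub>free_rmod R n\<^esub> y) i = x i \<oplus>\<^bsub>R\<^esub> y i"
  "i < n \<Longrightarrow> (x \<bullet>\<^bsub>free_rmod R n\<^esub> a) i = x i \<otimes>\<^bsub>R\<^esub> a"
  by (simp_all add: free_rmod_def)

lemma free_rmod_eqI:
  "\<lbrakk>x \<in> carrier (free_rmod R n); y \<in> carrier (free_rmod R n); \<And>i. i < n \<Longrightarrow> x i = y i\<rbrakk> \<Longrightarrow> x = y"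
  unfolding free_rmod_carrier by (rule PiE_ext) auto

lemma free_rmod_coord: "\<lbrakk>x \<in> carrier (free_rmod R n); i < n\<rbrakk> \<Longrightarrow> x i \<in> carrier R"
  by (auto simp: free_rmod_carrier PiE_def Pi_iff)

definition unit_vec :: "('a, 'r) ring_scheme \<Rightarrow> nat \<Rightarrow> nat \<Rightarrow> 'a \<Rightarrow> nat \<Rightarrow> 'a"
  where "unit_vec R n i a = (\<lambda>j\<in>{..<n}. if j = i then a else \<zero>\<^bsub>R\<^esub>)"

lemma unit_vec_nth [simp]: "j < n \<Longrightarrow> unit_vec R n i a j = (if j = i then a else \<zero>\<^bsub>R\<^esub>)"
  by (simp add: unit_vec_def)

primrec lincomb :: "('a, 'm, 's) rmodule_scheme \<Rightarrow> (nat \<Rightarrow> 'm) \<Rightarrow> nat \<Rightarrow> (nat \<Rightarrow> 'a) \<Rightarrow> 'm"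
  where
    "lincomb M u 0 y = \<zero>\<^bsub>M\<^esub>"
  | "lincomb M u (Suc k) y = lincomb M u k y \<oplus>\<^bsub>M\<^esub> u k \<bullet>\<^bsub>M\<^esub> y k"

lemma lincomb_cong: "(\<And>i. i < k \<Longrightarrow> u i = v i \<and> y i = z i) \<Longrightarrow> lincomb M u k y = lincomb M v k z"
  by (induction k) auto

context ring
begin

lemma right_module_ring: "right_module R (ring_rmod R)"
proof -
  have "abelian_group (ring_rmod R)"
    by (rule abelian_groupI) (auto simp: a_ac intro!: bexI[of _ "\<ominus> x" for x] l_neg)
  then show ?thesis
    by (intro right_module.intro right_module_axioms.intro)
      (auto simp: ring_axioms l_distr r_distr m_assoc)
qed

lemma right_module_free: "right_module R (free_rmod R n)"
proof -
  have cl: "x \<oplus>\<^bsub>free_rmod R n\<^esub> y \<in> carrier (free_rmod R n)"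
    if "x \<in> carrier (free_rmod R n)" "y \<in> carrier (free_rmod R n)" for x y
    using that by (auto simp: free_rmod_def PiE_def Pi_iff)
  have zcl: "\<zero>\<^bsub>free_rmod R n\<^esub> \<in> carrier (free_rmod R n)" by (auto simp: free_rmod_def)
  have acl: "x \<bullet>\<^bsub>free_rmod R n\<^esub> a \<in> carrier (free_rmod R n)"
    if "x \<in> carrier (free_rmod R n)" "a \<in> carrier R" for x a
    using that by (auto simp: free_rmod_def PiE_def Pi_iff)
  note c = free_rmod_coord
  have "abelian_group (free_rmod R n)"
  proof (rule abelian_groupI)
    fix x assume x: "x \<in> carrier (free_rmod R n)"
    define y where "y = (\<lambda>i\<in>{..<n}. \<ominus> (x i))"
    have y: "y \<in> carrier (free_rmod R n)" using c[OF x] by (auto simp: y_def free_rmod_carrier)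
    have "y \<oplus>\<^bsub>free_rmod R n\<^esub> x = \<zero>\<^bsub>free_rmod R n\<^esub>"
      by (rule free_rmod_eqI[OF cl[OF y x] zcl]) (use c[OF x] in \<open>simp add: y_def l_neg\<close>)
    then show "\<exists>y\<in>carrier (free_rmod R n). y \<oplus>\<^bsub>free_rmod R n\<^esub> x = \<zero>\<^bsub>free_rmod R n\<^esub>"
      using y by blast
  next
    fix x y z
    assume x: "x \<in> carrier (free_rmod R n)" and y: "y \<in> carrier (free_rmod R n)"
      and z: "z \<in> carrier (free_rmod R n)"
    show "x \<oplus>\<^bsub>free_rmod R n\<^esub> y \<oplus>\<^bsub>free_rmod R n\<^esub> z = x \<oplus>\<^bsub>free_rmod R n\<^esub> (y \<oplus>\<^bsub>free_rmod R n\<^esub> z)"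
      by (rule free_rmod_eqI[OF cl[OF cl[OF x y] z] cl[OF x cl[OF y z]]])
        (use c[OF x] c[OF y] c[OF z] in \<open>simp add: a_assoc\<close>)
  next
    fix x y
    assume x: "x \<in> carrier (free_rmod R n)" and y: "y \<in> carrier (free_rmod R n)"
    show "x \<oplus>\<^bsub>free_rmod R n\<^esub> y = y \<oplus>\<^bsub>free_rmod R n\<^esub> x"
      by (rule free_rmod_eqI[OF cl[OF x y] cl[OF y x]])
        (use c[OF x] c[OF y] in \<open>simp add: a_comm\<close>)
  next
    fix x assume x: "x \<in> carrier (free_rmod R n)"
    show "\<zero>\<^bsub>free_rmod R n\<^esub> \<oplus>\<^bsub>free_rmod R n\<^esub> x = x"
      by (rule free_rmod_eqI[OF cl[OF zcl x] x]) (use c[OF x] in simp)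
  qed (use cl zcl in blast)+
  moreover have "right_module_axioms R (free_rmod R n)"
  proof (rule right_module_axioms.intro)
    fix x y a
    assume x: "x \<in> carrier (free_rmod R n)" and y: "y \<in> carrier (free_rmod R n)" and a: "a \<in> carrier R"
    show "(x \<oplus>\<^bsub>free_rmod R n\<^esub> y) \<bullet>\<^bsub>free_rmod R n\<^esub> a
        = x \<bullet>\<^bsub>free_rmod R n\<^esub> a \<oplus>\<^bsub>free_rmod R n\<^esub> y \<bullet>\<^bsub>free_rmod R n\<^esub> a"
      by (rule free_rmod_eqI[OF acl[OF cl[OF x y] a] cl[OF acl[OF x a] acl[OF y a]]])
        (use c[OF x] c[OF y] a in \<open>simp add: l_distr\<close>)
  next
    fix x a b
    assume x: "x \<in> carrier (free_rmod R n)" and a: "a \<in> carrier R" and b: "b \<in> carrier R"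
    show "x \<bullet>\<^bsub>free_rmod R n\<^esub> (a \<oplus> b) = x \<bullet>\<^bsub>free_rmod R n\<^esub> a \<oplus>\<^bsub>free_rmod R n\<^esub> x \<bullet>\<^bsub>free_rmod R n\<^esub> b"
      by (rule free_rmod_eqI[OF acl[OF x add.m_closed[OF a b]] cl[OF acl[OF x a] acl[OF x b]]])
        (use c[OF x] a b in \<open>simp add: r_distr\<close>)
    show "x \<bullet>\<^bsub>free_rmod R n\<^esub> (a \<otimes> b) = x \<bullet>\<^bsub>free_rmod R n\<^esub> a \<bullet>\<^bsub>free_rmod R n\<^esub> b"
      by (rule free_rmod_eqI[OF acl[OF x m_closed[OF a b]] acl[OF acl[OF x a] b]])
        (use c[OF x] a b in \<open>simp add: m_assoc\<close>)
  next
    fix x assume x: "x \<in> carrier (free_rmod R n)"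
    show "x \<bullet>\<^bsub>free_rmod R n\<^esub> \<one> = x"
      by (rule free_rmod_eqI[OF acl[OF x one_closed] x]) (use c[OF x] in simp)
  qed (use acl in blast)
  ultimately show ?thesis by (intro right_module.intro ring_axioms)
qed

lemma unit_vec_closed [intro]: "a \<in> carrier R \<Longrightarrow> unit_vec R n i a \<in> carrier (free_rmod R n)"
  by (auto simp: unit_vec_def free_rmod_carrier)

lemma coord_hom: "i < n \<Longrightarrow> (\<lambda>x. x i) \<in> rmod_hom R (free_rmod R n) (ring_rmod R)"
  by (rule rmod_homI) (auto simp: free_rmod_coord)

lemma unit_vec_hom: "unit_vec R n i \<in> rmod_hom R (ring_rmod R) (free_rmod R n)"
proof -
  interpret F: right_module R "free_rmod R n" by (rule right_module_free)
  show ?thesis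
  proof (rule rmod_homI)
    fix x y assume "x \<in> carrier (ring_rmod R)" "y \<in> carrier (ring_rmod R)"
    then show "unit_vec R n i (x \<oplus>\<^bsub>ring_rmod R\<^esub> y)
        = unit_vec R n i x \<oplus>\<^bsub>free_rmod R n\<^esub> unit_vec R n i y"
      by (intro free_rmod_eqI F.M.a_closed unit_vec_closed) auto
  next
    fix x a assume "x \<in> carrier (ring_rmod R)" "a \<in> carrier R"
    then show "unit_vec R n i (x \<bullet>\<^bsub>ring_rmod R\<^esub> a) = unit_vec R n i x \<bullet>\<^bsub>free_rmod R n\<^esub> a"
      by (intro free_rmod_eqI F.ract_closed unit_vec_closed) auto
  qed (simp add: unit_vec_closed)
qed

end

context right_module
begin

lemma ract_const_hom: "\<lbrakk>u \<in> carrier M; i < n\<rbrakk> \<Longrightarrow> (\<lambda>y. u \<bullet>\<^bsub>M\<^esub> y i) \<in> rmod_hom R (free_rmod R n) M"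
  by (rule rmod_homI) (auto simp: ract_r_distr ract_assoc free_rmod_coord)

lemma lincomb_hom:
  assumes "\<And>i. i < k \<Longrightarrow> u i \<in> carrier M" and "k \<le> n"
  shows "lincomb M u k \<in> rmod_hom R (free_rmod R n) M"
  using assms
proof (induction k)
  case 0
  interpret two_modules R "free_rmod R n" M
    by (intro two_modules.intro R.right_module_free right_module_axioms)
  show ?case using zero_hom by (simp add: lincomb.simps(1)[abs_def])
next
  case (Suc k)
  have act: "(\<lambda>y. u k \<bullet>\<^bsub>M\<^esub> y k) \<in> rmod_hom R (free_rmod R n) M"
    using Suc.prems by (intro ract_const_hom) auto
  interpret two_modules R "free_rmod R n" M
    by (intro two_modules.intro R.right_module_free right_module_axioms)
  from Suc show ?case
    using sum_hom[OF Suc.IH act]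
    by (simp add: lincomb.simps(2)[abs_def])
qed

lemma lincomb_closed:
  assumes "\<And>i. i < k \<Longrightarrow> u i \<in> carrier M" and "\<And>i. i < k \<Longrightarrow> y i \<in> carrier R"
  shows "lincomb M u k y \<in> carrier M"
  using assms by (induction k) auto

end

text \<open>
  With the basis vectors for \<open>u\<close> this determines a homomorphism by its values on the basis, and
  \<open>lincomb_hom\<close> shows that these values can be prescribed.
\<close>

lemma (in two_modules) hom_lincomb:
  assumes f: "f \<in> rmod_hom R M N"
    and "\<And>i. i < k \<Longrightarrow> u i \<in> carrier M" and "\<And>i. i < k \<Longrightarrow> y i \<in> carrier R"
  shows "f (lincomb M u k y) = lincomb N (\<lambda>i. f (u i)) k y"
  using assms(2-)
  by (induction k) (auto simp: hom_zero[OF f] rmod_hom_add[OF f] rmod_hom_ract[OF f] M.lincomb_closed)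

context ring
begin

lemma lincomb_unit_vec:
  assumes y: "y \<in> carrier (free_rmod R n)"
  shows "lincomb (free_rmod R n) (\<lambda>i. unit_vec R n i \<one>) n y = y"
proof -
  interpret F: right_module R "free_rmod R n" by (rule right_module_free)
  have "lincomb (free_rmod R n) (\<lambda>i. unit_vec R n i \<one>) k y i = (if i < k then y i else \<zero>)"
    if "i < n" "k \<le> n" for i k
    using that(2)
  proof (induction k)
    case (Suc k)
    then show ?case using that(1) free_rmod_coord[OF y, of k] free_rmod_coord[OF y, of i]
      by (auto simp: less_Suc_eq)
  qed (use that in simp)
  moreover have "lincomb (free_rmod R n) (\<lambda>i. unit_vec R n i \<one>) n y \<in> carrier (free_rmod R n)"
    using free_rmod_coord[OF y] by (intro F.lincomb_closed unit_vec_closed) auto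
  ultimately show ?thesis using y by (intro free_rmod_eqI) auto
qed

lemma hom_free_eq_lincomb:
  assumes "right_module R M" and f: "f \<in> rmod_hom R (free_rmod R n) M"
    and y: "y \<in> carrier (free_rmod R n)"
  shows "f y = lincomb M (\<lambda>i. f (unit_vec R n i \<one>)) n y"
proof -
  interpret two_modules R "free_rmod R n" M
    by (intro two_modules.intro right_module_free assms(1))
  have "f (lincomb (free_rmod R n) (\<lambda>i. unit_vec R n i \<one>) n y)
      = lincomb M (\<lambda>i. f (unit_vec R n i \<one>)) n y"
    using free_rmod_coord[OF y] by (intro hom_lincomb[OF f] unit_vec_closed) auto
  then show ?thesis by (simp add: lincomb_unit_vec[OF y])
qed

end

section \<open>Quasi-inverses of homomorphisms between free modules\<close>

locale regular_ring = ring R for R :: "('a, 'r) ring_scheme" (structure) +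
  assumes regular: "x \<in> carrier R \<Longrightarrow> \<exists>y\<in>carrier R. x \<otimes> y \<otimes> x = x"
begin

text \<open>
  The step in the proof that a finitely generated right ideal of a regular ring is generated by an
  idempotent. Let \<open>c\<close> be a quasi-inverse of \<open>a' = a - e a\<close> and \<open>g = a' c\<close>. Then \<open>g a' = a'\<close> and
  \<open>e g = 0\<close>, so \<open>e + g - g e\<close> is a left identity of both \<open>e\<close> and \<open>a\<close>. It is stated in the form
  \<open>e r + a d\<close> because it has to lie in the right ideal generated by \<open>e\<close> and \<open>a\<close>.
\<close>

lemma adjoin_left_identity:
  assumes e: "e \<in> carrier R" "e \<otimes> e = e" and a: "a \<in> carrier R"
  obtains r d where "r \<in> carrier R" "d \<in> carrier R"
    "(e \<otimes> r \<oplus> a \<otimes> d) \<otimes> e = e" "(e \<otimes> r \<oplus> a \<otimes> d) \<otimes> a = a"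
proof -
  define a' where "a' = a \<ominus> e \<otimes> a"
  have "a' \<in> carrier R" using e a by (simp add: a'_def)
  then obtain c where c: "c \<in> carrier R" and *: "a' \<otimes> c \<otimes> a' = a'" using regular by blast
  define r where "r = \<one> \<ominus> a \<otimes> c \<oplus> a \<otimes> c \<otimes> e"
  define d where "d = c \<ominus> c \<otimes> e"
  have rd: "r \<in> carrier R" "d \<in> carrier R" using e a c by (auto simp: r_def d_def)
  have ee: "e \<otimes> (e \<otimes> x) = e \<otimes> x" if "x \<in> carrier R" for x
    using e that by (simp add: m_assoc[symmetric])
  have de: "d \<otimes> e = \<zero>"
    using e c by (simp add: d_def a_minus_def l_distr l_minus m_assoc r_neg)
  have re: "r \<otimes> e = e"
    using e a c by (simp add: r_def a_minus_def l_distr l_minus m_assoc a_assoc l_neg)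
  have "(e \<otimes> r \<oplus> a \<otimes> d) \<otimes> e = e"
    using e a rd by (simp add: l_distr m_assoc re de)
  moreover have "(e \<otimes> r \<oplus> a \<otimes> d) \<otimes> a = a"
  proof -
    have k: "a \<otimes> c \<otimes> a \<ominus> a \<otimes> c \<otimes> e \<otimes> a \<ominus> e \<otimes> a \<otimes> c \<otimes> a \<oplus> e \<otimes> a \<otimes> c \<otimes> e \<otimes> a = a \<ominus> e \<otimes> a"
      using e a c *[unfolded a'_def]
      by (simp add: a_minus_def l_distr r_distr l_minus r_minus m_assoc minus_add a_ac)
    have "(e \<otimes> r \<oplus> a \<otimes> d) \<otimes> a = e \<otimes> a \<oplus>
        (a \<otimes> c \<otimes> a \<ominus> a \<otimes> c \<otimes> e \<otimes> a \<ominus> e \<otimes> a \<otimes> c \<otimes> a \<oplus> e \<otimes> a \<otimes> c \<otimes> e \<otimes> a)"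
      using e a c
      by (simp add: r_def d_def a_minus_def l_distr r_distr l_minus r_minus m_assoc minus_add a_ac)
    also have "\<dots> = a" unfolding k using e a by (simp add: a_minus_def a_lcomm r_neg)
    finally show ?thesis .
  qed
  ultimately show thesis using rd that by blast
qed

text \<open>
  The range of \<open>f\<close> is the right ideal generated by the images of the basis vectors. These are adjoined
  one at a time, the left identity found so far being modified by \<open>adjoin_left_identity\<close>.
\<close>

lemma hom_range_left_identity:
  assumes f: "f \<in> rmod_hom R (free_rmod R m) (ring_rmod R)"
  obtains y0 where "y0 \<in> carrier (free_rmod R m)"
    "\<And>y. y \<in> carrier (free_rmod R m) \<Longrightarrow> f y0 \<otimes> f y = f y"
proof -
  interpret F: right_module R "free_rmod R m" by (rule right_module_free)
  interpret A: right_module R "ring_rmod R" by (rule right_module_ring)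
  define u where "u i = f (unit_vec R m i \<one>)" for i
  have u: "u i \<in> carrier R" for i
    using rmod_hom_closed[OF f unit_vec_closed] by (simp add: u_def)
  let ?l = "lincomb (ring_rmod R) u"
  have lh: "?l k \<in> rmod_hom R (free_rmod R m) (ring_rmod R)" if "k \<le> m" for k
    using that u by (intro A.lincomb_hom) auto
  have "\<exists>y0\<in>carrier (free_rmod R m). \<forall>y\<in>carrier (free_rmod R m). ?l k y0 \<otimes> ?l k y = ?l k y"
    if "k \<le> m" for k
    using that
  proof (induction k)
    case 0
    show ?case using F.M.zero_closed by (intro bexI[of _ "\<zero>\<^bsub>free_rmod R m\<^esub>"]) auto
  next
    case (Suc k)
    then obtain y0 where y0: "y0 \<in> carrier (free_rmod R m)"
      and id: "\<And>y. y \<in> carrier (free_rmod R m) \<Longrightarrow> ?l k y0 \<otimes> ?l k y = ?l k y" by auto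
    have lk: "?l k y \<in> carrier R" if "y \<in> carrier (free_rmod R m)" for y
      using rmod_hom_closed[OF lh that] Suc.prems by simp
    obtain r d where rd: "r \<in> carrier R" "d \<in> carrier R"
      and g: "(?l k y0 \<otimes> r \<oplus> u k \<otimes> d) \<otimes> ?l k y0 = ?l k y0"
        "(?l k y0 \<otimes> r \<oplus> u k \<otimes> d) \<otimes> u k = u k"
      using adjoin_left_identity[OF lk[OF y0] id[OF y0] u[of k]] by blast
    \<comment> \<open>only the coordinates up to \<open>k\<close> matter; this vector represents \<open>e r + u\<^sub>k d\<close>\<close>
    define y1 where "y1 = (\<lambda>i\<in>{..<m}. if i = k then d else y0 i \<otimes> r)"
    have y1: "y1 \<in> carrier (free_rmod R m)"
      using rd free_rmod_coord[OF y0] by (auto simp: y1_def free_rmod_carrier)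
    have "?l k y1 = ?l k (y0 \<bullet>\<^bsub>free_rmod R m\<^esub> r)"
      using Suc.prems by (intro lincomb_cong) (simp add: y1_def)
    also have "\<dots> = ?l k y0 \<otimes> r"
      using rmod_hom_ract[OF lh y0 rd(1)] Suc.prems by simp
    finally have l1: "?l (Suc k) y1 = ?l k y0 \<otimes> r \<oplus> u k \<otimes> d"
      using Suc.prems by (simp add: y1_def)
    have "?l (Suc k) y1 \<otimes> ?l (Suc k) y = ?l (Suc k) y" if y: "y \<in> carrier (free_rmod R m)" for y
    proof -
      let ?e = "?l k y0 \<otimes> r \<oplus> u k \<otimes> d"
      have c: "?e \<in> carrier R" "y k \<in> carrier R"
        using rd lk[OF y0] u free_rmod_coord[OF y] Suc.prems by auto
      have "?e \<otimes> ?l (Suc k) y = ?e \<otimes> (?l k y0 \<otimes> ?l k y) \<oplus> ?e \<otimes> (u k \<otimes> y k)"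
        using c u lk[OF y] by (simp add: id[OF y] r_distr)
      also have "\<dots> = (?e \<otimes> ?l k y0) \<otimes> ?l k y \<oplus> (?e \<otimes> u k) \<otimes> y k"
        using c u lk[OF y] lk[OF y0] by (simp only: m_assoc)
      also have "\<dots> = ?l (Suc k) y" by (simp add: g id[OF y])
      finally show ?thesis unfolding l1 .
    qed
    then show ?case using y1 by blast
  qed
  from this[of m] obtain y0 where "y0 \<in> carrier (free_rmod R m)"
    "\<forall>y\<in>carrier (free_rmod R m). ?l m y0 \<otimes> ?l m y = ?l m y" by auto
  moreover have "?l m = lincomb (ring_rmod R) (\<lambda>i. f (unit_vec R m i \<one>)) m"
    by (simp add: u_def[abs_def])
  ultimately show thesis
    using that[of y0] hom_free_eq_lincomb[OF right_module_ring f] by simp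
qed

text \<open>
  Elimination of coordinates from the last one downwards. Among the elements of the range \<open>X\<close> choose
  \<open>x\<close> such that its coordinate \<open>j\<close> is a left identity for the right ideal of all \<open>j\<close>-th coordinates.
  For \<open>y\<close> in \<open>X\<close> the element \<open>y - x y\<^sub>j\<close> is again in \<open>X\<close>, and its coordinate \<open>j\<close> is zero. If \<open>r'\<close>
  is a retraction onto the submodule of these elements, then \<open>x y\<^sub>j + r' (y - x y\<^sub>j)\<close> is one onto \<open>X\<close>.
\<close>

lemma free_hom_range_retract:
  assumes f: "f \<in> rmod_hom R (free_rmod R m) (free_rmod R k)"
  obtains r where "r \<in> rmod_hom R (free_rmod R k) (free_rmod R k)"
    "r ` carrier (free_rmod R k) \<subseteq> f ` carrier (free_rmod R m)"
    "\<And>y. y \<in> carrier (free_rmod R m) \<Longrightarrow> r (f y) = f y"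
proof -
  let ?P = "free_rmod R m" and ?F = "free_rmod R k"
  interpret P: right_module R ?P by (rule right_module_free)
  interpret F: right_module R ?F by (rule right_module_free)
  interpret PF: two_modules R ?P ?F ..
  interpret FF: two_modules R ?F ?F ..
  have "\<exists>r\<in>rmod_hom R ?F ?F. r ` carrier ?F \<subseteq> f ` carrier ?P \<and> (\<forall>y\<in>carrier ?P. r (f y) = f y)"
    if "j \<le> k" "f \<in> rmod_hom R ?P ?F"
      "\<And>y i. \<lbrakk>y \<in> carrier ?P; j \<le> i; i < k\<rbrakk> \<Longrightarrow> f y i = \<zero>" for j f
    using that
  proof (induction j arbitrary: f)
    case 0
    have z: "f y = \<zero>\<^bsub>?F\<^esub>" if "y \<in> carrier ?P" for y
      using 0(3)[OF that] rmod_hom_closed[OF 0(2) that] F.M.zero_closed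
      by (intro free_rmod_eqI) auto
    show ?case
      using z F.M.zero_closed P.M.zero_closed by (intro bexI[OF _ FF.zero_hom]) force
  next
    case (Suc j)
    have j: "j < k" using Suc.prems(1) by simp
    note f = Suc.prems(2)
    have fj: "(\<lambda>y. f y j) \<in> rmod_hom R ?P (ring_rmod R)"
      using rmod_hom_comp[OF f coord_hom[OF j]] by simp
    obtain y0 where y0: "y0 \<in> carrier ?P"
      and id: "\<And>y. y \<in> carrier ?P \<Longrightarrow> f y0 j \<otimes> f y j = f y j"
      using hom_range_left_identity[OF fj] by blast
    define x where "x = f y0"
    have x: "x \<in> carrier ?F" using rmod_hom_closed[OF f y0] by (simp add: x_def)
    define h where "h y = y \<ominus>\<^bsub>?F\<^esub> x \<bullet>\<^bsub>?F\<^esub> y j" for y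
    have xh: "(\<lambda>y. x \<bullet>\<^bsub>?F\<^esub> y j) \<in> rmod_hom R ?F ?F" by (rule F.ract_const_hom[OF x j])
    have h: "h \<in> rmod_hom R ?F ?F"
      unfolding h_def[abs_def] by (rule FF.diff_hom[OF rmod_hom_id xh])
    have h_nth: "h y i \<oplus> x i \<otimes> y j = y i" if "y \<in> carrier ?F" "i < k" for y i
    proof -
      have "h y \<oplus>\<^bsub>?F\<^esub> x \<bullet>\<^bsub>?F\<^esub> y j = y"
        using F.add_diff_cancel[OF F.ract_closed[OF x free_rmod_coord[OF that(1) j]] that(1)]
          rmod_hom_closed[OF h that(1)] rmod_hom_closed[OF xh that(1)]
        by (simp add: h_def F.M.a_comm)
      then show ?thesis using that(2) by (metis free_rmod_simps(2,3))
    qed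
    define f' where "f' y = h (f y)" for y
    have f': "f' \<in> rmod_hom R ?P ?F" unfolding f'_def[abs_def] by (rule rmod_hom_comp[OF f h])
    have f'_eq: "f' y = f (y \<ominus>\<^bsub>?P\<^esub> y0 \<bullet>\<^bsub>?P\<^esub> f y j)" "y \<ominus>\<^bsub>?P\<^esub> y0 \<bullet>\<^bsub>?P\<^esub> f y j \<in> carrier ?P"
      if "y \<in> carrier ?P" for y
      using that y0 rmod_hom_closed[OF fj that]
      by (auto simp: f'_def h_def x_def PF.hom_diff[OF f] rmod_hom_ract[OF f])
    have "f' y i = \<zero>" if y: "y \<in> carrier ?P" and i: "j \<le> i" "i < k" for y i
    proof -
      have c: "f' y i \<in> carrier R" "f y j \<in> carrier R"
        using free_rmod_coord[OF rmod_hom_closed[OF f' y] i(2)]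
          free_rmod_coord[OF rmod_hom_closed[OF f y] j] .
      have eq: "f' y i \<oplus> x i \<otimes> f y j = f y i"
        unfolding f'_def by (rule h_nth[OF rmod_hom_closed[OF f y] i(2)])
      show ?thesis
      proof (cases "i = j")
        case True
        then have "f' y i \<oplus> f y j = f y j" using eq id[OF y] by (simp add: x_def)
        then show ?thesis using c by simp
      next
        case False
        then have "f y i = \<zero>" "x i = \<zero>" using Suc.prems(3) i y y0 by (auto simp: x_def)
        then show ?thesis using eq c by simp
      qed
    qed
    then obtain r' where r': "r' \<in> rmod_hom R ?F ?F" "r' ` carrier ?F \<subseteq> f' ` carrier ?P"
      and r'_id: "\<And>y. y \<in> carrier ?P \<Longrightarrow> r' (f' y) = f' y"
      using Suc.IH[OF _ f'] Suc.prems(1) by auto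
    define r where "r y = x \<bullet>\<^bsub>?F\<^esub> y j \<oplus>\<^bsub>?F\<^esub> r' (h y)" for y
    have "r \<in> rmod_hom R ?F ?F"
      unfolding r_def[abs_def] by (rule FF.sum_hom[OF xh rmod_hom_comp[OF h r'(1)]])
    moreover have "r y \<in> f ` carrier ?P" if y: "y \<in> carrier ?F" for y
    proof -
      have S: "rsubmodule R ?F (f ` carrier ?P)"
        by (rule PF.image_rsubmodule[OF f rsubmodule_carrier[OF right_module_free]])
      have "r' (h y) \<in> f' ` carrier ?P" using r'(2) rmod_hom_closed[OF h y] by blast
      then have "r' (h y) \<in> f ` carrier ?P" using f'_eq by force
      then show ?thesis
        unfolding r_def using free_rmod_coord[OF y j] y0
        by (intro rsubmodule_add[OF S] rsubmodule_ract[OF S]) (auto simp: x_def)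
    qed
    moreover have "r (f y) = f y" if y: "y \<in> carrier ?P" for y
      using r'_id[OF y] F.add_diff_cancel[OF F.ract_closed[OF x] rmod_hom_closed[OF f y]]
        free_rmod_coord[OF rmod_hom_closed[OF f y] j]
      by (simp add: r_def f'_def h_def)
    ultimately show ?case by blast
  qed
  from this[of k f] f that show thesis by fastforce
qed

text \<open>
  The retraction \<open>r\<close> onto the range of \<open>f\<close> lifts through \<open>f\<close>, the module being free, to some \<open>g\<close>
  with \<open>f g = r\<close>.
\<close>

lemma free_hom_quasi_inverse:
  assumes f: "f \<in> rmod_hom R (free_rmod R m) (free_rmod R k)"
  obtains g where "g \<in> rmod_hom R (free_rmod R k) (free_rmod R m)"
    "\<And>x. x \<in> carrier (free_rmod R m) \<Longrightarrow> f (g (f x)) = f x"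
proof -
  let ?P = "free_rmod R m" and ?F = "free_rmod R k"
  interpret P: right_module R ?P by (rule right_module_free)
  interpret F: right_module R ?F by (rule right_module_free)
  interpret PF: two_modules R ?P ?F ..
  obtain r where r: "r \<in> rmod_hom R ?F ?F" "r ` carrier ?F \<subseteq> f ` carrier ?P"
    and r_id: "\<And>y. y \<in> carrier ?P \<Longrightarrow> r (f y) = f y"
    using free_hom_range_retract[OF f] by blast
  have "\<forall>i. \<exists>z. z \<in> carrier ?P \<and> f z = r (unit_vec R k i \<one>)"
    using r(2) unit_vec_closed[OF one_closed, of k]
    by (metis (no_types, lifting) imageE image_subset_iff)
  then obtain z where z: "\<And>i. z i \<in> carrier ?P" "\<And>i. f (z i) = r (unit_vec R k i \<one>)" by metis
  have "f (lincomb ?P z k y) = r y" if y: "y \<in> carrier ?F" for y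
    using PF.hom_lincomb[OF f, of k z y] free_rmod_coord[OF y] z
      hom_free_eq_lincomb[OF right_module_free r(1) y] by (simp)
  then show thesis
    using that[OF P.lincomb_hom[of k z k]] z(1) r_id rmod_hom_closed[OF f] by (simp)
qed

end

section \<open>Finitely generated projective modules as retracts\<close>

text \<open>
  Finitely generated projectivity in a form that mentions no test modules, and hence behaves uniformly
  for modules of all element types.
\<close>

definition free_retract :: "('a, 'r) ring_scheme \<Rightarrow> ('a, 'm, 's) rmodule_scheme \<Rightarrow> bool"
  where "free_retract R M \<longleftrightarrow> right_module R M \<and>
    (\<exists>m. \<exists>i\<in>rmod_hom R M (free_rmod R m). \<exists>q\<in>rmod_hom R (free_rmod R m) M.
      \<forall>x\<in>carrier M. q (i x) = x)"

lemma free_retractI: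
  assumes "right_module R M" "i \<in> rmod_hom R M (free_rmod R m)" "q \<in> rmod_hom R (free_rmod R m) M"
    and "\<And>x. x \<in> carrier M \<Longrightarrow> q (i x) = x"
  shows "free_retract R M"
  unfolding free_retract_def using assms by (intro conjI exI[of _ m] bexI[of _ i] bexI[of _ q]) auto

lemma free_retract_right_module: "free_retract R M \<Longrightarrow> right_module R M"
  by (simp add: free_retract_def)

lemma free_retractE:
  assumes "free_retract R M"
  obtains m i q where "i \<in> rmod_hom R M (free_rmod R m)" "q \<in> rmod_hom R (free_rmod R m) M"
    "\<And>x. x \<in> carrier M \<Longrightarrow> q (i x) = x"
  using assms unfolding free_retract_def by (elim conjE exE bexE) (erule (1) that, erule (1) bspec)

lemma free_retract_retract:
  assumes M: "free_retract R M" and N: "right_module R N"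
    and i: "i \<in> rmod_hom R N M" and q: "q \<in> rmod_hom R M N"
    and qi: "\<And>x. x \<in> carrier N \<Longrightarrow> q (i x) = x"
  shows "free_retract R N"
proof -
  obtain m i' q' where *: "i' \<in> rmod_hom R M (free_rmod R m)" "q' \<in> rmod_hom R (free_rmod R m) M"
    "\<And>x. x \<in> carrier M \<Longrightarrow> q' (i' x) = x" by (rule free_retractE[OF M]) (erule (1) that, assumption)
  have "(\<lambda>x. i' (i x)) \<in> rmod_hom R N (free_rmod R m)" "(\<lambda>x. q (q' x)) \<in> rmod_hom R (free_rmod R m) N"
    using rmod_hom_comp[OF i *(1)] rmod_hom_comp[OF *(2) q] .
  then show ?thesis
    by (rule free_retractI[OF N]) (simp add: *(3)[OF rmod_hom_closed[OF i]] qi)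
qed

context ring
begin

lemma free_retract_free: "free_retract R (free_rmod R n)"
  by (rule free_retractI[OF right_module_free rmod_hom_id rmod_hom_id]) simp

lemma free_retract_ring: "free_retract R (ring_rmod R)"
  by (rule free_retract_retract[OF free_retract_free[of 1] right_module_ring unit_vec_hom[of 1 0] coord_hom[of 0 1]])
    auto

end

lemma rmod_sum_simps [simp]:
  "carrier (rmod_sum M N) = carrier M \<times> carrier N"
  "\<zero>\<^bsub>rmod_sum M N\<^esub> = (\<zero>\<^bsub>M\<^esub>, \<zero>\<^bsub>N\<^esub>)"
  "(x, y) \<oplus>\<^bsub>rmod_sum M N\<^esub> (x', y') = (x \<oplus>\<^bsub>M\<^esub> x', y \<oplus>\<^bsub>N\<^esub> y')"
  "(x, y) \<bullet>\<^bsub>rmod_sum M N\<^esub> a = (x \<bullet>\<^bsub>M\<^esub> a, y \<bullet>\<^bsub>N\<^esub> a)"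
  by (simp_all add: rmod_sum_def)

context two_modules
begin

lemma right_module_sum: "right_module R (rmod_sum M N)"
proof -
  have "abelian_group (rmod_sum M N)"
  proof (rule abelian_groupI)
    fix x assume "x \<in> carrier (rmod_sum M N)"
    then show "\<exists>y\<in>carrier (rmod_sum M N). y \<oplus>\<^bsub>rmod_sum M N\<^esub> x = \<zero>\<^bsub>rmod_sum M N\<^esub>"
      by (intro bexI[of _ "(\<ominus>\<^bsub>M\<^esub> fst x, \<ominus>\<^bsub>N\<^esub> snd x)"]) (auto simp: M.M.l_neg N.M.l_neg)
  qed (auto simp: M.M.a_assoc N.M.a_assoc intro: M.M.a_comm N.M.a_comm)
  then show ?thesis
    by (intro right_module.intro right_module_axioms.intro)
      (auto simp: M.R.ring_axioms M.ract_l_distr N.ract_l_distr M.ract_r_distr N.ract_r_distr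
        M.ract_assoc N.ract_assoc)
qed

lemma sum_inl_hom: "(\<lambda>x. (x, \<zero>\<^bsub>N\<^esub>)) \<in> rmod_hom R M (rmod_sum M N)"
  by (rule rmod_homI) auto

lemma sum_inr_hom: "(\<lambda>y. (\<zero>\<^bsub>M\<^esub>, y)) \<in> rmod_hom R N (rmod_sum M N)"
  by (rule rmod_homI) auto

end

lemma fst_hom: "fst \<in> rmod_hom R (rmod_sum M N) M"
  by (rule rmod_homI) auto

lemma snd_hom: "snd \<in> rmod_hom R (rmod_sum M N) N"
  by (rule rmod_homI) auto

lemma pair_hom:
  "\<lbrakk>f \<in> rmod_hom R P M; g \<in> rmod_hom R P N\<rbrakk> \<Longrightarrow> (\<lambda>x. (f x, g x)) \<in> rmod_hom R P (rmod_sum M N)"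
  by (rule rmod_homI) (auto simp: rmod_hom_closed rmod_hom_add rmod_hom_ract)

lemma map_prod_hom:
  "\<lbrakk>f \<in> rmod_hom R M M'; g \<in> rmod_hom R N N'\<rbrakk> \<Longrightarrow>
    map_prod f g \<in> rmod_hom R (rmod_sum M N) (rmod_sum M' N')"
  by (rule rmod_homI) (auto simp: rmod_hom_closed rmod_hom_add rmod_hom_ract)

lemma rmod_isomorphic_sum:
  assumes "rmod_isomorphic R M M'" "rmod_isomorphic R N N'"
  shows "rmod_isomorphic R (rmod_sum M N) (rmod_sum M' N')"
proof -
  obtain f g where "f \<in> rmod_hom R M M'" "bij_betw f (carrier M) (carrier M')"
    "g \<in> rmod_hom R N N'" "bij_betw g (carrier N) (carrier N')"
    using assms unfolding rmod_isomorphic_def by blast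
  then show ?thesis
    by (intro rmod_isomorphicI[OF map_prod_hom]) (auto intro: bij_betw_map_prod)
qed

lemma rmod_isomorphic_sum_comm: "rmod_isomorphic R (rmod_sum M N) (rmod_sum N M)"
  by (rule rmod_isomorphicI[of prod.swap]) (auto intro!: rmod_homI simp: bij_betw_def inj_on_def image_iff)

lemma rmod_isomorphic_sum_assoc:
  "rmod_isomorphic R (rmod_sum (rmod_sum M N) P) (rmod_sum M (rmod_sum N P))"
  by (rule rmod_isomorphicI[of "\<lambda>((x, y), z). (x, (y, z))"])
    (auto intro!: rmod_homI simp: bij_betw_def inj_on_def image_iff)

text \<open>
  Concatenation of coordinates identifies this sum with the free module of rank \<open>m + k\<close>.
\<close>

lemma (in ring) free_retract_sum_free: "free_retract R (rmod_sum (free_rmod R m) (free_rmod R k))"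
proof -
  interpret S: two_modules R "free_rmod R m" "free_rmod R k"
    by (intro two_modules.intro right_module_free)
  define i where "i z = (\<lambda>j\<in>{..<m + k}. if j < m then fst z j else snd z (j - m))"
    for z :: "(nat \<Rightarrow> 'a) \<times> (nat \<Rightarrow> 'a)"
  define q where "q z = ((\<lambda>j\<in>{..<m}. z j), (\<lambda>j\<in>{..<k}. z (m + j)))" for z :: "nat \<Rightarrow> 'a"
  have i_nth: "i z j = (if j < m then fst z j else snd z (j - m))" if "j < m + k" for z j
    using that by (simp add: i_def)
  have icl: "i z \<in> carrier (free_rmod R (m + k))"
    if "z \<in> carrier (rmod_sum (free_rmod R m) (free_rmod R k))" for z
    using that by (auto simp: i_def free_rmod_carrier PiE_def Pi_iff)
  interpret F: right_module R "free_rmod R (m + k)" by (rule right_module_free)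
  have "i \<in> rmod_hom R (rmod_sum (free_rmod R m) (free_rmod R k)) (free_rmod R (m + k))"
  proof (rule rmod_homI[OF icl])
    fix z w
    assume z: "z \<in> carrier (rmod_sum (free_rmod R m) (free_rmod R k))"
      and w: "w \<in> carrier (rmod_sum (free_rmod R m) (free_rmod R k))"
    then show "i (z \<oplus>\<^bsub>rmod_sum (free_rmod R m) (free_rmod R k)\<^esub> w) = i z \<oplus>\<^bsub>free_rmod R (m + k)\<^esub> i w"
      by (intro free_rmod_eqI[where R = R and n = "m + k"] F.M.a_closed icl)
        (auto simp: i_nth intro: S.M.M.a_closed S.N.M.a_closed)
  next
    fix z a
    assume z: "z \<in> carrier (rmod_sum (free_rmod R m) (free_rmod R k))" and a: "a \<in> carrier R"
    then show "i (z \<bullet>\<^bsub>rmod_sum (free_rmod R m) (free_rmod R k)\<^esub> a) = i z \<bullet>\<^bsub>free_rmod R (m + k)\<^esub> a"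
      by (intro free_rmod_eqI[where R = R and n = "m + k"] F.ract_closed icl) (auto simp: i_nth)
  qed
  moreover have "(\<lambda>z. \<lambda>j\<in>{..<l}. z (d + j)) \<in> rmod_hom R (free_rmod R (m + k)) (free_rmod R l)"
    if "d + l \<le> m + k" for l d
  proof -
    interpret L: right_module R "free_rmod R l" by (rule right_module_free)
    have cl: "(\<lambda>j\<in>{..<l}. z (d + j)) \<in> carrier (free_rmod R l)"
      if "z \<in> carrier (free_rmod R (m + k))" for z
      using that \<open>d + l \<le> m + k\<close> by (auto simp: free_rmod_carrier PiE_def Pi_iff)
    show ?thesis
      using that by (intro rmod_homI cl) (auto intro!: free_rmod_eqI[where R = R and n = l] L.M.a_closed L.ract_closed F.M.a_closed F.ract_closed cl)
  qed
  from this[of 0 m] this[of m k]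
  have "q \<in> rmod_hom R (free_rmod R (m + k)) (rmod_sum (free_rmod R m) (free_rmod R k))"
    unfolding q_def[abs_def] by (intro pair_hom) auto
  moreover have "q (i z) = z" if "z \<in> carrier (rmod_sum (free_rmod R m) (free_rmod R k))" for z
    using that by (auto simp: q_def i_nth free_rmod_carrier fun_eq_iff restrict_def PiE_def extensional_def prod_eq_iff)
  ultimately show ?thesis
    by (intro free_retract_retract[OF free_retract_free[of "m + k"] S.right_module_sum])
qed

lemma free_retract_sum:
  assumes M: "free_retract R M" and N: "free_retract R N"
  shows "free_retract R (rmod_sum M N)"
proof -
  interpret two_modules R M N using M N by (intro two_modules.intro free_retract_right_module)
  obtain m i q where 1: "i \<in> rmod_hom R M (free_rmod R m)" "q \<in> rmod_hom R (free_rmod R m) M"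
    "\<And>x. x \<in> carrier M \<Longrightarrow> q (i x) = x" by (rule free_retractE[OF M]) (erule (1) that, assumption)
  obtain k i' q' where 2: "i' \<in> rmod_hom R N (free_rmod R k)" "q' \<in> rmod_hom R (free_rmod R k) N"
    "\<And>x. x \<in> carrier N \<Longrightarrow> q' (i' x) = x" by (rule free_retractE[OF N]) (erule (1) that, assumption)
  show ?thesis
    by (rule free_retract_retract[OF M.R.free_retract_sum_free right_module_sum
          map_prod_hom[OF 1(1) 2(1)] map_prod_hom[OF 1(2) 2(2)]])
      (auto simp: 1 2)
qed

lemma free_retract_iso:
  assumes M: "free_retract R M" and N: "right_module R N" and iso: "rmod_isomorphic R M N"
  shows "free_retract R N"
proof -
  obtain f where f: "f \<in> rmod_hom R M N" "bij_betw f (carrier M) (carrier N)"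
    using iso unfolding rmod_isomorphic_def by blast
  show ?thesis
    by (rule free_retract_retract[OF M N inv_rmod_hom[OF free_retract_right_module[OF M] f] f(1)])
      (use f(2) in \<open>simp add: bij_betw_def f_inv_into_f\<close>)
qed

context right_module
begin

lemma lincomb_in_rsubmodule:
  assumes X: "rsubmodule R M X" and "\<And>i. i < k \<Longrightarrow> u i \<in> X" and "\<And>i. i < k \<Longrightarrow> y i \<in> carrier R"
  shows "lincomb M u k y \<in> X"
  using assms(2-) by (induction k) (auto simp: rsubmodule_zero[OF X] rsubmodule_add[OF X] rsubmodule_ract[OF X])

lemma lincomb_at_unit_vec:
  assumes "\<And>i. i < n \<Longrightarrow> u i \<in> carrier M" and "i < n"
  shows "lincomb M u n (unit_vec R n i \<one>) = u i"
proof -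
  have "lincomb M u k (unit_vec R n i \<one>) = (if i < k then u i else \<zero>\<^bsub>M\<^esub>)" if "k \<le> n" for k
    using that assms by (induction k) (auto simp: less_Suc_eq)
  then show ?thesis using assms(2) by simp
qed

lemma finitely_generated_iff:
  "finitely_generated R M \<longleftrightarrow>
    (\<exists>m. \<exists>f\<in>rmod_hom R (free_rmod R m) M. f ` carrier (free_rmod R m) = carrier M)"
proof
  assume "finitely_generated R M"
  then obtain S where S: "finite S" "S \<subseteq> carrier M" "rspan R M S = carrier M"
    unfolding finitely_generated_def by blast
  obtain m u where u: "S = u ` {..<m::nat}"
    using finite_imp_nat_seg_image_inj_on[OF S(1)] by (auto simp: lessThan_def)
  have uM: "u i \<in> carrier M" if "i < m" for i using S(2) u that by blast
  let ?f = "lincomb M u m"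
  have f: "?f \<in> rmod_hom R (free_rmod R m) M" by (rule lincomb_hom) (use uM in auto)
  have "rsubmodule R M (?f ` carrier (free_rmod R m))"
    using two_modules.image_rsubmodule[OF _ f rsubmodule_carrier] R.right_module_free
    by (auto intro: two_modules.intro right_module_axioms)
  moreover have "S \<subseteq> ?f ` carrier (free_rmod R m)"
    unfolding u
  proof (rule image_subsetI)
    fix i assume "i \<in> {..<m}"
    then show "u i \<in> ?f ` carrier (free_rmod R m)"
      using lincomb_at_unit_vec[of m u i] uM
      by (intro image_eqI[of _ _ "unit_vec R m i \<one>"]) auto
  qed
  ultimately have "carrier M \<subseteq> ?f ` carrier (free_rmod R m)"
    using S(3) unfolding rspan_def by blast
  then show "\<exists>m. \<exists>f\<in>rmod_hom R (free_rmod R m) M. f ` carrier (free_rmod R m) = carrier M"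
    using rmod_hom_closed[OF f] by (intro exI[of _ m] bexI[of _ ?f] f) auto
next
  assume "\<exists>m. \<exists>f\<in>rmod_hom R (free_rmod R m) M. f ` carrier (free_rmod R m) = carrier M"
  then obtain m f where f: "f \<in> rmod_hom R (free_rmod R m) M"
    and im: "f ` carrier (free_rmod R m) = carrier M" by blast
  let ?S = "(\<lambda>i. f (unit_vec R m i \<one>)) ` {..<m}"
  have S: "?S \<subseteq> carrier M" using rmod_hom_closed[OF f R.unit_vec_closed] by auto
  \<comment> \<open>every submodule that contains the images of the basis vectors contains the range of \<open>f\<close>\<close>
  have "rspan R M ?S = carrier M"
  proof
    show "rspan R M ?S \<subseteq> carrier M"
      using rsubmodule_carrier[OF right_module_axioms] S unfolding rspan_def by blast
    have "carrier M \<subseteq> X" if X: "rsubmodule R M X" "?S \<subseteq> X" for X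
    proof -
      have "f y \<in> X" if "y \<in> carrier (free_rmod R m)" for y
      proof -
        have "lincomb M (\<lambda>i. f (unit_vec R m i \<one>)) m y \<in> X"
          by (rule lincomb_in_rsubmodule[OF X(1)]) (use X(2) free_rmod_coord[OF that] in auto)
        then show ?thesis by (simp only: R.hom_free_eq_lincomb[OF right_module_axioms f that])
      qed
      then show ?thesis unfolding im[symmetric] by (rule image_subsetI)
    qed
    then show "carrier M \<subseteq> rspan R M ?S" unfolding rspan_def by blast
  qed
  then show "finitely_generated R M" unfolding finitely_generated_def using S by blast
qed

end

context ring
begin

text \<open>
  To lift \<open>f\<close> through \<open>g\<close>, lift the images of the basis vectors under \<open>f q\<close>; the resulting
  homomorphism on the free module is restricted to \<open>P\<close> along \<open>i\<close>.
\<close>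

lemma fg_projective_if_free_retract:
  assumes P: "free_retract R P"
  shows "fg_projective R P"
proof -
  interpret P: right_module R P using free_retract_right_module[OF P] .
  obtain m i q where iq: "i \<in> rmod_hom R P (free_rmod R m)" "q \<in> rmod_hom R (free_rmod R m) P"
    "\<And>x. x \<in> carrier P \<Longrightarrow> q (i x) = x" by (rule free_retractE[OF P]) (erule (1) that, assumption)
  have "q ` carrier (free_rmod R m) = carrier P"
    using iq rmod_hom_closed by (metis (no_types, lifting) image_subsetI rev_image_eqI subsetI subset_antisym)
  then have "finitely_generated R P" using P.finitely_generated_iff iq(2) by blast
  moreover have "projective R P"
    unfolding projective_def
  proof (intro allI impI ballI)
    fix A B :: "('a, nat \<Rightarrow> 'a) rmodule" and g f
    assume A: "right_module R A" and B: "right_module R B" and g: "g \<in> rmod_hom R A B"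
      and onto: "g ` carrier A = carrier B" and f: "f \<in> rmod_hom R P B"
    interpret A: right_module R A by fact
    interpret AB: two_modules R A B by (intro two_modules.intro A B)
    let ?b = "\<lambda>j. f (q (unit_vec R m j \<one>))"
    have "\<forall>j. \<exists>a\<in>carrier A. g a = ?b j"
      using onto rmod_hom_closed[OF f rmod_hom_closed[OF iq(2) unit_vec_closed[OF one_closed]]]
      by (metis (no_types, lifting) imageE)
    then obtain a where a: "\<And>j. a j \<in> carrier A" "\<And>j. g (a j) = ?b j" by metis
    let ?h = "\<lambda>x. lincomb A a m (i x)"
    have "g (?h x) = f x" if x: "x \<in> carrier P" for x
    proof -
      have ix: "i x \<in> carrier (free_rmod R m)" by (rule rmod_hom_closed[OF iq(1) x])
      have "g (?h x) = lincomb B ?b m (i x)"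
        using AB.hom_lincomb[OF g, of m a "i x"] a free_rmod_coord[OF ix] by simp
      also have "\<dots> = f (q (i x))"
        using hom_free_eq_lincomb[OF B rmod_hom_comp[OF iq(2) f] ix] by simp
      finally show ?thesis using iq(3)[OF x] by simp
    qed
    moreover have "?h \<in> rmod_hom R P A"
      using rmod_hom_comp[OF iq(1) A.lincomb_hom[of m a m]] a(1) by simp
    ultimately show "\<exists>h\<in>rmod_hom R P A. \<forall>x\<in>carrier P. g (h x) = f x"
      by (intro bexI[of _ ?h]) auto
  qed
  ultimately show ?thesis unfolding fg_projective_def using P.right_module_axioms by simp
qed

text \<open>
  Lifting the identity of \<open>P\<close> through an epimorphism from a free module splits that epimorphism. This
  instance of the lifting property is available because \<open>P\<close> has the element type of the test modules.
\<close>

lemma free_retract_if_fg_projective: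
  fixes P :: "('a, nat \<Rightarrow> 'a) rmodule"
  assumes P: "fg_projective R P"
  shows "free_retract R P"
proof -
  interpret P: right_module R P using P unfolding fg_projective_def by blast
  have "finitely_generated R P" using P by (simp add: fg_projective_def)
  then obtain m f where f: "f \<in> rmod_hom R (free_rmod R m) P" "f ` carrier (free_rmod R m) = carrier P"
    unfolding P.finitely_generated_iff by (elim exE bexE)
  have "projective R P" using P by (simp add: fg_projective_def)
  from this[unfolded projective_def, rule_format, OF right_module_free P.right_module_axioms f rmod_hom_id]
  obtain h where h: "h \<in> rmod_hom R P (free_rmod R m)" "\<forall>x\<in>carrier P. f (h x) = x" ..
  then show ?thesis by (intro free_retractI[OF P.right_module_axioms h(1) f(1)]) simp
qed

lemma fg_projective_iff:
  fixes P :: "('a, nat \<Rightarrow> 'a) rmodule"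
  shows "fg_projective R P \<longleftrightarrow> free_retract R P"
  using fg_projective_if_free_retract free_retract_if_fg_projective by blast

end

text \<open>
  Extend \<open>f\<close> to the free modules of which \<open>M\<close> and \<open>N\<close> are retracts, and compress a quasi-inverse
  found there.
\<close>

lemma (in regular_ring) quasi_inverse:
  assumes M: "free_retract R M" and N: "free_retract R N" and f: "f \<in> rmod_hom R M N"
  obtains g where "g \<in> rmod_hom R N M" "\<And>x. x \<in> carrier M \<Longrightarrow> f (g (f x)) = f x"
proof -
  obtain m i q where 1: "i \<in> rmod_hom R M (free_rmod R m)" "q \<in> rmod_hom R (free_rmod R m) M"
    "\<And>x. x \<in> carrier M \<Longrightarrow> q (i x) = x" by (rule free_retractE[OF M]) (erule (1) that, assumption)
  obtain k i' q' where 2: "i' \<in> rmod_hom R N (free_rmod R k)" "q' \<in> rmod_hom R (free_rmod R k) N"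
    "\<And>x. x \<in> carrier N \<Longrightarrow> q' (i' x) = x" by (rule free_retractE[OF N]) (erule (1) that, assumption)
  have "(\<lambda>x. i' (f (q x))) \<in> rmod_hom R (free_rmod R m) (free_rmod R k)"
    using rmod_hom_comp[OF rmod_hom_comp[OF 1(2) f] 2(1)] .
  then obtain h where h: "h \<in> rmod_hom R (free_rmod R k) (free_rmod R m)"
    "\<And>x. x \<in> carrier (free_rmod R m) \<Longrightarrow> i' (f (q (h (i' (f (q x)))))) = i' (f (q x))"
    by (rule free_hom_quasi_inverse) (erule that, assumption)
  have "(\<lambda>x. q (h (i' x))) \<in> rmod_hom R N M"
    using rmod_hom_comp[OF rmod_hom_comp[OF 2(1) h(1)] 1(2)] .
  moreover have "f (q (h (i' (f x)))) = f x" if x: "x \<in> carrier M" for x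
  proof -
    have "i' (f (q (h (i' (f x))))) = i' (f x)"
      using h(2)[OF rmod_hom_closed[OF 1(1) x]] 1(3)[OF x] by simp
    moreover have "f x \<in> carrier N" "f (q (h (i' (f x)))) \<in> carrier N"
      using x by (auto intro!: rmod_hom_closed[OF f] rmod_hom_closed[OF 1(2)] rmod_hom_closed[OF h(1)]
          rmod_hom_closed[OF 2(1)])
    ultimately show ?thesis using 2(3)[of "f x"] 2(3)[of "f (q (h (i' (f x))))"] by simp
  qed
  ultimately show thesis by (rule that)
qed

section \<open>Finitely generated submodules and direct sums\<close>

abbreviation fgsub :: "('a, 'r) ring_scheme \<Rightarrow> ('a, 'm, 's) rmodule_scheme \<Rightarrow> 'm set set"
  where "fgsub R M \<equiv> carrier (fg_submodules R M)"

lemma fgsub_iff: "X \<in> fgsub R M \<longleftrightarrow> rsubmodule R M X \<and> finitely_generated R (M \<restriction> X)"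
  by (simp add: fg_submodules_def)

lemma fgsub_rsubmodule: "X \<in> fgsub R M \<Longrightarrow> rsubmodule R M X"
  by (simp add: fgsub_iff)

lemma fgsub_subset: "X \<in> fgsub R M \<Longrightarrow> X \<subseteq> carrier M"
  by (rule rsubmodule_subset[OF fgsub_rsubmodule])

definition dsum :: "[('a, 'r) ring_scheme, ('a, 'm, 's) rmodule_scheme, 'm set, 'm set, 'm set] \<Rightarrow> bool"
  where "dsum R M A B C \<longleftrightarrow>
    B \<in> fgsub R M \<and> C \<in> fgsub R M \<and> B \<inter> C = {\<zero>\<^bsub>M\<^esub>} \<and> A = B <+>\<^bsub>M\<^esub> C"

lemma set_add_iff: "x \<in> B <+>\<^bsub>M\<^esub> C \<longleftrightarrow> (\<exists>b\<in>B. \<exists>c\<in>C. x = b \<oplus>\<^bsub>M\<^esub> c)"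
  by (auto simp: set_add_def set_mult_def)

lemma set_add_image: "f ` A <+>\<^bsub>M\<^esub> g ` B = (\<lambda>z. f (fst z) \<oplus>\<^bsub>M\<^esub> g (snd z)) ` (A \<times> B)"
  by (rule Set.set_eqI) (simp add: set_add_iff image_iff)

context right_module
begin

lemma fgsub_free_image:
  assumes f: "f \<in> rmod_hom R (free_rmod R m) M"
  shows "f ` carrier (free_rmod R m) \<in> fgsub R M"
proof -
  note rm = right_module_axioms
  interpret two_modules R "free_rmod R m" M
    by (intro two_modules.intro R.right_module_free right_module_axioms)
  have S: "rsubmodule R M (f ` carrier (free_rmod R m))"
    by (rule image_rsubmodule[OF f rsubmodule_carrier[OF R.right_module_free]])
  interpret X: right_module R "M \<restriction> f ` carrier (free_rmod R m)"
    by (rule right_module_restr[OF rm S])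
  have "f \<in> rmod_hom R (free_rmod R m) (M \<restriction> f ` carrier (free_rmod R m))"
    by (rule rmod_hom_corestr[OF f order_refl])
  then show ?thesis unfolding fgsub_iff X.finitely_generated_iff
    by (intro conjI S exI[of _ m] bexI[of _ f]) auto
qed

lemma fgsub_free_imageE:
  assumes X: "X \<in> fgsub R M"
  obtains m f where "f \<in> rmod_hom R (free_rmod R m) M" "f ` carrier (free_rmod R m) = X"
proof -
  have S: "rsubmodule R M X" and fg: "finitely_generated R (M \<restriction> X)" using X by (auto simp: fgsub_iff)
  interpret X: right_module R "M \<restriction> X" by (rule right_module_restr[OF right_module_axioms S])
  obtain m f where f: "f \<in> rmod_hom R (free_rmod R m) (M \<restriction> X)"
      "f ` carrier (free_rmod R m) = carrier (M \<restriction> X)"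
    using fg unfolding X.finitely_generated_iff by (elim exE bexE)
  then show thesis
    using that[OF rmod_hom_incl[OF f(1) rsubmodule_subset[OF S]]] by simp
qed

end

lemma fgsub_hom_image:
  assumes P: "free_retract R P" and N: "right_module R N" and f: "f \<in> rmod_hom R P N"
  shows "f ` carrier P \<in> fgsub R N"
proof -
  obtain m i q where iq: "i \<in> rmod_hom R P (free_rmod R m)" "q \<in> rmod_hom R (free_rmod R m) P"
    "\<And>x. x \<in> carrier P \<Longrightarrow> q (i x) = x" by (rule free_retractE[OF P]) (erule (1) that, assumption)
  have "q ` carrier (free_rmod R m) = carrier P"
  proof (rule subset_antisym)
    show "q ` carrier (free_rmod R m) \<subseteq> carrier P" using rmod_hom_closed[OF iq(2)] by (rule image_subsetI)
    show "carrier P \<subseteq> q ` carrier (free_rmod R m)"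
    proof
      fix x assume x: "x \<in> carrier P"
      show "x \<in> q ` carrier (free_rmod R m)"
        using iq(3)[OF x] by (intro image_eqI[of _ q "i x"] rmod_hom_closed[OF iq(1) x]) simp
    qed
  qed
  then have "(\<lambda>x. f (q x)) ` carrier (free_rmod R m) = f ` carrier P" by (simp add: image_image[symmetric])
  then show ?thesis using right_module.fgsub_free_image[OF N rmod_hom_comp[OF iq(2) f]] by simp
qed

locale regular_module = regular_ring R for R :: "('a, 'r) ring_scheme" (structure) +
  fixes M :: "('a, 'm, 's) rmodule_scheme"
  assumes M: "free_retract R M"

sublocale regular_module \<subseteq> right_module R M
  using M by (rule free_retract_right_module)

context regular_module
begin

text \<open>
  Write \<open>X\<close> as the range of a homomorphism \<open>f\<close> from a free module. If \<open>g\<close> is a quasi-inverse of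
  \<open>f\<close>, then \<open>f g\<close> is the identity on \<open>X\<close>.
\<close>

lemma fgsub_retraction:
  assumes X: "X \<in> fgsub R M"
  obtains e where "e \<in> rmod_hom R M M" "e ` carrier M = X" "\<And>x. x \<in> X \<Longrightarrow> e x = x"
proof -
  obtain m f where f: "f \<in> rmod_hom R (free_rmod R m) M" "f ` carrier (free_rmod R m) = X"
    by (rule fgsub_free_imageE[OF X])
  obtain g where g: "g \<in> rmod_hom R M (free_rmod R m)"
    "\<And>x. x \<in> carrier (free_rmod R m) \<Longrightarrow> f (g (f x)) = f x"
    by (rule quasi_inverse[OF free_retract_free M f(1)]) (erule that, assumption)
  let ?e = "\<lambda>x. f (g x)"
  have e: "?e \<in> rmod_hom R M M" by (rule rmod_hom_comp[OF g(1) f(1)])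
  have id: "?e x = x" if "x \<in> X" for x using that g(2) unfolding f(2)[symmetric] by auto
  have "?e ` carrier M = X"
  proof (rule subset_antisym)
    show "?e ` carrier M \<subseteq> X" using rmod_hom_closed[OF g(1)] f(2) by auto
    show "X \<subseteq> ?e ` carrier M"
    proof
      fix x assume x: "x \<in> X"
      then show "x \<in> ?e ` carrier M" using fgsub_subset[OF X] id[OF x] by (intro image_eqI[of _ ?e x]) auto
    qed
  qed
  then show thesis using that e id by simp
qed

lemma free_retract_restr: 
  assumes X: "X \<in> fgsub R M"
  shows "free_retract R (M \<restriction> X)"
proof -
  obtain e where e: "e \<in> rmod_hom R M M" "e ` carrier M = X" "\<And>x. x \<in> X \<Longrightarrow> e x = x"
    by (rule fgsub_retraction[OF X]) (erule (1) that, assumption)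
  show ?thesis
  proof (rule free_retract_retract[OF M])
    show "right_module R (M \<restriction> X)" by (rule right_module_restr[OF right_module_axioms fgsub_rsubmodule[OF X]])
    show "(\<lambda>x. x) \<in> rmod_hom R (M \<restriction> X) M" by (rule rmod_hom_restr[OF rmod_hom_id fgsub_subset[OF X]])
    show "e \<in> rmod_hom R M (M \<restriction> X)" by (rule rmod_hom_corestr[OF e(1)]) (simp add: e(2))
  qed (simp add: e(3))
qed

lemma fgsub_image:
  assumes X: "X \<in> fgsub R M" and N: "right_module R N" and f: "f \<in> rmod_hom R (M \<restriction> X) N"
  shows "f ` X \<in> fgsub R N"
  using fgsub_hom_image[OF free_retract_restr[OF X] N f] by simp

lemma fgsub_carrier: "carrier M \<in> fgsub R M"
  using fgsub_hom_image[OF M right_module_axioms rmod_hom_id] by simp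

lemma fgsub_zero: "{\<zero>\<^bsub>M\<^esub>} \<in> fgsub R M"
proof -
  interpret two_modules R M M ..
  have "(\<lambda>x. \<zero>\<^bsub>M\<^esub>) ` carrier M \<in> fgsub R M"
    by (rule fgsub_hom_image[OF M right_module_axioms zero_hom])
  then show ?thesis using M.zero_closed by (simp add: image_constant)
qed

text \<open>
  For a quasi-inverse \<open>g\<close> of \<open>f\<close> the kernel is the range of \<open>1 - g f\<close>.
\<close>

lemma fgsub_kernel:
  assumes X: "X \<in> fgsub R M" and N: "free_retract R N" and f: "f \<in> rmod_hom R (M \<restriction> X) N"
  shows "{x \<in> X. f x = \<zero>\<^bsub>N\<^esub>} \<in> fgsub R M"
proof -
  have S: "rsubmodule R M X" by (rule fgsub_rsubmodule[OF X])
  interpret XN: two_modules R "M \<restriction> X" N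
    by (intro two_modules.intro right_module_restr right_module_axioms S free_retract_right_module[OF N])
  interpret XX: two_modules R "M \<restriction> X" "M \<restriction> X" ..
  interpret NX: two_modules R N "M \<restriction> X" ..
  obtain g where g: "g \<in> rmod_hom R N (M \<restriction> X)"
    "\<And>x. x \<in> carrier (M \<restriction> X) \<Longrightarrow> f (g (f x)) = f x"
    by (rule quasi_inverse[OF free_retract_restr[OF X] N f]) (erule that, assumption)
  define h where "h x = x \<ominus>\<^bsub>M \<restriction> X\<^esub> g (f x)" for x
  have h: "h \<in> rmod_hom R (M \<restriction> X) (M \<restriction> X)"
    unfolding h_def[abs_def] by (rule XX.diff_hom[OF rmod_hom_id rmod_hom_comp[OF f g(1)]])
  have "h ` X = {x \<in> X. f x = \<zero>\<^bsub>N\<^esub>}"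
  proof safe
    fix x assume x: "x \<in> X"
    then have c: "x \<in> carrier (M \<restriction> X)" by simp
    show "h x \<in> X" using rmod_hom_closed[OF h c] by simp
    show "f (h x) = \<zero>\<^bsub>N\<^esub>"
      using XN.hom_diff[OF f c rmod_hom_closed[OF g(1) rmod_hom_closed[OF f c]]] g(2)[OF c]
        rmod_hom_closed[OF f c] by (simp add: h_def)
  next
    fix x assume x: "x \<in> X" "f x = \<zero>\<^bsub>N\<^esub>"
    then have "h x = x \<ominus>\<^bsub>M \<restriction> X\<^esub> \<zero>\<^bsub>M \<restriction> X\<^esub>" using NX.hom_zero[OF g(1)] by (simp add: h_def)
    also have "\<dots> = x"
      using x right_module.diff_zero[OF right_module_restr[OF right_module_axioms S], of x] by simp
    finally show "x \<in> h ` X" using x(1) by (metis imageI)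
  qed
  moreover have "h \<in> rmod_hom R (M \<restriction> X) M" by (rule rmod_hom_incl[OF h fgsub_subset[OF X]])
  ultimately show ?thesis using fgsub_image[OF X right_module_axioms] by metis
qed

text \<open>
  If \<open>e\<close> is a projection onto \<open>Y\<close>, then \<open>X \<inter> Y\<close> is the kernel of \<open>1 - e\<close> on \<open>X\<close>.
\<close>

lemma fgsub_Int:
  assumes X: "X \<in> fgsub R M" and Y: "Y \<in> fgsub R M"
  shows "X \<inter> Y \<in> fgsub R M"
proof -
  interpret MM: two_modules R M M ..
  obtain e where e: "e \<in> rmod_hom R M M" "e ` carrier M = Y" "\<And>x. x \<in> Y \<Longrightarrow> e x = x"
    by (rule fgsub_retraction[OF Y]) (erule (1) that, assumption)
  have h: "(\<lambda>x. x \<ominus>\<^bsub>M\<^esub> e x) \<in> rmod_hom R (M \<restriction> X) M"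
    by (rule rmod_hom_restr[OF MM.diff_hom[OF rmod_hom_id e(1)] fgsub_subset[OF X]])
  have "x \<ominus>\<^bsub>M\<^esub> e x = \<zero>\<^bsub>M\<^esub> \<longleftrightarrow> x \<in> Y" if "x \<in> X" for x
  proof -
    have x: "x \<in> carrier M" using fgsub_subset[OF X] that by blast
    have "e x \<in> Y" using e(2) x by blast
    moreover have "e x \<in> carrier M" by (rule rmod_hom_closed[OF e(1) x])
    ultimately show ?thesis using diff_eq_zeroD[of x "e x"] e(3) x by auto
  qed
  then have "{x \<in> X. x \<ominus>\<^bsub>M\<^esub> e x = \<zero>\<^bsub>M\<^esub>} = X \<inter> Y" by blast
  then show ?thesis using fgsub_kernel[OF X M h] by simp
qed

lemma fgsub_set_add:
  assumes X: "X \<in> fgsub R M" and Y: "Y \<in> fgsub R M"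
  shows "X <+>\<^bsub>M\<^esub> Y \<in> fgsub R M"
proof -
  obtain e where e: "e \<in> rmod_hom R M M" "e ` carrier M = X" "\<And>x. x \<in> X \<Longrightarrow> e x = x"
    by (rule fgsub_retraction[OF X]) (erule (1) that, assumption)
  obtain e' where e': "e' \<in> rmod_hom R M M" "e' ` carrier M = Y" "\<And>x. x \<in> Y \<Longrightarrow> e' x = x"
    by (rule fgsub_retraction[OF Y]) (erule (1) that, assumption)
  have fr: "free_retract R (rmod_sum M M)" by (rule free_retract_sum[OF M M])
  interpret SM: two_modules R "rmod_sum M M" M
    by (intro two_modules.intro free_retract_right_module[OF fr] right_module_axioms)
  let ?h = "\<lambda>z. e (fst z) \<oplus>\<^bsub>M\<^esub> e' (snd z)"
  have h: "?h \<in> rmod_hom R (rmod_sum M M) M"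
    by (rule SM.sum_hom[OF rmod_hom_comp[OF fst_hom e(1)] rmod_hom_comp[OF snd_hom e'(1)]])
  have "?h ` carrier (rmod_sum M M) = X <+>\<^bsub>M\<^esub> Y"
    unfolding e(2)[symmetric] e'(2)[symmetric] set_add_image by simp
  then show ?thesis using fgsub_hom_image[OF fr right_module_axioms h] by simp
qed

lemma set_add_left: "\<lbrakk>rsubmodule R M C; B \<subseteq> carrier M\<rbrakk> \<Longrightarrow> B \<subseteq> B <+>\<^bsub>M\<^esub> C"
  using rsubmodule_zero[of R M C] by (force simp: set_add_iff)

lemma set_add_right: "\<lbrakk>rsubmodule R M B; C \<subseteq> carrier M\<rbrakk> \<Longrightarrow> C \<subseteq> B <+>\<^bsub>M\<^esub> C"
  using rsubmodule_zero[of R M B] by (force simp: set_add_iff)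

lemma dsumI:
  assumes "B \<in> fgsub R M" "C \<in> fgsub R M" "A \<in> fgsub R M" "B \<subseteq> A" "C \<subseteq> A"
    and "\<And>x. \<lbrakk>x \<in> B; x \<in> C\<rbrakk> \<Longrightarrow> x = \<zero>\<^bsub>M\<^esub>"
    and "\<And>a. a \<in> A \<Longrightarrow> \<exists>b\<in>B. \<exists>c\<in>C. a = b \<oplus>\<^bsub>M\<^esub> c"
  shows "dsum R M A B C"
proof -
  have "B \<inter> C = {\<zero>\<^bsub>M\<^esub>}"
    using assms(1,2,6) rsubmodule_zero[OF fgsub_rsubmodule] by blast
  moreover have "A = B <+>\<^bsub>M\<^esub> C"
    using assms(4,5,7) rsubmodule_add[OF fgsub_rsubmodule[OF assms(3)]]
    by (auto simp: set_add_iff subset_iff)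
  ultimately show ?thesis using assms(1,2) by (simp add: dsum_def)
qed

lemma dsumD:
  assumes d: "dsum R M A B C"
  shows dsum_left: "B \<in> fgsub R M" and dsum_right: "C \<in> fgsub R M" and dsum_total: "A \<in> fgsub R M"
    and dsum_left_subset: "B \<subseteq> A" and dsum_right_subset: "C \<subseteq> A"
    and dsum_Int: "\<And>x. \<lbrakk>x \<in> B; x \<in> C\<rbrakk> \<Longrightarrow> x = \<zero>\<^bsub>M\<^esub>"
proof -
  show B: "B \<in> fgsub R M" and C: "C \<in> fgsub R M" using d by (auto simp: dsum_def)
  show "A \<in> fgsub R M" using d fgsub_set_add by (auto simp: dsum_def)
  show "B \<subseteq> A" "C \<subseteq> A"
    using d set_add_left[OF fgsub_rsubmodule[OF C] fgsub_subset[OF B]]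
      set_add_right[OF fgsub_rsubmodule[OF B] fgsub_subset[OF C]] by (auto simp: dsum_def)
  show "\<And>x. \<lbrakk>x \<in> B; x \<in> C\<rbrakk> \<Longrightarrow> x = \<zero>\<^bsub>M\<^esub>" using d by (auto simp: dsum_def)
qed

lemma dsumE:
  assumes d: "dsum R M A B C" and a: "a \<in> A"
  obtains b c where "b \<in> B" "c \<in> C" "a = b \<oplus>\<^bsub>M\<^esub> c"
  using d a by (auto simp: dsum_def set_add_iff)

lemma dsum_mem: "dsum R M A B C \<Longrightarrow> b \<in> B \<Longrightarrow> c \<in> C \<Longrightarrow> b \<oplus>\<^bsub>M\<^esub> c \<in> A"
  by (auto simp: dsum_def set_add_iff)

lemma dsum_carrier:
  assumes "dsum R M A B C"
  shows "a \<in> A \<Longrightarrow> a \<in> carrier M" "b \<in> B \<Longrightarrow> b \<in> carrier M" "c \<in> C \<Longrightarrow> c \<in> carrier M"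
  using fgsub_subset dsumD[OF assms] by blast+

lemma dsum_unique:
  assumes d: "dsum R M A B C" and "b \<in> B" "b' \<in> B" "c \<in> C" "c' \<in> C"
    and eq: "b \<oplus>\<^bsub>M\<^esub> c = b' \<oplus>\<^bsub>M\<^esub> c'"
  shows "b = b'" "c = c'"
proof -
  have cc: "b \<in> carrier M" "b' \<in> carrier M" "c \<in> carrier M" "c' \<in> carrier M"
    using assms dsum_carrier[OF d] by auto
  have "(b \<ominus>\<^bsub>M\<^esub> b') \<oplus>\<^bsub>M\<^esub> (c \<ominus>\<^bsub>M\<^esub> c') = \<zero>\<^bsub>M\<^esub>"
    using add_diff_add[of b c b' c'] eq cc by (simp add: M.a_closed)
  then have *: "b \<ominus>\<^bsub>M\<^esub> b' = \<ominus>\<^bsub>M\<^esub> (c \<ominus>\<^bsub>M\<^esub> c')" using cc by (intro M.minus_equality[symmetric]) auto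
  have "b \<ominus>\<^bsub>M\<^esub> b' \<in> B" "\<ominus>\<^bsub>M\<^esub> (c \<ominus>\<^bsub>M\<^esub> c') \<in> C"
    using assms(2-5) rsubmodule_diff[OF fgsub_rsubmodule[OF dsum_left[OF d]]]
      rsubmodule_diff[OF fgsub_rsubmodule[OF dsum_right[OF d]]]
      rsubmodule_neg[OF fgsub_rsubmodule[OF dsum_right[OF d]]] by auto
  then have "b \<ominus>\<^bsub>M\<^esub> b' = \<zero>\<^bsub>M\<^esub>" using dsum_Int[OF d] * by simp
  then show "b = b'" using diff_eq_zeroD cc by blast
  then show "c = c'" using eq cc by simp
qed

lemma dsum_commute: "dsum R M A B C \<Longrightarrow> dsum R M A C B"
  unfolding dsum_def using fgsub_subset[of B R M] fgsub_subset[of C R M]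
  by (auto simp: set_add_iff M.a_comm subset_iff) (metis M.a_comm)+

text \<open>
  The kernel on \<open>Y\<close> of a projection onto \<open>X\<close> is a complement.
\<close>

lemma complement_exists:
  assumes X: "X \<in> fgsub R M" and Y: "Y \<in> fgsub R M" and XY: "X \<subseteq> Y"
  obtains Z where "dsum R M Y X Z"
proof -
  obtain e where e: "e \<in> rmod_hom R M M" "e ` carrier M = X" "\<And>x. x \<in> X \<Longrightarrow> e x = x"
    by (rule fgsub_retraction[OF X]) (erule (1) that, assumption)
  interpret MM: two_modules R M M ..
  let ?Z = "{y \<in> Y. e y = \<zero>\<^bsub>M\<^esub>}"
  have Z: "?Z \<in> fgsub R M"
    by (rule fgsub_kernel[OF Y M rmod_hom_restr[OF e(1) fgsub_subset[OF Y]]])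
  have "dsum R M Y X ?Z"
  proof (rule dsumI[OF X Z Y XY])
    fix y assume y: "y \<in> Y"
    have yM: "y \<in> carrier M" using fgsub_subset[OF Y] y by blast
    have ey: "e y \<in> X" "e y \<in> Y" using e(2) yM XY by auto
    have eyM: "e y \<in> carrier M" by (rule rmod_hom_closed[OF e(1) yM])
    have "e (y \<ominus>\<^bsub>M\<^esub> e y) = \<zero>\<^bsub>M\<^esub>" using MM.hom_diff[OF e(1) yM eyM] e(3)[OF ey(1)] eyM by simp
    moreover have "y \<ominus>\<^bsub>M\<^esub> e y \<in> Y" by (rule rsubmodule_diff[OF fgsub_rsubmodule[OF Y] y ey(2)])
    ultimately show "\<exists>b\<in>X. \<exists>c\<in>?Z. y = b \<oplus>\<^bsub>M\<^esub> c"
      using ey add_diff_cancel[OF eyM yM]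
      by (intro bexI[of _ "e y"] bexI[of _ "y \<ominus>\<^bsub>M\<^esub> e y"]) auto
  qed (use e(3) in auto)
  then show thesis by (rule that)
qed

lemma dsum_projection:
  assumes d: "dsum R M A B C"
  obtains q where "q \<in> rmod_hom R (M \<restriction> A) M"
    "\<And>b c. \<lbrakk>b \<in> B; c \<in> C\<rbrakk> \<Longrightarrow> q (b \<oplus>\<^bsub>M\<^esub> c) = b"
proof -
  note cc = dsum_carrier[OF d]
  note SB = fgsub_rsubmodule[OF dsum_left[OF d]]
  note SC = fgsub_rsubmodule[OF dsum_right[OF d]]
  define q where "q a = (THE b. b \<in> B \<and> (\<exists>c\<in>C. a = b \<oplus>\<^bsub>M\<^esub> c))" for a
  have q: "q (b \<oplus>\<^bsub>M\<^esub> c) = b" if "b \<in> B" "c \<in> C" for b c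
    unfolding q_def using that by (intro the_equality) (auto dest: dsum_unique(1)[OF d])
  have "q \<in> rmod_hom R (M \<restriction> A) M"
  proof (rule rmod_homI)
    fix x assume "x \<in> carrier (M \<restriction> A)"
    then obtain b c where x: "b \<in> B" "c \<in> C" "x = b \<oplus>\<^bsub>M\<^esub> c" using dsumE[OF d, of x] by auto
    then show "q x \<in> carrier M" using q cc(2) by simp
    show "q (x \<bullet>\<^bsub>M \<restriction> A\<^esub> a) = q x \<bullet>\<^bsub>M\<^esub> a" if "a \<in> carrier R" for a
      using x that q rsubmodule_ract[OF SB] rsubmodule_ract[OF SC] cc(2,3)
      by (simp add: ract_l_distr)
    fix y assume "y \<in> carrier (M \<restriction> A)"
    then obtain b' c' where y: "b' \<in> B" "c' \<in> C" "y = b' \<oplus>\<^bsub>M\<^esub> c'" using dsumE[OF d, of y] by auto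
    have "x \<oplus>\<^bsub>M\<^esub> y = (b \<oplus>\<^bsub>M\<^esub> b') \<oplus>\<^bsub>M\<^esub> (c \<oplus>\<^bsub>M\<^esub> c')"
      using x y cc(2,3) by (simp add: M.a_assoc M.a_lcomm)
    then show "q (x \<oplus>\<^bsub>M \<restriction> A\<^esub> y) = q x \<oplus>\<^bsub>M\<^esub> q y"
      using x y q rsubmodule_add[OF SB] rsubmodule_add[OF SC] by simp
  qed
  then show thesis using q by (rule that)
qed

text \<open>
  The form that relation (D1) takes for complements.
\<close>

lemma dsum_assoc:
  assumes d: "dsum R M C B F" and d': "dsum R M B A E"
  shows "dsum R M C A (E <+>\<^bsub>M\<^esub> F)" "dsum R M (E <+>\<^bsub>M\<^esub> F) E F"
proof -
  note D = dsumD[OF d] and D' = dsumD[OF d']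
  note cc = dsum_carrier[OF d] dsum_carrier[OF d']
  have EF: "E <+>\<^bsub>M\<^esub> F \<in> fgsub R M" by (rule fgsub_set_add[OF D'(2) D(2)])
  have E0: "\<zero>\<^bsub>M\<^esub> \<in> E" by (rule rsubmodule_zero[OF fgsub_rsubmodule[OF D'(2)]])
  show "dsum R M (E <+>\<^bsub>M\<^esub> F) E F"
    unfolding dsum_def using D(2,6) D'(2,5) E0 rsubmodule_zero[OF fgsub_rsubmodule[OF D(2)]] by auto
  show "dsum R M C A (E <+>\<^bsub>M\<^esub> F)"
  proof (rule dsumI[OF D'(1) EF D(3)])
    show "A \<subseteq> C" using D'(4) D(4) by blast
    show "E <+>\<^bsub>M\<^esub> F \<subseteq> C"
      using D'(5) dsum_mem[OF d] by (auto simp: set_add_iff subset_iff)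
  next
    fix x assume x: "x \<in> A" "x \<in> E <+>\<^bsub>M\<^esub> F"
    then obtain b c where bc: "b \<in> E" "c \<in> F" "x = b \<oplus>\<^bsub>M\<^esub> c" by (auto simp: set_add_iff)
    have "x \<oplus>\<^bsub>M\<^esub> \<zero>\<^bsub>M\<^esub> = b \<oplus>\<^bsub>M\<^esub> c" using bc x cc by simp
    then have "x = b" using dsum_unique(1)[OF d, of x b "\<zero>\<^bsub>M\<^esub>" c] x(1) bc D'(4,5)
        rsubmodule_zero[OF fgsub_rsubmodule[OF D(2)]] by blast
    then show "x = \<zero>\<^bsub>M\<^esub>" using D'(6) x(1) bc(1) by blast
  next
    fix x assume "x \<in> C"
    then obtain b c where bc: "b \<in> B" "c \<in> F" "x = b \<oplus>\<^bsub>M\<^esub> c" by (rule dsumE[OF d])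
    obtain a e where ae: "a \<in> A" "e \<in> E" "b = a \<oplus>\<^bsub>M\<^esub> e" using bc(1) by (rule dsumE[OF d'])
    have "x = a \<oplus>\<^bsub>M\<^esub> (e \<oplus>\<^bsub>M\<^esub> c)" using bc ae cc by (simp add: M.a_assoc)
    then show "\<exists>b\<in>A. \<exists>c\<in>E <+>\<^bsub>M\<^esub> F. x = b \<oplus>\<^bsub>M\<^esub> c"
      using ae(1,2) bc(2) by (intro bexI[of _ a] bexI[of _ "e \<oplus>\<^bsub>M\<^esub> c"]) (auto simp: set_add_iff)
  qed
qed

text \<open>
  The form that relation (D2) takes for complements.
\<close>

lemma dsum_join:
  assumes A: "A \<in> fgsub R M" and d: "dsum R M B (A \<inter> B) C"
  shows "dsum R M (A <+>\<^bsub>M\<^esub> B) A C"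
proof -
  note D = dsumD[OF d]
  note AS = fgsub_rsubmodule[OF A] and BS = fgsub_rsubmodule[OF D(3)]
  show ?thesis
  proof (rule dsumI[OF A D(2) fgsub_set_add[OF A D(3)]])
    show "A \<subseteq> A <+>\<^bsub>M\<^esub> B" by (rule set_add_left[OF BS fgsub_subset[OF A]])
    show "C \<subseteq> A <+>\<^bsub>M\<^esub> B" using set_add_right[OF AS fgsub_subset[OF D(3)]] D(5) by blast
    show "x = \<zero>\<^bsub>M\<^esub>" if "x \<in> A" "x \<in> C" for x using D(5,6) that by blast
  next
    fix x assume "x \<in> A <+>\<^bsub>M\<^esub> B"
    then obtain a b where ab: "a \<in> A" "b \<in> B" "x = a \<oplus>\<^bsub>M\<^esub> b" by (auto simp: set_add_iff)
    obtain i c where ic: "i \<in> A \<inter> B" "c \<in> C" "b = i \<oplus>\<^bsub>M\<^esub> c" using ab(2) by (rule dsumE[OF d])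
    have "x = (a \<oplus>\<^bsub>M\<^esub> i) \<oplus>\<^bsub>M\<^esub> c"
      using ab ic fgsub_subset[OF A] dsum_carrier[OF d] by (auto simp: M.a_assoc subset_iff)
    moreover have "a \<oplus>\<^bsub>M\<^esub> i \<in> A" using ab ic rsubmodule_add[OF AS] by blast
    ultimately show "\<exists>b\<in>A. \<exists>c\<in>C. x = b \<oplus>\<^bsub>M\<^esub> c" using ic(2) by blast
  qed
qed

text \<open>
  Homomorphisms split: \<open>f\<close> is injective on any complement of its kernel, which therefore is a copy of
  the image.
\<close>

lemma kernel_split:
  assumes A: "A \<in> fgsub R M" and N: "free_retract R N" and f: "f \<in> rmod_hom R (M \<restriction> A) N"
  obtains A1 where "dsum R M A A1 {x \<in> A. f x = \<zero>\<^bsub>N\<^esub>}" "inj_on f A1" "f ` A1 = f ` A"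
proof -
  let ?K = "{x \<in> A. f x = \<zero>\<^bsub>N\<^esub>}"
  have K: "?K \<in> fgsub R M" by (rule fgsub_kernel[OF A N f])
  obtain A1 where "dsum R M A ?K A1" by (rule complement_exists[OF K A]) auto
  then have d: "dsum R M A A1 ?K" by (rule dsum_commute)
  note D = dsumD[OF d]
  note AS = fgsub_rsubmodule[OF A]
  interpret AN: two_modules R "M \<restriction> A" N
    by (intro two_modules.intro right_module_restr right_module_axioms AS free_retract_right_module[OF N])
  have "rsubmodule R (M \<restriction> A) A1"
    unfolding rsubmodule_restr_iff[OF right_module_axioms AS]
    using D(4) fgsub_rsubmodule[OF D(1)] by simp
  then have "inj_on f A1" using AN.inj_on_hom_iff[OF f] D(4,6) by (auto simp: subset_iff)
  moreover have "f ` A1 = f ` A"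
  proof
    show "f ` A \<subseteq> f ` A1"
    proof (rule image_subsetI)
      fix a assume "a \<in> A"
      then obtain b c where bc: "b \<in> A1" "c \<in> ?K" "a = b \<oplus>\<^bsub>M\<^esub> c" by (rule dsumE[OF d])
      then have b: "b \<in> A" "c \<in> A" using D(4) by auto
      have "f a = f b"
        using rmod_hom_add[OF f, of b c] rmod_hom_closed[OF f, of b] b bc by simp
      then show "f a \<in> f ` A1" using bc(1) by simp
    qed
  qed (use D(4) in blast)
  ultimately show thesis using d that by blast
qed

lemma dsum_hom_image:
  assumes d: "dsum R M A B C" and N: "free_retract R N"
    and f: "f \<in> rmod_hom R (M \<restriction> A) N" and inj: "inj_on f A"
  shows "dsum R N (f ` A) (f ` B) (f ` C)"
proof -
  note D = dsumD[OF d]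
  interpret N: regular_module R N using N by unfold_locales
  have AS: "rsubmodule R M A" by (rule fgsub_rsubmodule[OF D(3)])
  interpret AN: two_modules R "M \<restriction> A" N
    by (intro two_modules.intro right_module_restr right_module_axioms AS N.right_module_axioms)
  have r: "f \<in> rmod_hom R (M \<restriction> B) N" "f \<in> rmod_hom R (M \<restriction> C) N"
    using rmod_hom_restr[OF f, of B] rmod_hom_restr[OF f, of C] D(4,5) by simp_all
  show ?thesis
  proof (rule N.dsumI)
    show "f ` B \<in> fgsub R N" "f ` C \<in> fgsub R N" "f ` A \<in> fgsub R N"
      using fgsub_image[OF _ N.right_module_axioms] D(1-3) r f by auto
    show "f ` B \<subseteq> f ` A" "f ` C \<subseteq> f ` A" using D(4,5) by auto
    show "y = \<zero>\<^bsub>N\<^esub>" if y: "y \<in> f ` B" "y \<in> f ` C" for y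
    proof -
      obtain b c where bc: "b \<in> B" "c \<in> C" "y = f b" "y = f c" using y by blast
      then have "b = c" using inj D(4,5) by (metis inj_onD subsetD)
      then have "b = \<zero>\<^bsub>M\<^esub>" using D(6) bc by blast
      then show ?thesis using bc AN.hom_zero[OF f] by simp
    qed
    show "\<exists>b\<in>f ` B. \<exists>c\<in>f ` C. y = b \<oplus>\<^bsub>N\<^esub> c" if y: "y \<in> f ` A" for y
    proof -
      obtain a where a: "a \<in> A" "y = f a" using y by blast
      obtain b c where bc: "b \<in> B" "c \<in> C" "a = b \<oplus>\<^bsub>M\<^esub> c" using a(1) by (rule dsumE[OF d])
      have "y = f b \<oplus>\<^bsub>N\<^esub> f c"
        using rmod_hom_add[OF f, of b c] bc a(2) D(4,5) by (auto simp: subset_iff)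
      then show ?thesis using bc by blast
    qed
  qed
qed

lemma dsum_isomorphic:
  assumes d: "dsum R M A B C"
  shows "rmod_isomorphic R (rmod_sum (M \<restriction> B) (M \<restriction> C)) (M \<restriction> A)"
proof (rule rmod_isomorphicI[of "\<lambda>z. fst z \<oplus>\<^bsub>M\<^esub> snd z"])
  note cc = dsum_carrier[OF d]
  show "(\<lambda>z. fst z \<oplus>\<^bsub>M\<^esub> snd z) \<in> rmod_hom R (rmod_sum (M \<restriction> B) (M \<restriction> C)) (M \<restriction> A)"
  proof (rule rmod_homI)
    fix x y assume "x \<in> carrier (rmod_sum (M \<restriction> B) (M \<restriction> C))" "y \<in> carrier (rmod_sum (M \<restriction> B) (M \<restriction> C))"
    then show "fst (x \<oplus>\<^bsub>rmod_sum (M \<restriction> B) (M \<restriction> C)\<^esub> y) \<oplus>\<^bsub>M\<^esub> snd (x \<oplus>\<^bsub>rmod_sum (M \<restriction> B) (M \<restriction> C)\<^esub> y)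
        = (fst x \<oplus>\<^bsub>M\<^esub> snd x) \<oplus>\<^bsub>M \<restriction> A\<^esub> (fst y \<oplus>\<^bsub>M\<^esub> snd y)"
      using cc(2,3) by (auto simp: M.a_assoc M.a_lcomm)
  qed (use dsum_mem[OF d] cc(2,3) in \<open>auto simp: ract_l_distr\<close>)
  show "bij_betw (\<lambda>z. fst z \<oplus>\<^bsub>M\<^esub> snd z) (carrier (rmod_sum (M \<restriction> B) (M \<restriction> C))) (carrier (M \<restriction> A))"
    unfolding bij_betw_def
  proof
    show "inj_on (\<lambda>z. fst z \<oplus>\<^bsub>M\<^esub> snd z) (carrier (rmod_sum (M \<restriction> B) (M \<restriction> C)))"
      by (rule inj_onI) (auto dest: dsum_unique[OF d])
    show "(\<lambda>z. fst z \<oplus>\<^bsub>M\<^esub> snd z) ` carrier (rmod_sum (M \<restriction> B) (M \<restriction> C)) = carrier (M \<restriction> A)"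
      using d set_add_image[where f = "\<lambda>x. x" and g = "\<lambda>x. x" and M = M and A = B and B = C] by (simp add: dsum_def)
  qed
qed

text \<open>
  The projection onto \<open>C\<close> along \<open>B\<close> maps any other complement of \<open>B\<close> isomorphically onto \<open>C\<close>.
\<close>

lemma complements_isomorphic:
  assumes d: "dsum R M A B C" and d': "dsum R M A B C'"
  shows "rmod_isomorphic R (M \<restriction> C') (M \<restriction> C)"
proof -
  note D = dsumD[OF d] and D' = dsumD[OF d']
  note cc = dsum_carrier[OF d] dsum_carrier[OF d']
  obtain q where q: "q \<in> rmod_hom R (M \<restriction> A) M"
    "\<And>c b. \<lbrakk>c \<in> C; b \<in> B\<rbrakk> \<Longrightarrow> q (c \<oplus>\<^bsub>M\<^esub> b) = c"
    by (rule dsum_projection[OF dsum_commute[OF d]]) (erule that, assumption)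
  have q': "q (b \<oplus>\<^bsub>M\<^esub> c) = c" if "c \<in> C" "b \<in> B" for b c
    using q(2)[OF that] that cc by (simp add: M.a_comm)
  have B0: "\<zero>\<^bsub>M\<^esub> \<in> B" by (rule rsubmodule_zero[OF fgsub_rsubmodule[OF D(1)]])
  have qC: "q c = c" if "c \<in> C" for c using q(2)[OF that B0] that cc by simp
  have im: "q ` A \<subseteq> C" using q' by (auto elim!: dsumE[OF d])
  have h: "q \<in> rmod_hom R (M \<restriction> C') (M \<restriction> C)"
    using rmod_hom_restr[OF q(1), of C'] D'(5) im by (intro rmod_hom_corestr) auto
  interpret CC: two_modules R "M \<restriction> C'" "M \<restriction> C"
    by (intro two_modules.intro right_module_restr right_module_axioms fgsub_rsubmodule D(2) D'(2))
  have "inj_on q (carrier (M \<restriction> C'))"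
    unfolding CC.inj_on_hom_iff[OF h rsubmodule_carrier[OF CC.M.right_module_axioms]]
  proof (intro ballI impI)
    fix x assume x: "x \<in> carrier (M \<restriction> C')" "q x = \<zero>\<^bsub>M \<restriction> C\<^esub>"
    then obtain b c where bc: "b \<in> B" "c \<in> C" "x = b \<oplus>\<^bsub>M\<^esub> c" using dsumE[OF d, of x] D'(5) by auto
    then have "c = \<zero>\<^bsub>M\<^esub>" using x q' by simp
    then have "x \<in> B" using bc cc by simp
    then show "x = \<zero>\<^bsub>M \<restriction> C'\<^esub>" using D'(6) x by simp
  qed
  moreover have "q ` carrier (M \<restriction> C') = carrier (M \<restriction> C)"
  proof
    show "q ` carrier (M \<restriction> C') \<subseteq> carrier (M \<restriction> C)" using im D'(5) by auto
    show "carrier (M \<restriction> C) \<subseteq> q ` carrier (M \<restriction> C')"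
    proof
      fix c assume "c \<in> carrier (M \<restriction> C)"
      then have c: "c \<in> C" "c \<in> A" using D(5) by auto
      obtain b c' where bc: "b \<in> B" "c' \<in> C'" "c = b \<oplus>\<^bsub>M\<^esub> c'" using c(2) by (rule dsumE[OF d'])
      have a: "b \<in> A" "c' \<in> A" using bc D(4) D'(5) by auto
      have "q b = \<zero>\<^bsub>M\<^esub>"
        using q'[of "\<zero>\<^bsub>M\<^esub>" b] bc(1) cc rsubmodule_zero[OF fgsub_rsubmodule[OF D(2)]] by simp
      then have "q c = q c'"
        using rmod_hom_add[OF q(1), of b c'] rmod_hom_closed[OF q(1), of c'] a bc by simp
      then show "c \<in> q ` carrier (M \<restriction> C')" using qC[OF c(1)] bc(2) by auto
    qed
  qed
  ultimately show ?thesis by (intro rmod_isomorphicI[OF h]) (simp add: bij_betw_def)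
qed

end

section \<open>The monoid of isomorphism classes\<close>

context ring
begin

lemma rmod_class_eqI:
  assumes "right_module R M" "rmod_isomorphic R M N"
  shows "rmod_class R M = rmod_class R N"
  using rmod_isomorphic_trans[OF _ assms(2)] rmod_isomorphic_trans[OF _ rmod_isomorphic_sym[OF assms]]
  unfolding rmod_class_def by blast

lemma rmod_class_mem_iff:
  fixes C :: "('a, nat \<Rightarrow> 'a) rmodule"
  shows "C \<in> rmod_class R M \<longleftrightarrow> free_retract R C \<and> rmod_isomorphic R C M"
  by (simp add: rmod_class_def fg_projective_iff)

text \<open>
  The image of \<open>M\<close> in the free module of which it is a retract has the element type used for classes.
  So the class of \<open>M\<close> is inhabited whatever the element type of \<open>M\<close> is, and equal classes
  mean isomorphic modules.
\<close>

lemma rmod_class_memE: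
  assumes M: "free_retract R M"
  obtains C where "C \<in> rmod_class R M" "free_retract R C" "rmod_class R C = rmod_class R M"
proof -
  obtain m i q where iq: "i \<in> rmod_hom R M (free_rmod R m)" "q \<in> rmod_hom R (free_rmod R m) M"
    "\<And>x. x \<in> carrier M \<Longrightarrow> q (i x) = x" by (rule free_retractE[OF M]) (erule (1) that, assumption)
  let ?C = "free_rmod R m \<restriction> i ` carrier M"
  interpret two_modules R M "free_rmod R m"
    by (intro two_modules.intro free_retract_right_module[OF M] right_module_free)
  have C: "right_module R ?C"
    by (intro right_module_restr right_module_free image_rsubmodule[OF iq(1)] rsubmodule_carrier
        free_retract_right_module[OF M])
  have "inj_on i (carrier M)" by (rule inj_on_inverseI[of _ q]) (rule iq(3))
  then have MC: "rmod_isomorphic R M ?C"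
    by (intro rmod_isomorphicI[OF rmod_hom_corestr[OF iq(1) order_refl]]) (simp add: bij_betw_def)
  then have "rmod_isomorphic R ?C M" by (rule rmod_isomorphic_sym[OF free_retract_right_module[OF M]])
  moreover from this have "rmod_class R ?C = rmod_class R M" by (rule rmod_class_eqI[OF C])
  moreover have "free_retract R ?C" by (rule free_retract_iso[OF M C MC])
  ultimately show thesis using that[of ?C] by (simp add: rmod_class_mem_iff)
qed

lemma rmod_class_eqD:
  assumes M: "free_retract R M" and eq: "rmod_class R M = rmod_class R N"
  shows "rmod_isomorphic R M N"
proof -
  obtain C where C: "C \<in> rmod_class R M" by (rule rmod_class_memE[OF M])
  then have "rmod_isomorphic R C M" "rmod_isomorphic R C N" "right_module R C"
    using eq free_retract_right_module by (auto simp: rmod_class_mem_iff)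
  then show ?thesis using rmod_isomorphic_sym rmod_isomorphic_trans by blast
qed

lemma V_carrier: "carrier (V_monoid R) = {rmod_class R A | A :: ('a, nat \<Rightarrow> 'a) rmodule. free_retract R A}"
  by (simp add: V_monoid_def fg_projective_iff)

lemma V_carrierE:
  assumes "x \<in> carrier (V_monoid R)"
  obtains A :: "('a, nat \<Rightarrow> 'a) rmodule" where "free_retract R A" "x = rmod_class R A"
  using assms unfolding V_carrier by auto

lemma rmod_class_in_V: "free_retract R M \<Longrightarrow> rmod_class R M \<in> carrier (V_monoid R)"
proof -
  assume "free_retract R M"
  then obtain C :: "('a, nat \<Rightarrow> 'a) rmodule" where "free_retract R C" "rmod_class R C = rmod_class R M"
    by (rule rmod_class_memE)
  then show ?thesis unfolding V_carrier by blast
qed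

lemma V_mult:
  assumes M: "free_retract R M" and N: "free_retract R N"
  shows "rmod_class R M \<otimes>\<^bsub>V_monoid R\<^esub> rmod_class R N = rmod_class R (rmod_sum M N)"
proof -
  have eq: "rmod_class R (rmod_sum A B) = rmod_class R (rmod_sum M N)"
    if "A \<in> rmod_class R M" "B \<in> rmod_class R N" for A B
  proof (rule rmod_class_eqI)
    show "right_module R (rmod_sum A B)"
      using that by (auto simp: rmod_class_mem_iff intro: free_retract_right_module free_retract_sum)
    show "rmod_isomorphic R (rmod_sum A B) (rmod_sum M N)"
      using that by (auto simp: rmod_class_mem_iff intro: rmod_isomorphic_sum)
  qed
  obtain A where A: "A \<in> rmod_class R M" by (rule rmod_class_memE[OF M])
  obtain B where B: "B \<in> rmod_class R N" by (rule rmod_class_memE[OF N])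
  have "rmod_class R M \<otimes>\<^bsub>V_monoid R\<^esub> rmod_class R N
      = (\<Union>A\<in>rmod_class R M. \<Union>B\<in>rmod_class R N. rmod_class R (rmod_sum A B))"
    by (simp add: V_monoid_def)
  also have "\<dots> = rmod_class R (rmod_sum M N)"
  proof
    show "(\<Union>A\<in>rmod_class R M. \<Union>B\<in>rmod_class R N. rmod_class R (rmod_sum A B)) \<subseteq> rmod_class R (rmod_sum M N)"
      by (intro UN_least) (simp add: eq)
    show "rmod_class R (rmod_sum M N) \<subseteq> (\<Union>A\<in>rmod_class R M. \<Union>B\<in>rmod_class R N. rmod_class R (rmod_sum A B))"
      unfolding eq[OF A B, symmetric] using A B by blast
  qed
  finally show ?thesis .
qed

lemma V_one: "\<one>\<^bsub>V_monoid R\<^esub> = rmod_class R (free_rmod R 0)"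
  by (simp add: V_monoid_def)

lemma rmod_class_trivial:
  assumes M: "right_module R M" and triv: "carrier M = {\<zero>\<^bsub>M\<^esub>}"
  shows "rmod_class R M = \<one>\<^bsub>V_monoid R\<^esub>"
proof -
  interpret two_modules R M "free_rmod R 0" by (intro two_modules.intro M right_module_free)
  have "carrier (free_rmod R 0) = {\<zero>\<^bsub>free_rmod R 0\<^esub>}"
    by (auto simp: free_rmod_def)
  then have "rmod_isomorphic R M (free_rmod R 0)"
    using triv by (intro rmod_isomorphicI[OF zero_hom]) (simp add: bij_betw_def)
  then show ?thesis unfolding V_one by (rule rmod_class_eqI[OF M])
qed

lemma V_comm_monoid: "comm_monoid (V_monoid R)"
proof (rule comm_monoidI)
  fix x y z
  assume "x \<in> carrier (V_monoid R)" "y \<in> carrier (V_monoid R)"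
  then obtain A B :: "('a, nat \<Rightarrow> 'a) rmodule" where A: "free_retract R A" "x = rmod_class R A"
    and B: "free_retract R B" "y = rmod_class R B" by (metis V_carrierE)
  have AB: "free_retract R (rmod_sum A B)" by (rule free_retract_sum[OF A(1) B(1)])
  show "x \<otimes>\<^bsub>V_monoid R\<^esub> y \<in> carrier (V_monoid R)"
    unfolding A(2) B(2) V_mult[OF A(1) B(1)] by (rule rmod_class_in_V[OF AB])
  show "x \<otimes>\<^bsub>V_monoid R\<^esub> y = y \<otimes>\<^bsub>V_monoid R\<^esub> x"
    unfolding A(2) B(2) V_mult[OF A(1) B(1)] V_mult[OF B(1) A(1)]
    by (rule rmod_class_eqI[OF free_retract_right_module[OF AB] rmod_isomorphic_sum_comm])
  assume "z \<in> carrier (V_monoid R)"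
  then obtain C :: "('a, nat \<Rightarrow> 'a) rmodule" where C: "free_retract R C" "z = rmod_class R C"
    by (rule V_carrierE)
  have BC: "free_retract R (rmod_sum B C)" by (rule free_retract_sum[OF B(1) C(1)])
  show "x \<otimes>\<^bsub>V_monoid R\<^esub> y \<otimes>\<^bsub>V_monoid R\<^esub> z = x \<otimes>\<^bsub>V_monoid R\<^esub> (y \<otimes>\<^bsub>V_monoid R\<^esub> z)"
    unfolding A(2) B(2) C(2) V_mult[OF A(1) B(1)] V_mult[OF B(1) C(1)] V_mult[OF AB C(1)] V_mult[OF A(1) BC]
    by (rule rmod_class_eqI[OF free_retract_right_module[OF free_retract_sum[OF AB C(1)]]
          rmod_isomorphic_sum_assoc])
next
  show "\<one>\<^bsub>V_monoid R\<^esub> \<in> carrier (V_monoid R)"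
    unfolding V_one by (rule rmod_class_in_V[OF free_retract_free])
next
  fix x assume "x \<in> carrier (V_monoid R)"
  then obtain A :: "('a, nat \<Rightarrow> 'a) rmodule" where A: "free_retract R A" "x = rmod_class R A"
    by (rule V_carrierE)
  have "carrier (free_rmod R 0) = {\<lambda>_. undefined}" by (simp add: free_rmod_def)
  then have "bij_betw snd (carrier (rmod_sum (free_rmod R 0) A)) (carrier A)"
    by (auto simp: bij_betw_def inj_on_def)
  then show "\<one>\<^bsub>V_monoid R\<^esub> \<otimes>\<^bsub>V_monoid R\<^esub> x = x"
    unfolding V_one A(2) V_mult[OF free_retract_free A(1)]
    by (intro rmod_class_eqI free_retract_right_module free_retract_sum free_retract_free A(1)
        rmod_isomorphicI[OF snd_hom])
qed

end

sublocale regular_ring \<subseteq> V: comm_monoid "V_monoid R"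
  by (rule V_comm_monoid)

context regular_module
begin

lemma class_in_V: "A \<in> fgsub R M \<Longrightarrow> rmod_class R (M \<restriction> A) \<in> carrier (V_monoid R)"
  by (rule rmod_class_in_V[OF free_retract_restr])

lemma class_zero: "rmod_class R (M \<restriction> {\<zero>\<^bsub>M\<^esub>}) = \<one>\<^bsub>V_monoid R\<^esub>"
  by (rule rmod_class_trivial[OF right_module_restr[OF right_module_axioms
          rsubmodule_zero_set[OF right_module_axioms]]]) simp

lemma class_dsum:
  assumes d: "dsum R M A B C"
  shows "rmod_class R (M \<restriction> A) = rmod_class R (M \<restriction> B) \<otimes>\<^bsub>V_monoid R\<^esub> rmod_class R (M \<restriction> C)"
proof -
  have B: "free_retract R (M \<restriction> B)" and C: "free_retract R (M \<restriction> C)"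
    using free_retract_restr dsumD(1,2)[OF d] by auto
  show ?thesis
    unfolding V_mult[OF B C]
    by (rule rmod_class_eqI[OF free_retract_right_module[OF free_retract_sum[OF B C]]
          dsum_isomorphic[OF d], symmetric])
qed

lemma class_image:
  assumes A: "A \<in> fgsub R M" and f: "f \<in> rmod_hom R (M \<restriction> A) N" and inj: "inj_on f A"
  shows "rmod_class R (N \<restriction> f ` A) = rmod_class R (M \<restriction> A)"
proof (rule rmod_class_eqI[symmetric])
  show "right_module R (M \<restriction> A)" by (rule free_retract_right_module[OF free_retract_restr[OF A]])
  show "rmod_isomorphic R (M \<restriction> A) (N \<restriction> f ` A)"
    using inj by (intro rmod_isomorphicI[OF rmod_hom_corestr[OF f]]) (auto simp: bij_betw_def)
qed

lemma class_complements:
  assumes d: "dsum R M A B C" and d': "dsum R M A B C'"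
  shows "rmod_class R (M \<restriction> C) = rmod_class R (M \<restriction> C')"
  by (rule rmod_class_eqI[OF free_retract_right_module[OF free_retract_restr[OF dsum_right[OF d]]]
        complements_isomorphic[OF d' d]])

text \<open>
  Put \<open>A' = A \<inter> D\<close>, the kernel on \<open>A\<close> of the projection \<open>q\<close> onto \<open>Y\<close> along \<open>D\<close>, and let \<open>A1\<close> be a
  complement of \<open>A'\<close> in \<open>A\<close>. Then \<open>q\<close> maps \<open>A1\<close> isomorphically onto \<open>Y' = q(A)\<close>. With \<open>Y''\<close> a
  complement of \<open>Y'\<close> in \<open>Y\<close> and \<open>D''\<close> one of \<open>A'\<close> in \<open>D\<close>, the sum \<open>Y'' + D''\<close> is direct and
  complements \<open>A\<close> in \<open>T\<close>, so it is isomorphic to \<open>B\<close>.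
\<close>

lemma common_refinement:
  assumes d: "dsum R M T A B" and d': "dsum R M T Y D"
  obtains A1 A' Y' Y'' D'' where "dsum R M A A1 A'" "dsum R M Y Y' Y''" "dsum R M D A' D''"
    "rmod_class R (M \<restriction> A1) = rmod_class R (M \<restriction> Y')"
    "rmod_class R (M \<restriction> B) = rmod_class R (M \<restriction> Y'') \<otimes>\<^bsub>V_monoid R\<^esub> rmod_class R (M \<restriction> D'')"
proof -
  note E = dsumD[OF d] and E' = dsumD[OF d']
  note cc = dsum_carrier[OF d] dsum_carrier[OF d']
  obtain q where q: "q \<in> rmod_hom R (M \<restriction> T) M"
    "\<And>y t. \<lbrakk>y \<in> Y; t \<in> D\<rbrakk> \<Longrightarrow> q (y \<oplus>\<^bsub>M\<^esub> t) = y"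
    by (rule dsum_projection[OF d']) (erule that, assumption)
  have TS: "rsubmodule R M T" by (rule fgsub_rsubmodule[OF E(3)])
  have Y0: "\<zero>\<^bsub>M\<^esub> \<in> Y" and D0: "\<zero>\<^bsub>M\<^esub> \<in> D"
    using E'(1,2) by (auto intro!: rsubmodule_zero fgsub_rsubmodule)
  have qY: "q y = y" if "y \<in> Y" for y using q(2)[OF that D0] that cc by simp
  have q_zero: "q t = \<zero>\<^bsub>M\<^esub> \<longleftrightarrow> t \<in> D" if t: "t \<in> T" for t
  proof -
    obtain y u where yu: "y \<in> Y" "u \<in> D" "t = y \<oplus>\<^bsub>M\<^esub> u" using t by (rule dsumE[OF d'])
    show ?thesis
    proof
      assume "q t = \<zero>\<^bsub>M\<^esub>"
      then show "t \<in> D" using yu q(2)[OF yu(1,2)] cc by simp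
    next
      assume "t \<in> D"
      then show "q t = \<zero>\<^bsub>M\<^esub>" using q(2)[OF Y0, of t] cc by simp
    qed
  qed
  have qT: "q t \<in> Y" if "t \<in> T" for t using dsumE[OF d' that] q(2) by metis
  have qA: "q \<in> rmod_hom R (M \<restriction> A) M" using rmod_hom_restr[OF q(1), of A] E(4) by simp
  define A' where "A' = {a \<in> A. q a = \<zero>\<^bsub>M\<^esub>}"
  have A'D: "A' = A \<inter> D" using q_zero E(4) by (auto simp: A'_def)
  obtain A1 where A1: "dsum R M A A1 A'" "inj_on q A1" "q ` A1 = q ` A"
    using kernel_split[OF E(1) M qA] unfolding A'_def by blast
  define Y' where "Y' = q ` A"
  have Y': "Y' \<in> fgsub R M" "Y' \<subseteq> Y"
    using fgsub_image[OF E(1) right_module_axioms qA] qT E(4) by (auto simp: Y'_def)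
  obtain Y'' where Y'': "dsum R M Y Y' Y''" by (rule complement_exists[OF Y'(1) E'(1) Y'(2)])
  note F = dsumD[OF Y'']
  have "A' \<subseteq> D" using A'D by blast
  then obtain D'' where D'': "dsum R M D A' D''" by (rule complement_exists[OF dsum_right[OF A1(1)] E'(2)])
  note G = dsumD[OF D'']
  have d2: "dsum R M (Y'' <+>\<^bsub>M\<^esub> D'') Y'' D''"
    unfolding dsum_def using F(2,5) G(2,5) E'(6) rsubmodule_zero[OF fgsub_rsubmodule[OF F(2)]]
      rsubmodule_zero[OF fgsub_rsubmodule[OF G(2)]] by blast
  have "dsum R M T A (Y'' <+>\<^bsub>M\<^esub> D'')"
  proof (rule dsumI[OF E(1) dsum_total[OF d2] E(3,4)])
    show "Y'' <+>\<^bsub>M\<^esub> D'' \<subseteq> T"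
      using F(5) G(5) E'(4,5) rsubmodule_add[OF TS] by (auto simp: set_add_iff subset_iff)
  next
    fix x assume x: "x \<in> A" "x \<in> Y'' <+>\<^bsub>M\<^esub> D''"
    then obtain y t where yt: "y \<in> Y''" "t \<in> D''" "x = y \<oplus>\<^bsub>M\<^esub> t" by (auto simp: set_add_iff)
    then have "q x = y" using q(2)[of y t] F(5) G(5) by blast
    then have "y \<in> Y'" using x(1) by (auto simp: Y'_def)
    then have "y = \<zero>\<^bsub>M\<^esub>" using F(6) yt(1) by blast
    then have "x \<in> A'" "x = t" using \<open>q x = y\<close> x(1) yt dsum_carrier[OF d2] by (auto simp: A'_def)
    then show "x = \<zero>\<^bsub>M\<^esub>" using G(6) yt(2) by blast
  next
    fix t assume t: "t \<in> T"
    obtain y' y'' where y: "y' \<in> Y'" "y'' \<in> Y''" "q t = y' \<oplus>\<^bsub>M\<^esub> y''"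
      using qT[OF t] by (rule dsumE[OF Y''])
    obtain a where a: "a \<in> A" "y' = q a" using y(1) by (auto simp: Y'_def)
    have aT: "a \<in> T" "y'' \<in> Y" "y'' \<in> T" using a(1) E(4) y(2) F(5) E'(4) by auto
    \<comment> \<open>\<open>s\<close> has the same image under \<open>q\<close> as \<open>t\<close>, so \<open>t - s\<close> lies in \<open>D\<close>\<close>
    define s where "s = a \<oplus>\<^bsub>M\<^esub> y''"
    have s: "s \<in> T" unfolding s_def by (rule rsubmodule_add[OF TS aT(1,3)])
    have qs: "q s = q t" using rmod_hom_add[OF q(1), of a y''] aT qY a(2) y(3) by (simp add: s_def)
    have u: "t \<ominus>\<^bsub>M\<^esub> s \<in> T" by (rule rsubmodule_diff[OF TS t s])
    have cst: "s \<in> carrier M" "t \<in> carrier M" "t \<ominus>\<^bsub>M\<^esub> s \<in> carrier M" using s t u cc by auto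
    have "q (t \<ominus>\<^bsub>M\<^esub> s) \<oplus>\<^bsub>M\<^esub> q s = q t"
      using rmod_hom_add[OF q(1), of "t \<ominus>\<^bsub>M\<^esub> s" s] u s add_diff_cancel[OF cst(1,2)] cst
      by (simp add: M.a_comm)
    then have "q (t \<ominus>\<^bsub>M\<^esub> s) = \<zero>\<^bsub>M\<^esub>"
      using qs rmod_hom_closed[OF q(1), of t] rmod_hom_closed[OF q(1), of "t \<ominus>\<^bsub>M\<^esub> s"] u t by simp
    then have "t \<ominus>\<^bsub>M\<^esub> s \<in> D" using q_zero u by blast
    then obtain a' d'' where ad: "a' \<in> A'" "d'' \<in> D''" "t \<ominus>\<^bsub>M\<^esub> s = a' \<oplus>\<^bsub>M\<^esub> d''" by (rule dsumE[OF D''])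
    have c2: "a \<in> carrier M" "y'' \<in> carrier M" "a' \<in> carrier M" "d'' \<in> carrier M"
      using aT cc ad dsum_carrier[OF D''] by auto
    have "t = s \<oplus>\<^bsub>M\<^esub> (a' \<oplus>\<^bsub>M\<^esub> d'')" using add_diff_cancel[OF cst(1,2)] ad(3) by simp
    also have "\<dots> = (a \<oplus>\<^bsub>M\<^esub> a') \<oplus>\<^bsub>M\<^esub> (y'' \<oplus>\<^bsub>M\<^esub> d'')"
      using c2 by (simp add: s_def M.a_assoc M.a_lcomm)
    finally have "t = (a \<oplus>\<^bsub>M\<^esub> a') \<oplus>\<^bsub>M\<^esub> (y'' \<oplus>\<^bsub>M\<^esub> d'')" .
    moreover have "a \<oplus>\<^bsub>M\<^esub> a' \<in> A"
      using rsubmodule_add[OF fgsub_rsubmodule[OF E(1)] a(1)] ad(1) by (simp add: A'_def)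
    moreover have "y'' \<oplus>\<^bsub>M\<^esub> d'' \<in> Y'' <+>\<^bsub>M\<^esub> D''" by (rule dsum_mem[OF d2 y(2) ad(2)])
    ultimately show "\<exists>b\<in>A. \<exists>c\<in>Y'' <+>\<^bsub>M\<^esub> D''. t = b \<oplus>\<^bsub>M\<^esub> c" by blast
  qed
  then have "rmod_class R (M \<restriction> B) = rmod_class R (M \<restriction> (Y'' <+>\<^bsub>M\<^esub> D''))"
    by (rule class_complements[OF d])
  then have B: "rmod_class R (M \<restriction> B) = rmod_class R (M \<restriction> Y'') \<otimes>\<^bsub>V_monoid R\<^esub> rmod_class R (M \<restriction> D'')"
    by (simp add: class_dsum[OF d2])
  have "q \<in> rmod_hom R (M \<restriction> A1) M" using rmod_hom_restr[OF qA, of A1] dsumD(4)[OF A1(1)] by simp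
  from class_image[OF dsum_left[OF A1(1)] this A1(2)]
  have "rmod_class R (M \<restriction> A1) = rmod_class R (M \<restriction> Y')" by (simp add: A1(3) Y'_def)
  then show thesis using that[OF A1(1) Y'' D'' _ B] by simp
qed

text \<open>
  An isomorphism from the external direct sum of representatives carries its two summands into \<open>M\<close>.
\<close>

lemma class_split_carrier:
  assumes a: "a \<in> carrier (V_monoid R)" and b: "b \<in> carrier (V_monoid R)"
    and eq: "rmod_class R M = a \<otimes>\<^bsub>V_monoid R\<^esub> b"
  obtains A B where "dsum R M (carrier M) A B" "rmod_class R (M \<restriction> A) = a" "rmod_class R (M \<restriction> B) = b"
proof -
  obtain P :: "('a, nat \<Rightarrow> 'a) rmodule" where P: "free_retract R P" "a = rmod_class R P"
    using a by (rule V_carrierE)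
  obtain Q :: "('a, nat \<Rightarrow> 'a) rmodule" where Q: "free_retract R Q" "b = rmod_class R Q"
    using b by (rule V_carrierE)
  define S where "S = rmod_sum P Q"
  have SF: "free_retract R S" unfolding S_def by (rule free_retract_sum[OF P(1) Q(1)])
  interpret P: regular_module R P using P(1) by unfold_locales
  interpret Q: regular_module R Q using Q(1) by unfold_locales
  interpret S: regular_module R S using SF by unfold_locales
  interpret PQ: two_modules R P Q ..
  have "rmod_class R S = rmod_class R M" unfolding eq P(2) Q(2) V_mult[OF P(1) Q(1)] S_def ..
  then obtain f where f: "f \<in> rmod_hom R S M" "bij_betw f (carrier S) (carrier M)"
    using rmod_class_eqD[OF SF] unfolding rmod_isomorphic_def by blast
  let ?l = "\<lambda>x. (x, \<zero>\<^bsub>Q\<^esub>)" and ?r = "\<lambda>y. (\<zero>\<^bsub>P\<^esub>, y)"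
  have l: "?l \<in> rmod_hom R P S" and r: "?r \<in> rmod_hom R Q S"
    unfolding S_def by (rule PQ.sum_inl_hom, rule PQ.sum_inr_hom)
  have d: "dsum R S (carrier S) (?l ` carrier P) (?r ` carrier Q)"
  proof (rule S.dsumI)
    show "?l ` carrier P \<in> fgsub R S" by (rule fgsub_hom_image[OF P(1) S.right_module_axioms l])
    show "?r ` carrier Q \<in> fgsub R S" by (rule fgsub_hom_image[OF Q(1) S.right_module_axioms r])
    show "carrier S \<in> fgsub R S" by (rule S.fgsub_carrier)
    fix z assume z: "z \<in> carrier S"
    then obtain x y where "z = (x, y)" "x \<in> carrier P" "y \<in> carrier Q" by (auto simp: S_def)
    then show "\<exists>b\<in>?l ` carrier P. \<exists>c\<in>?r ` carrier Q. z = b \<oplus>\<^bsub>S\<^esub> c" by (auto simp: S_def)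
  qed (auto simp: S_def)
  have f': "f \<in> rmod_hom R (S \<restriction> carrier S) M" using f(1) by simp
  have inj: "inj_on f (carrier S)" using f(2) by (simp add: bij_betw_def)
  have "dsum R M (carrier M) (f ` ?l ` carrier P) (f ` ?r ` carrier Q)"
    using S.dsum_hom_image[OF d M f' inj] f(2) by (simp add: bij_betw_def)
  moreover have "rmod_class R (M \<restriction> f ` ?l ` carrier P) = a"
  proof -
    have "inj_on (\<lambda>x. f (?l x)) (carrier P)"
      by (rule inj_onI) (use inj in \<open>auto simp: S_def dest: inj_onD\<close>)
    then show ?thesis
      using P.class_image[OF P.fgsub_carrier, of "\<lambda>x. f (?l x)" M] rmod_hom_comp[OF l f(1)] P(2)
      by (simp add: image_image)
  qed
  moreover have "rmod_class R (M \<restriction> f ` ?r ` carrier Q) = b"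
  proof -
    have "inj_on (\<lambda>x. f (?r x)) (carrier Q)"
      by (rule inj_onI) (use inj in \<open>auto simp: S_def dest: inj_onD\<close>)
    then show ?thesis
      using Q.class_image[OF Q.fgsub_carrier, of "\<lambda>x. f (?r x)" M] rmod_hom_comp[OF r f(1)] Q(2)
      by (simp add: image_image)
  qed
  ultimately show thesis by (rule that)
qed

lemma class_split:
  assumes X: "X \<in> fgsub R M" and a: "a \<in> carrier (V_monoid R)" and b: "b \<in> carrier (V_monoid R)"
    and eq: "rmod_class R (M \<restriction> X) = a \<otimes>\<^bsub>V_monoid R\<^esub> b"
  obtains A B where "dsum R M X A B" "rmod_class R (M \<restriction> A) = a" "rmod_class R (M \<restriction> B) = b"
proof -
  interpret X: regular_module R "M \<restriction> X" using free_retract_restr[OF X] by unfold_locales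
  obtain A B where d: "dsum R (M \<restriction> X) (carrier (M \<restriction> X)) A B"
    and AB: "rmod_class R (M \<restriction> X \<restriction> A) = a" "rmod_class R (M \<restriction> X \<restriction> B) = b"
    by (rule X.class_split_carrier[OF a b eq])
  have "(\<lambda>x. x) \<in> rmod_hom R (M \<restriction> X) M" by (rule rmod_hom_restr[OF rmod_hom_id fgsub_subset[OF X]])
  then have "dsum R M X A B" using X.dsum_hom_image[OF d M, of "\<lambda>x. x"] by simp
  then show thesis using AB by (intro that) auto
qed

end

context regular_ring
begin

text \<open>
  Realise both sums as decompositions of one module and refine them there.
\<close>

lemma V_refinement:
  assumes "a \<in> carrier (V_monoid R)" "b \<in> carrier (V_monoid R)"
    and "y \<in> carrier (V_monoid R)" "d \<in> carrier (V_monoid R)"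
    and eq: "a \<otimes>\<^bsub>V_monoid R\<^esub> b = y \<otimes>\<^bsub>V_monoid R\<^esub> d"
  obtains y' a' y'' d'' where "y' \<in> carrier (V_monoid R)" "a' \<in> carrier (V_monoid R)"
    "y'' \<in> carrier (V_monoid R)" "d'' \<in> carrier (V_monoid R)"
    "a = y' \<otimes>\<^bsub>V_monoid R\<^esub> a'" "b = y'' \<otimes>\<^bsub>V_monoid R\<^esub> d''"
    "y = y' \<otimes>\<^bsub>V_monoid R\<^esub> y''" "d = a' \<otimes>\<^bsub>V_monoid R\<^esub> d''"
proof -
  have "a \<otimes>\<^bsub>V_monoid R\<^esub> b \<in> carrier (V_monoid R)" using assms by simp
  then obtain T :: "('a, nat \<Rightarrow> 'a) rmodule" where T: "free_retract R T" "a \<otimes>\<^bsub>V_monoid R\<^esub> b = rmod_class R T"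
    by (rule V_carrierE)
  interpret T: regular_module R T using T(1) by unfold_locales
  obtain A B where AB: "dsum R T (carrier T) A B" "rmod_class R (T \<restriction> A) = a" "rmod_class R (T \<restriction> B) = b"
    by (rule T.class_split_carrier[OF assms(1,2) T(2)[symmetric]])
  have eq': "rmod_class R T = y \<otimes>\<^bsub>V_monoid R\<^esub> d" using T(2) eq by simp
  obtain Y D where YD: "dsum R T (carrier T) Y D" "rmod_class R (T \<restriction> Y) = y" "rmod_class R (T \<restriction> D) = d"
    by (rule T.class_split_carrier[OF assms(3,4) eq'])
  obtain A1 A' Y' Y'' D'' where *: "dsum R T A A1 A'" "dsum R T Y Y' Y''" "dsum R T D A' D''"
    "rmod_class R (T \<restriction> A1) = rmod_class R (T \<restriction> Y')"
    "rmod_class R (T \<restriction> B) = rmod_class R (T \<restriction> Y'') \<otimes>\<^bsub>V_monoid R\<^esub> rmod_class R (T \<restriction> D'')"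
    by (rule T.common_refinement[OF AB(1) YD(1)])
  show thesis
    using that[of "rmod_class R (T \<restriction> Y')" "rmod_class R (T \<restriction> A')" "rmod_class R (T \<restriction> Y'')" "rmod_class R (T \<restriction> D'')"]
      T.class_dsum[OF *(1)] T.class_dsum[OF *(2)] T.class_dsum[OF *(3)] AB YD *(4,5)
      T.class_in_V T.dsum_left[OF *(2)] T.dsum_right[OF *(2)] T.dsum_left[OF *(3)] T.dsum_right[OF *(3)]
    by metis
qed

end

section \<open>Lattice operations and the dimension monoid\<close>

context regular_module
begin

lemma lattice_le [simp]: "A \<sqsubseteq>\<^bsub>fg_submodules R M\<^esub> B \<longleftrightarrow> A \<subseteq> B"
  by (simp add: fg_submodules_def)

lemma lattice_bottom: "\<bottom>\<^bsub>fg_submodules R M\<^esub> = {\<zero>\<^bsub>M\<^esub>}"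
proof -
  have "least (fg_submodules R M) x (fgsub R M) \<longleftrightarrow> x = {\<zero>\<^bsub>M\<^esub>}" for x
    using fgsub_zero rsubmodule_zero[OF fgsub_rsubmodule] unfolding least_def lattice_le by blast
  then show ?thesis unfolding bottom_def by simp
qed

lemma lattice_join:
  assumes A: "A \<in> fgsub R M" and B: "B \<in> fgsub R M"
  shows "A \<squnion>\<^bsub>fg_submodules R M\<^esub> B = A <+>\<^bsub>M\<^esub> B"
proof -
  have AB: "A <+>\<^bsub>M\<^esub> B \<in> fgsub R M" by (rule fgsub_set_add[OF A B])
  have sub: "A \<subseteq> A <+>\<^bsub>M\<^esub> B" "B \<subseteq> A <+>\<^bsub>M\<^esub> B"
    using set_add_left[OF fgsub_rsubmodule[OF B] fgsub_subset[OF A]]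
      set_add_right[OF fgsub_rsubmodule[OF A] fgsub_subset[OF B]] .
  have "A <+>\<^bsub>M\<^esub> B \<subseteq> X" if "X \<in> fgsub R M" "A \<subseteq> X" "B \<subseteq> X" for X
    using that rsubmodule_add[OF fgsub_rsubmodule[OF that(1)]] by (auto simp: set_add_iff subset_iff)
  note join_le = this
  have U: "Upper (fg_submodules R M) {A, B} = {X \<in> fgsub R M. A \<subseteq> X \<and> B \<subseteq> X}"
    using A B unfolding Upper_def lattice_le by blast
  have l: "least (fg_submodules R M) (A <+>\<^bsub>M\<^esub> B) (Upper (fg_submodules R M) {A, B})"
    unfolding U least_def
  proof (intro conjI ballI)
    show "{X \<in> fgsub R M. A \<subseteq> X \<and> B \<subseteq> X} \<subseteq> fgsub R M" by blast
    show "A <+>\<^bsub>M\<^esub> B \<in> {X \<in> fgsub R M. A \<subseteq> X \<and> B \<subseteq> X}" using AB sub by simp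
    fix X assume "X \<in> {X \<in> fgsub R M. A \<subseteq> X \<and> B \<subseteq> X}"
    then show "A <+>\<^bsub>M\<^esub> B \<sqsubseteq>\<^bsub>fg_submodules R M\<^esub> X" using join_le by simp
  qed
  show ?thesis
    unfolding join_def sup_def
  proof (rule some_equality[where P = "\<lambda>x. least (fg_submodules R M) x (Upper (fg_submodules R M) {A, B})", OF l])
    fix X assume "least (fg_submodules R M) X (Upper (fg_submodules R M) {A, B})"
    then have "X \<sqsubseteq>\<^bsub>fg_submodules R M\<^esub> A <+>\<^bsub>M\<^esub> B" "A <+>\<^bsub>M\<^esub> B \<sqsubseteq>\<^bsub>fg_submodules R M\<^esub> X"
      using l by (simp_all only: least_def)
    then show "X = A <+>\<^bsub>M\<^esub> B" by simp
  qed
qed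

lemma lattice_meet:
  assumes A: "A \<in> fgsub R M" and B: "B \<in> fgsub R M"
  shows "A \<sqinter>\<^bsub>fg_submodules R M\<^esub> B = A \<inter> B"
proof -
  have Lo: "Lower (fg_submodules R M) {A, B} = {X \<in> fgsub R M. X \<subseteq> A \<and> X \<subseteq> B}"
    using A B unfolding Lower_def lattice_le by blast
  have g: "greatest (fg_submodules R M) (A \<inter> B) (Lower (fg_submodules R M) {A, B})"
    unfolding Lo greatest_def lattice_le using fgsub_Int[OF A B] by blast
  show ?thesis
    unfolding meet_def inf_def
  proof (rule some_equality[where P = "\<lambda>x. greatest (fg_submodules R M) x (Lower (fg_submodules R M) {A, B})", OF g])
    fix X assume "greatest (fg_submodules R M) X (Lower (fg_submodules R M) {A, B})"
    then have "X \<sqsubseteq>\<^bsub>fg_submodules R M\<^esub> A \<inter> B" "A \<inter> B \<sqsubseteq>\<^bsub>fg_submodules R M\<^esub> X"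
      using g by (simp_all only: greatest_def)
    then show "X = A \<inter> B" by auto
  qed
qed

lemma dim_gens_iff: "p \<in> dim_gens (fg_submodules R M) \<longleftrightarrow> fst p \<in> fgsub R M \<and> snd p \<in> fgsub R M \<and> fst p \<subseteq> snd p"
  by (auto simp: dim_gens_def)

lemma dim_cong_gens:
  "dim_cong (fg_submodules R M) m m' \<Longrightarrow> set_mset m \<subseteq> dim_gens (fg_submodules R M) \<and> set_mset m' \<subseteq> dim_gens (fg_submodules R M)"
proof (induction rule: dim_cong.induct)
  case (D2 A B)
  then have "A \<subseteq> A <+>\<^bsub>M\<^esub> B"
    by (intro set_add_left fgsub_rsubmodule fgsub_subset)
  then show ?case
    using D2 by (simp add: dim_gens_iff lattice_join lattice_meet fgsub_set_add fgsub_Int)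
qed (auto simp: dim_gens_iff)

end

lemma dim_class_eqI: "dim_cong L m m' \<Longrightarrow> dim_class L m = dim_class L m'"
  unfolding dim_class_def using dim_cong.trans[of L m m'] dim_cong.trans[OF dim_cong.sym, of L m m']
  by blast

lemma dim_class_eqD:
  assumes eq: "dim_class L m = dim_class L m'" and "set_mset m' \<subseteq> dim_gens L"
  shows "dim_cong L m m'"
proof -
  have "m' \<in> dim_class L m'" unfolding dim_class_def using dim_cong.refl[OF assms(2)] by simp
  then have "m' \<in> dim_class L m" by (simp only: eq)
  then show ?thesis by (simp add: dim_class_def)
qed

lemma Dim_carrierE:
  assumes "X \<in> carrier (Dim L)"
  obtains m where "set_mset m \<subseteq> dim_gens L" "X = dim_class L m"
  using assms unfolding Dim_def by auto

lemma dim_class_in_Dim: "set_mset m \<subseteq> dim_gens L \<Longrightarrow> dim_class L m \<in> carrier (Dim L)"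
  unfolding Dim_def by auto

lemma Dim_mult:
  assumes "set_mset m \<subseteq> dim_gens L" "set_mset k \<subseteq> dim_gens L"
  shows "dim_class L m \<otimes>\<^bsub>Dim L\<^esub> dim_class L k = dim_class L (m + k)"
proof -
  have eq: "dim_class L (m' + k') = dim_class L (m + k)" if "m' \<in> dim_class L m" "k' \<in> dim_class L k" for m' k'
    using that dim_class_eqI[OF dim_cong.sym[OF dim_cong.add[of L m m' k k']]] by (simp add: dim_class_def)
  have mem: "m \<in> dim_class L m" "k \<in> dim_class L k"
    using assms by (auto simp: dim_class_def intro: dim_cong.refl)
  have "dim_class L m \<otimes>\<^bsub>Dim L\<^esub> dim_class L k
      = (\<Union>m'\<in>dim_class L m. \<Union>k'\<in>dim_class L k. dim_class L (m' + k'))"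
    by (simp add: Dim_def)
  also have "\<dots> = dim_class L (m + k)"
  proof
    show "(\<Union>m'\<in>dim_class L m. \<Union>k'\<in>dim_class L k. dim_class L (m' + k')) \<subseteq> dim_class L (m + k)"
      by (intro UN_least) (simp add: eq)
    show "dim_class L (m + k) \<subseteq> (\<Union>m'\<in>dim_class L m. \<Union>k'\<in>dim_class L k. dim_class L (m' + k'))"
      using mem by blast
  qed
  finally show ?thesis .
qed

lemma Dim_one: "\<one>\<^bsub>Dim L\<^esub> = dim_class L {#}"
  by (simp add: Dim_def)

text \<open>
  Elements of \<open>m\<close> count with multiplicity, which is why powers occur under the product over the support.
\<close>

definition mset_prod :: "('b, 's) monoid_scheme \<Rightarrow> ('c \<Rightarrow> 'b) \<Rightarrow> 'c multiset \<Rightarrow> 'b"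
  where "mset_prod G f m = finprod G (\<lambda>x. f x [^]\<^bsub>G\<^esub> count m x) (set_mset m)"

context comm_monoid
begin

lemma mset_prod_closed: "f \<in> set_mset m \<rightarrow> carrier G \<Longrightarrow> mset_prod G f m \<in> carrier G"
  unfolding mset_prod_def by (intro finprod_closed) auto

lemma mset_prod_empty [simp]: "mset_prod G f {#} = \<one>"
  by (simp add: mset_prod_def)

lemma mset_prod_single: "f x \<in> carrier G \<Longrightarrow> mset_prod G f {#x#} = f x"
  by (simp add: mset_prod_def)

lemma mset_prod_union:
  assumes m: "f \<in> set_mset m \<rightarrow> carrier G" and k: "f \<in> set_mset k \<rightarrow> carrier G"
  shows "mset_prod G f (m + k) = mset_prod G f m \<otimes> mset_prod G f k"
proof -
  have f: "f x \<in> carrier G" if "x \<in> set_mset m \<union> set_mset k" for x using that m k by auto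
  have extend: "mset_prod G f m' = finprod G (\<lambda>x. f x [^] count m' x) (set_mset m \<union> set_mset k)"
    if "set_mset m' \<subseteq> set_mset m \<union> set_mset k" for m'
    unfolding mset_prod_def
    by (rule finprod_mono_neutral_cong_left) (use that f in \<open>auto simp: not_in_iff\<close>)
  have "finprod G (\<lambda>x. f x [^] count (m + k) x) (set_mset m \<union> set_mset k)
      = finprod G (\<lambda>x. f x [^] count m x \<otimes> f x [^] count k x) (set_mset m \<union> set_mset k)"
    using f by (intro finprod_cong') (auto simp: nat_pow_mult)
  also have "\<dots> = finprod G (\<lambda>x. f x [^] count m x) (set_mset m \<union> set_mset k)
      \<otimes> finprod G (\<lambda>x. f x [^] count k x) (set_mset m \<union> set_mset k)"
    using f by (intro finprod_multf) auto
  finally show ?thesis using extend[of "m + k"] extend[of m] extend[of k] by simp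
qed

end

context regular_module
begin

text \<open>
  The class of the quotient \<open>B / A\<close> for \<open>p = (A, B)\<close>, taken to be that of a complement; by
  \<open>class_complements\<close> the choice does not matter.
\<close>

definition quotient_class :: "'m set \<times> 'm set \<Rightarrow> ('a, nat \<Rightarrow> 'a) rmodule set"
  where "quotient_class p = rmod_class R (M \<restriction> (SOME C. dsum R M (snd p) (fst p) C))"

lemma quotient_class_eq:
  assumes d: "dsum R M B A C"
  shows "quotient_class (A, B) = rmod_class R (M \<restriction> C)"
proof -
  have "dsum R M B A (SOME C. dsum R M B A C)" by (rule someI[of "dsum R M B A", OF d])
  then show ?thesis unfolding quotient_class_def by (simp add: class_complements[OF d])
qed

lemma dim_gens_complement:
  assumes "p \<in> dim_gens (fg_submodules R M)"
  obtains C where "dsum R M (snd p) (fst p) C"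
  using assms complement_exists unfolding dim_gens_iff by blast

lemma quotient_class_in_V: "p \<in> dim_gens (fg_submodules R M) \<Longrightarrow> quotient_class p \<in> carrier (V_monoid R)"
proof -
  assume "p \<in> dim_gens (fg_submodules R M)"
  then obtain C where d: "dsum R M (snd p) (fst p) C" by (rule dim_gens_complement)
  show ?thesis using quotient_class_eq[OF d] class_in_V[OF dsum_right[OF d]] by simp
qed

lemma dsum_zero_left: "A \<in> fgsub R M \<Longrightarrow> dsum R M A {\<zero>\<^bsub>M\<^esub>} A"
proof -
  assume A: "A \<in> fgsub R M"
  show ?thesis
  proof (rule dsumI[OF fgsub_zero A A])
    show "\<exists>b\<in>{\<zero>\<^bsub>M\<^esub>}. \<exists>c\<in>A. a = b \<oplus>\<^bsub>M\<^esub> c" if "a \<in> A" for a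
      using that fgsub_subset[OF A] by (intro bexI[of _ "\<zero>\<^bsub>M\<^esub>"] bexI[of _ a]) auto
  qed (use rsubmodule_zero[OF fgsub_rsubmodule[OF A]] in auto)
qed

lemma quotient_class_zero: "A \<in> fgsub R M \<Longrightarrow> quotient_class ({\<zero>\<^bsub>M\<^esub>}, A) = rmod_class R (M \<restriction> A)"
  by (rule quotient_class_eq[OF dsum_zero_left])

abbreviation total_class :: "('m set \<times> 'm set) multiset \<Rightarrow> ('a, nat \<Rightarrow> 'a) rmodule set"
  where "total_class \<equiv> mset_prod (V_monoid R) quotient_class"

lemma quotient_class_Pi: "set_mset m \<subseteq> dim_gens (fg_submodules R M) \<Longrightarrow> quotient_class \<in> set_mset m \<rightarrow> carrier (V_monoid R)"
  using quotient_class_in_V by blast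

lemma total_class_union:
  "\<lbrakk>set_mset m \<subseteq> dim_gens (fg_submodules R M); set_mset k \<subseteq> dim_gens (fg_submodules R M)\<rbrakk> \<Longrightarrow>
    total_class (m + k) = total_class m \<otimes>\<^bsub>V_monoid R\<^esub> total_class k"
  by (intro V.mset_prod_union quotient_class_Pi)

lemma total_class_single: "p \<in> dim_gens (fg_submodules R M) \<Longrightarrow> total_class {#p#} = quotient_class p"
  by (intro V.mset_prod_single quotient_class_in_V)

lemma total_class_in_V: "set_mset m \<subseteq> dim_gens (fg_submodules R M) \<Longrightarrow> total_class m \<in> carrier (V_monoid R)"
  by (intro V.mset_prod_closed quotient_class_Pi)

text \<open>
  Each relation becomes a statement on complements: (D1) is \<open>dsum_assoc\<close> and (D2) is \<open>dsum_join\<close>.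
\<close>

lemma total_class_cong: "dim_cong (fg_submodules R M) m m' \<Longrightarrow> total_class m = total_class m'"
proof (induction rule: dim_cong.induct)
  case (D0 A)
  have "quotient_class (A, A) = \<one>\<^bsub>V_monoid R\<^esub>"
    using quotient_class_eq[OF dsum_commute[OF dsum_zero_left[OF D0]]] class_zero by simp
  then show ?case using D0 by (simp add: total_class_single dim_gens_iff)
next
  case (D1 A B C)
  then have AB: "A \<subseteq> B" and BC: "B \<subseteq> C" by simp_all
  have gens: "(A, B) \<in> dim_gens (fg_submodules R M)" "(B, C) \<in> dim_gens (fg_submodules R M)" "(A, C) \<in> dim_gens (fg_submodules R M)"
    using D1 AB BC by (auto simp: dim_gens_iff)
  obtain E where E: "dsum R M B A E" by (rule complement_exists[OF D1(1,2) AB])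
  obtain F where F: "dsum R M C B F" by (rule complement_exists[OF D1(2,3) BC])
  note a = dsum_assoc[OF F E]
  have "quotient_class (A, C) = quotient_class (A, B) \<otimes>\<^bsub>V_monoid R\<^esub> quotient_class (B, C)"
    using quotient_class_eq[OF a(1)] class_dsum[OF a(2)] quotient_class_eq[OF E] quotient_class_eq[OF F]
    by simp
  moreover have "total_class {#(A, B), (B, C)#} = quotient_class (A, B) \<otimes>\<^bsub>V_monoid R\<^esub> quotient_class (B, C)"
    using total_class_union[of "{#(A, B)#}" "{#(B, C)#}"] gens
    by (simp add: total_class_single add_mset_commute)
  ultimately show ?case using gens by (simp add: total_class_single)
next
  case (D2 A B)
  have AB: "A \<inter> B \<in> fgsub R M" by (rule fgsub_Int[OF D2])
  obtain C where C: "dsum R M B (A \<inter> B) C" by (rule complement_exists[OF AB D2(2)]) auto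
  have J: "dsum R M (A <+>\<^bsub>M\<^esub> B) A C" by (rule dsum_join[OF D2(1) C])
  have "(A, A <+>\<^bsub>M\<^esub> B) \<in> dim_gens (fg_submodules R M)" "(A \<inter> B, B) \<in> dim_gens (fg_submodules R M)"
    using D2 AB dsumD(3,4)[OF J] by (auto simp: dim_gens_iff)
  then show ?case
    using quotient_class_eq[OF C] quotient_class_eq[OF J]
    by (simp add: lattice_join[OF D2] lattice_meet[OF D2] total_class_single)
next
  case (add m m' k k')
  then show ?case
    using dim_cong_gens[OF add.hyps(1)] dim_cong_gens[OF add.hyps(2)] by (simp add: total_class_union)
qed simp_all

text \<open>
  The equation \<open>\<Delta>(X) = \<Delta>(Y)\<close> in the dimension monoid.
\<close>

definition submodule_cong :: "'m set \<Rightarrow> 'm set \<Rightarrow> bool"  (infix \<open>\<approx>\<close> 50)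
  where "X \<approx> Y \<longleftrightarrow> dim_cong (fg_submodules R M) {#({\<zero>\<^bsub>M\<^esub>}, X)#} {#({\<zero>\<^bsub>M\<^esub>}, Y)#}"

lemma submodule_gens: "X \<in> fgsub R M \<Longrightarrow> ({\<zero>\<^bsub>M\<^esub>}, X) \<in> dim_gens (fg_submodules R M)"
  using fgsub_zero rsubmodule_zero[OF fgsub_rsubmodule] by (simp add: dim_gens_iff)

lemma submodule_cong_sym: "X \<approx> Y \<Longrightarrow> Y \<approx> X"
  unfolding submodule_cong_def by (rule dim_cong.sym)

lemma submodule_cong_trans: "X \<approx> Y \<Longrightarrow> Y \<approx> Z \<Longrightarrow> X \<approx> Z"
  unfolding submodule_cong_def by (rule dim_cong.trans)

text \<open>
  This is (D2) for \<open>A\<close> and \<open>C\<close>, whose join is \<open>B\<close> and whose meet is zero.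
\<close>

lemma dim_cong_complement:
  assumes d: "dsum R M B A C"
  shows "dim_cong (fg_submodules R M) {#(A, B)#} {#({\<zero>\<^bsub>M\<^esub>}, C)#}"
proof -
  note D = dsumD[OF d]
  have "A \<squnion>\<^bsub>fg_submodules R M\<^esub> C = B" using d D(1,2) by (simp add: lattice_join dsum_def)
  moreover have "A \<sqinter>\<^bsub>fg_submodules R M\<^esub> C = {\<zero>\<^bsub>M\<^esub>}" using d D(1,2) by (simp add: lattice_meet dsum_def)
  ultimately show ?thesis using dim_cong.D2[OF D(1,2)] by simp
qed

lemma dim_cong_dsum:
  assumes d: "dsum R M A B C"
  shows "dim_cong (fg_submodules R M) {#({\<zero>\<^bsub>M\<^esub>}, A)#} ({#({\<zero>\<^bsub>M\<^esub>}, B)#} + {#({\<zero>\<^bsub>M\<^esub>}, C)#})"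
proof -
  note D = dsumD[OF d]
  have "dim_cong (fg_submodules R M) {#({\<zero>\<^bsub>M\<^esub>}, A)#} ({#({\<zero>\<^bsub>M\<^esub>}, B)#} + {#(B, A)#})"
    using dim_cong.D1[of "{\<zero>\<^bsub>M\<^esub>}" "fg_submodules R M" B A] D fgsub_zero rsubmodule_zero[OF fgsub_rsubmodule[OF D(1)]]
    by (simp add: add_mset_commute)
  moreover have "dim_cong (fg_submodules R M) ({#({\<zero>\<^bsub>M\<^esub>}, B)#} + {#(B, A)#}) ({#({\<zero>\<^bsub>M\<^esub>}, B)#} + {#({\<zero>\<^bsub>M\<^esub>}, C)#})"
    using submodule_gens[OF D(1)] by (intro dim_cong.add dim_cong_complement[OF d] dim_cong.refl) simp
  ultimately show ?thesis by (rule dim_cong.trans)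
qed

lemma dsum_submodule_cong:
  assumes "dsum R M A B C" "dsum R M A' B' C'" "B \<approx> B'" "C \<approx> C'"
  shows "A \<approx> A'"
  using dim_cong_dsum[OF assms(1)] dim_cong_dsum[OF assms(2)] dim_cong.add[OF assms(3,4)[unfolded submodule_cong_def]]
  unfolding submodule_cong_def by (meson dim_cong.sym dim_cong.trans)

lemma perspective_submodule_cong:
  assumes "dsum R M T A X" "dsum R M T A Y"
  shows "X \<approx> Y"
  using dim_cong_complement[OF assms(1)] dim_cong_complement[OF assms(2)]
  unfolding submodule_cong_def by (meson dim_cong.sym dim_cong.trans)

text \<open>
  The graph \<open>Z\<close> of an isomorphism \<open>f\<close> from \<open>X\<close> to \<open>Y\<close> complements both \<open>X\<close> and \<open>Y\<close> in \<open>X + Y\<close>.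
\<close>

lemma disjoint_isomorphic_submodule_cong:
  assumes X: "X \<in> fgsub R M" and Y: "Y \<in> fgsub R M" and disj: "\<And>x. \<lbrakk>x \<in> X; x \<in> Y\<rbrakk> \<Longrightarrow> x = \<zero>\<^bsub>M\<^esub>"
    and cls: "rmod_class R (M \<restriction> X) = rmod_class R (M \<restriction> Y)"
  shows "X \<approx> Y"
proof -
  note XS = fgsub_rsubmodule[OF X] and YS = fgsub_rsubmodule[OF Y]
  obtain f where f: "f \<in> rmod_hom R (M \<restriction> X) (M \<restriction> Y)" "bij_betw f X Y"
    using rmod_class_eqD[OF free_retract_restr[OF X] cls] by (auto simp: rmod_isomorphic_def)
  have fY: "f x \<in> Y" if "x \<in> X" for x using rmod_hom_closed[OF f(1), of x] that by simp
  have f_onto: "\<exists>x\<in>X. f x = y" if "y \<in> Y" for y using f(2) that by (auto simp: bij_betw_def)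
  interpret XM: two_modules R "M \<restriction> X" M
    by (intro two_modules.intro right_module_restr right_module_axioms XS)
  have fM: "f \<in> rmod_hom R (M \<restriction> X) M" by (rule rmod_hom_incl[OF f(1) fgsub_subset[OF Y]])
  have f0: "x = \<zero>\<^bsub>M\<^esub>" if "x \<in> X" "f x = \<zero>\<^bsub>M\<^esub>" for x
    using XM.inj_on_hom_iff[OF fM rsubmodule_carrier[OF XM.M.right_module_axioms]] f(2) that
    by (simp add: bij_betw_def)
  have cX: "x \<in> carrier M" if "x \<in> X" for x using fgsub_subset[OF X] that by blast
  have cY: "y \<in> carrier M" if "y \<in> Y" for y using fgsub_subset[OF Y] that by blast
  let ?h = "\<lambda>x. x \<oplus>\<^bsub>M\<^esub> f x"
  have h: "?h \<in> rmod_hom R (M \<restriction> X) M"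
    by (rule XM.sum_hom[OF rmod_hom_restr[OF rmod_hom_id fgsub_subset[OF X]] fM])
  define Z where "Z = ?h ` X"
  have Z: "Z \<in> fgsub R M" unfolding Z_def by (rule fgsub_image[OF X right_module_axioms h])
  define T where "T = X <+>\<^bsub>M\<^esub> Y"
  have T: "T \<in> fgsub R M" unfolding T_def by (rule fgsub_set_add[OF X Y])
  have TX: "X \<subseteq> T" "Y \<subseteq> T"
    unfolding T_def using set_add_left[OF YS fgsub_subset[OF X]] set_add_right[OF XS fgsub_subset[OF Y]] .
  have TZ: "Z \<subseteq> T" 
    unfolding Z_def
  proof (rule image_subsetI)
    fix x assume "x \<in> X"
    then show "?h x \<in> T" using fY unfolding T_def set_add_iff by (intro bexI[of _ x] bexI[of _ "f x"]) auto
  qed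
  have "dsum R M T Z X"
  proof (rule dsumI[OF Z X T TZ TX(1)])
    fix z assume z: "z \<in> Z" "z \<in> X"
    then obtain x where x: "x \<in> X" "z = x \<oplus>\<^bsub>M\<^esub> f x" by (auto simp: Z_def)
    have "f x = z \<ominus>\<^bsub>M\<^esub> x"
      using x cX[OF x(1)] cY[OF fY[OF x(1)]] add_diff_cancel[of x "f x"]
      by (simp add: a_minus_def M.a_assoc)
    then have "f x \<in> X" using rsubmodule_diff[OF XS z(2) x(1)] by simp
    then have "f x = \<zero>\<^bsub>M\<^esub>" using disj fY x(1) by blast
    then show "z = \<zero>\<^bsub>M\<^esub>" using f0[OF x(1)] x by simp
  next
    fix t assume "t \<in> T"
    then obtain x y where xy: "x \<in> X" "y \<in> Y" "t = x \<oplus>\<^bsub>M\<^esub> y" by (auto simp: T_def set_add_iff)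
    obtain x' where x': "x' \<in> X" "f x' = y" using f_onto[OF xy(2)] by blast
    have "t = ?h x' \<oplus>\<^bsub>M\<^esub> (x \<ominus>\<^bsub>M\<^esub> x')"
      using xy x' cX cY add_diff_cancel[of x' x] by (simp add: M.a_assoc M.a_lcomm[of x' y] M.a_comm[of x y])
    then show "\<exists>b\<in>Z. \<exists>c\<in>X. t = b \<oplus>\<^bsub>M\<^esub> c"
      using x' rsubmodule_diff[OF XS xy(1) x'(1)] unfolding Z_def by blast
  qed
  moreover have "dsum R M T Z Y"
  proof (rule dsumI[OF Z Y T TZ TX(2)])
    fix z assume z: "z \<in> Z" "z \<in> Y"
    then obtain x where x: "x \<in> X" "z = x \<oplus>\<^bsub>M\<^esub> f x" by (auto simp: Z_def)
    have "x = z \<ominus>\<^bsub>M\<^esub> f x"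
      using x cX[OF x(1)] cY[OF fY[OF x(1)]] by (simp add: a_minus_def M.a_assoc M.r_neg)
    then have "x \<in> Y" using rsubmodule_diff[OF YS z(2) fY[OF x(1)]] by simp
    then have "x = \<zero>\<^bsub>M\<^esub>" using disj x(1) by blast
    then show "z = \<zero>\<^bsub>M\<^esub>" using XM.hom_zero[OF fM] x by simp
  next
    fix t assume "t \<in> T"
    then obtain x y where xy: "x \<in> X" "y \<in> Y" "t = x \<oplus>\<^bsub>M\<^esub> y" by (auto simp: T_def set_add_iff)
    have "t = ?h x \<oplus>\<^bsub>M\<^esub> (y \<ominus>\<^bsub>M\<^esub> f x)"
      using xy cX cY fY add_diff_cancel[of "f x" y] by (simp add: M.a_assoc)
    then show "\<exists>b\<in>Z. \<exists>c\<in>Y. t = b \<oplus>\<^bsub>M\<^esub> c"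
      using xy rsubmodule_diff[OF YS xy(2) fY[OF xy(1)]] unfolding Z_def by blast
  qed
  ultimately show ?thesis by (rule perspective_submodule_cong)
qed

end

section \<open>Isomorphic submodules of a free module\<close>

locale regular_free_module = regular_ring R for R :: "('a, 'r) ring_scheme" (structure) +
  fixes n :: nat

sublocale regular_free_module \<subseteq> regular_module R "free_rmod R n"
  by unfold_locales (rule free_retract_free)

context regular_free_module
begin

abbreviation free_module :: "('a, nat \<Rightarrow> 'a) rmodule" (\<open>F\<close>)
  where "F \<equiv> free_rmod R n"

notation submodule_cong (infix \<open>\<approx>\<close> 50)

definition supported_at :: "nat \<Rightarrow> (nat \<Rightarrow> 'a) set \<Rightarrow> bool"
  where "supported_at k A \<longleftrightarrow> (\<forall>x\<in>A. \<forall>i<n. i \<noteq> k \<longrightarrow> x i = \<zero>)"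

lemma supported_atD: "\<lbrakk>supported_at k A; x \<in> A; i < n; i \<noteq> k\<rbrakk> \<Longrightarrow> x i = \<zero>"
  by (simp add: supported_at_def)

lemma coord_hom_restr: "\<lbrakk>i < n; A \<in> fgsub R F\<rbrakk> \<Longrightarrow> (\<lambda>x. x i) \<in> rmod_hom R (F \<restriction> A) (ring_rmod R)"
  by (rule rmod_hom_restr[OF coord_hom fgsub_subset])

text \<open>
  Splitting off the kernel of one coordinate after the other. The remaining kernel vanishes in one more
  coordinate each time, so it is zero after \<open>n\<close> steps.
\<close>

lemma coordinate_induct [consumes 1, case_names zero split]:
  assumes A: "A \<in> fgsub R F" and zero: "P {\<zero>\<^bsub>F\<^esub>}"
    and split: "\<And>A A1 K i. \<lbrakk>dsum R F A A1 K; i < n; inj_on (\<lambda>x. x i) A1; P K\<rbrakk> \<Longrightarrow> P A"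
  shows "P A"
proof -
  \<comment> \<open>\<open>k\<close> bounds the number of coordinates that may still be nonzero\<close>
  have "P A" if "A \<in> fgsub R F" "\<And>x i. \<lbrakk>x \<in> A; i < n - k\<rbrakk> \<Longrightarrow> x i = \<zero>" for k A
    using that
  proof (induction k arbitrary: A)
    case 0
    have "x = \<zero>\<^bsub>F\<^esub>" if "x \<in> A" for x
      using 0(2)[OF that] fgsub_subset[OF 0(1)] that M.zero_closed by (intro free_rmod_eqI[of _ R n]) auto
    then have "A = {\<zero>\<^bsub>F\<^esub>}" using rsubmodule_zero[OF fgsub_rsubmodule[OF 0(1)]] by blast
    then show ?case using zero by simp
  next
    case (Suc k)
    show ?case
    proof (cases "k < n")
      case False
      then show ?thesis using Suc by simp
    next
      case True
      let ?i = "n - Suc k"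
      have i: "?i < n" using True by simp
      obtain A1 where A1: "dsum R F A A1 {x \<in> A. x ?i = \<zero>\<^bsub>ring_rmod R\<^esub>}" "inj_on (\<lambda>x. x ?i) A1"
        by (rule kernel_split[OF Suc.prems(1) free_retract_ring coord_hom_restr[OF i Suc.prems(1)]])
      have "x j = \<zero>" if "x \<in> {x \<in> A. x ?i = \<zero>\<^bsub>ring_rmod R\<^esub>}" "j < n - k" for x j
      proof (cases "j = ?i")
        case False
        then show ?thesis using that Suc.prems(2)[of x j] by simp
      qed (use that in simp)
      then have "P {x \<in> A. x ?i = \<zero>\<^bsub>ring_rmod R\<^esub>}" by (rule Suc.IH[OF dsum_right[OF A1(1)]])
      then show ?thesis by (rule split[OF A1(1) i A1(2)])
    qed
  qed
  from this[of A n] A show ?thesis by simp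
qed

text \<open>
  The copy of \<open>X\<close> in coordinate \<open>j\<close> has zero coordinate \<open>i\<close>. As coordinate \<open>i\<close> is injective on
  \<open>X\<close>, the two submodules are disjoint.
\<close>

lemma move_to_coordinate:
  assumes X: "X \<in> fgsub R F" and i: "i < n" and j: "j < n" and ij: "i \<noteq> j"
    and inj: "inj_on (\<lambda>x. x i) X"
  obtains Y where "Y \<in> fgsub R F" "supported_at j Y"
    "rmod_class R (F \<restriction> X) = rmod_class R (F \<restriction> Y)" "X \<approx> Y"
proof -
  define f where "f x = unit_vec R n j (x i)" for x :: "nat \<Rightarrow> 'a"
  have f: "f \<in> rmod_hom R (F \<restriction> X) F"
    unfolding f_def[abs_def] by (rule rmod_hom_comp[OF coord_hom_restr[OF i X] unit_vec_hom])
  have fj: "f x j = x i" for x using j by (simp add: f_def)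
  have Y: "f ` X \<in> fgsub R F" by (rule fgsub_image[OF X right_module_axioms f])
  have f_inj: "inj_on f X"
  proof (rule inj_onI)
    fix x y assume "x \<in> X" "y \<in> X" "f x = f y"
    then show "x = y" using fj[of x] fj[of y] inj by (auto dest: inj_onD)
  qed
  have cls: "rmod_class R (F \<restriction> X) = rmod_class R (F \<restriction> f ` X)" by (rule class_image[OF X f f_inj, symmetric])
  have supp: "supported_at j (f ` X)" by (auto simp: supported_at_def f_def)
  have "x = \<zero>\<^bsub>F\<^esub>" if "x \<in> X" "x \<in> f ` X" for x
  proof -
    have "x i = \<zero>\<^bsub>F\<^esub> i" using supported_atD[OF supp that(2) i ij] i by simp
    then show ?thesis using inj that(1) rsubmodule_zero[OF fgsub_rsubmodule[OF X]] by (auto dest: inj_onD)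
  qed
  then have "X \<approx> f ` X" by (rule disjoint_isomorphic_submodule_cong[OF X Y _ cls])
  then show thesis using that Y supp cls by blast
qed

end

locale regular_free_module_ge2 = regular_free_module +
  assumes n_ge2: "n \<ge> 2"
begin

text \<open>
  Submodules supported at different coordinates are disjoint. If \<open>A\<close> and \<open>B\<close> share their
  coordinate, \<open>B\<close> is first moved to another one.
\<close>

lemma submodule_cong_supported:
  assumes A: "A \<in> fgsub R F" and B: "B \<in> fgsub R F" and k: "k < n" and l: "l < n"
    and sA: "supported_at k A" and sB: "supported_at l B"
    and cls: "rmod_class R (F \<restriction> A) = rmod_class R (F \<restriction> B)"
  shows "A \<approx> B"
proof -
  have disj: "A \<approx> B'" if B': "B' \<in> fgsub R F" and j: "j < n" "j \<noteq> k"
      and sB': "supported_at j B'"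
      and cls': "rmod_class R (F \<restriction> A) = rmod_class R (F \<restriction> B')" for B' j
  proof (rule disjoint_isomorphic_submodule_cong[OF A B' _ cls'])
    fix x assume x: "x \<in> A" "x \<in> B'"
    have "x i = \<zero>" if i: "i < n" for i
      using supported_atD[OF sA x(1) i] supported_atD[OF sB' x(2) i] j(2) by blast
    then show "x = \<zero>\<^bsub>F\<^esub>"
      using fgsub_subset[OF A] x(1) M.zero_closed by (intro free_rmod_eqI[of _ R n]) auto
  qed
  show ?thesis
  proof (cases "k = l")
    case False
    show ?thesis by (rule disj[OF B l False[symmetric] sB cls])
  next
    case True
    obtain j where j: "j < n" "j \<noteq> k"
      using n_ge2 that[of 0] that[of 1] by (cases "k = 0") auto
    have injB: "inj_on (\<lambda>x. x k) B"
    proof (rule inj_onI)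
      fix x y assume xy: "x \<in> B" "y \<in> B" "x k = y k"
      have "x i = y i" if "i < n" for i using supported_atD[OF sB, of x i] supported_atD[OF sB, of y i] xy that True
        by (cases "i = k") auto
      then show "x = y" using fgsub_subset[OF B] xy by (intro free_rmod_eqI[of _ R n]) auto
    qed
    obtain B' where B': "B' \<in> fgsub R F" "supported_at j B'"
      "rmod_class R (F \<restriction> B) = rmod_class R (F \<restriction> B')" "B \<approx> B'"
      by (rule move_to_coordinate[OF B k j(1) j(2)[symmetric] injB])
    have "A \<approx> B'" using disj[OF B'(1) j B'(2)] cls B'(3) by simp
    then show ?thesis using B'(4) submodule_cong_sym submodule_cong_trans by blast
  qed
qed

lemma submodule_cong_coord_inj:
  assumes X: "X \<in> fgsub R F" and Y: "Y \<in> fgsub R F" and i: "i < n" and j: "j < n"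
    and injX: "inj_on (\<lambda>x. x i) X" and injY: "inj_on (\<lambda>x. x j) Y"
    and cls: "rmod_class R (F \<restriction> X) = rmod_class R (F \<restriction> Y)"
  shows "X \<approx> Y"
proof -
  have other: "\<exists>k<n. k \<noteq> i" for i
    using n_ge2 by (cases "i = 0") (auto intro: exI[of _ 0] exI[of _ 1])
  obtain k where k: "k < n" "i \<noteq> k" using other[of i] by blast
  obtain l where l: "l < n" "j \<noteq> l" using other[of j] by blast
  obtain X' where X': "X' \<in> fgsub R F" "supported_at k X'"
    "rmod_class R (F \<restriction> X) = rmod_class R (F \<restriction> X')" "X \<approx> X'"
    by (rule move_to_coordinate[OF X i k injX])
  obtain Y' where Y': "Y' \<in> fgsub R F" "supported_at l Y'"
    "rmod_class R (F \<restriction> Y) = rmod_class R (F \<restriction> Y')" "Y \<approx> Y'"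
    by (rule move_to_coordinate[OF Y j l injY])
  have "X' \<approx> Y'"
    using submodule_cong_supported[OF X'(1) Y'(1) k(1) l(1) X'(2) Y'(2)] X'(3) Y'(3) cls by simp
  then show ?thesis using X'(4) Y'(4) submodule_cong_sym submodule_cong_trans by blast
qed

text \<open>
  Cut \<open>Y\<close> by \<open>coordinate_induct\<close>, and cut \<open>X\<close> accordingly by \<open>class_split\<close>. The property \<open>H\<close>
  allows the lemma to be applied to both arguments in turn: once a coordinate is injective on one of
  them, \<open>H\<close> keeps this fact for its pieces while the other one is being cut.
\<close>

lemma submodule_cong_cut:
  assumes Y: "Y \<in> fgsub R F" and X: "X \<in> fgsub R F" "H X"
    and cls: "rmod_class R (F \<restriction> X) = rmod_class R (F \<restriction> Y)"
    and hered: "\<And>X X'. \<lbrakk>H X; X' \<subseteq> X\<rbrakk> \<Longrightarrow> H X'"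
    and base: "\<And>X Y j. \<lbrakk>X \<in> fgsub R F; H X; Y \<in> fgsub R F; j < n; inj_on (\<lambda>x. x j) Y;
        rmod_class R (F \<restriction> X) = rmod_class R (F \<restriction> Y)\<rbrakk> \<Longrightarrow> X \<approx> Y"
  shows "X \<approx> Y"
  using Y X cls
proof (induction Y arbitrary: X rule: coordinate_induct)
  case zero
  \<comment> \<open>any coordinate is injective on the zero module\<close>
  then show ?case using base[OF _ _ fgsub_zero, of X 0] n_ge2 by simp
next
  case (split Y Y1 K i)
  note D = dsumD[OF split.hyps(1)]
  have "rmod_class R (F \<restriction> X) = rmod_class R (F \<restriction> Y1) \<otimes>\<^bsub>V_monoid R\<^esub> rmod_class R (F \<restriction> K)"
    using split.prems(3) class_dsum[OF split.hyps(1)] by simp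
  then obtain X1 X2 where XX: "dsum R F X X1 X2" "rmod_class R (F \<restriction> X1) = rmod_class R (F \<restriction> Y1)"
    "rmod_class R (F \<restriction> X2) = rmod_class R (F \<restriction> K)"
    by (rule class_split[OF split.prems(1) class_in_V[OF D(1)] class_in_V[OF D(2)]])
  note E = dsumD[OF XX(1)]
  have "X1 \<approx> Y1"
    by (rule base[OF E(1) hered[OF split.prems(2) E(4)] D(1) split.hyps(2,3) XX(2)])
  moreover have "X2 \<approx> K"
    by (rule split.IH[OF E(2) hered[OF split.prems(2) E(5)] XX(3)])
  ultimately show ?case by (rule dsum_submodule_cong[OF XX(1) split.hyps(1)])
qed

text \<open>
  First \<open>Y\<close> is cut until a coordinate is injective on it, then \<open>X\<close> is; what remains is
  \<open>submodule_cong_coord_inj\<close>.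
\<close>

lemma isomorphic_submodule_cong:
  assumes X: "X \<in> fgsub R F" and Y: "Y \<in> fgsub R F"
    and cls: "rmod_class R (F \<restriction> X) = rmod_class R (F \<restriction> Y)"
  shows "X \<approx> Y"
proof (rule submodule_cong_cut[where H = "\<lambda>_. True", OF Y X _ cls])
  fix X Y j
  assume X: "X \<in> fgsub R F" and Y: "Y \<in> fgsub R F" and j: "j < n" and inj: "inj_on (\<lambda>x. x j) Y"
    and cls: "rmod_class R (F \<restriction> X) = rmod_class R (F \<restriction> Y)"
  have "Y \<approx> X"
  proof (rule submodule_cong_cut[where H = "inj_on (\<lambda>x. x j)", OF X Y inj cls[symmetric]])
    show "inj_on (\<lambda>x. x j) X'" if "inj_on (\<lambda>x. x j) X" "X' \<subseteq> X" for X X' :: "(nat \<Rightarrow> 'a) set"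
      using that by (rule inj_on_subset)
  qed (use submodule_cong_coord_inj[OF _ _ j] in blast)
  then show "X \<approx> Y" by (rule submodule_cong_sym)
qed simp_all

end

section \<open>The natural isomorphism\<close>

context regular_module
begin

abbreviation submodule_gen :: "'m set multiset \<Rightarrow> ('m set \<times> 'm set) multiset"
  where "submodule_gen \<equiv> image_mset (Pair {\<zero>\<^bsub>M\<^esub>})"

abbreviation sum_class :: "'m set multiset \<Rightarrow> ('a, nat \<Rightarrow> 'a) rmodule set"
  where "sum_class N \<equiv> total_class (submodule_gen N)"

lemma submodule_gen_gens: "set_mset N \<subseteq> fgsub R M \<Longrightarrow> set_mset (submodule_gen N) \<subseteq> dim_gens (fg_submodules R M)"
  using submodule_gens by auto

lemma sum_class_in_V: "set_mset N \<subseteq> fgsub R M \<Longrightarrow> sum_class N \<in> carrier (V_monoid R)"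
  by (rule total_class_in_V[OF submodule_gen_gens])

lemma sum_class_add_mset:
  assumes "X \<in> fgsub R M" "set_mset N \<subseteq> fgsub R M"
  shows "sum_class (add_mset X N) = rmod_class R (M \<restriction> X) \<otimes>\<^bsub>V_monoid R\<^esub> sum_class N"
  using total_class_union[of "{#({\<zero>\<^bsub>M\<^esub>}, X)#}" "submodule_gen N"] submodule_gens[OF assms(1)]
    submodule_gen_gens[OF assms(2)] quotient_class_zero[OF assms(1)]
  by (simp add: total_class_single)

text \<open>
  Every generator \<open>\<Delta>(A, B)\<close> is \<open>\<Delta>(C)\<close> for a complement \<open>C\<close> of \<open>A\<close> in \<open>B\<close>.
\<close>

lemma dim_cong_submodules:
  assumes "set_mset m \<subseteq> dim_gens (fg_submodules R M)"
  obtains N where "set_mset N \<subseteq> fgsub R M" "dim_cong (fg_submodules R M) m (submodule_gen N)"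
proof -
  have "\<exists>N. set_mset N \<subseteq> fgsub R M \<and> dim_cong (fg_submodules R M) m (submodule_gen N)" using assms
  proof (induction m)
    case empty
    show ?case by (rule exI[of _ "{#}"]) (simp add: dim_cong.refl)
  next
    case (add p m)
    then obtain N where N: "set_mset N \<subseteq> fgsub R M" "dim_cong (fg_submodules R M) m (submodule_gen N)" by auto
    obtain C where C: "dsum R M (snd p) (fst p) C" using dim_gens_complement[of p] add.prems by auto
    have "dim_cong (fg_submodules R M) ({#p#} + m) ({#({\<zero>\<^bsub>M\<^esub>}, C)#} + submodule_gen N)"
      using dim_cong_complement[OF C] by (intro dim_cong.add N(2)) simp
    then show ?case
      using N(1) dsum_right[OF C] by (intro exI[of _ "add_mset C N"]) simp
  qed
  then show thesis using that by blast
qed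

text \<open>
  A decomposition of the zero module has only zero parts.
\<close>

lemma one_eq_multD:
  assumes a: "a \<in> carrier (V_monoid R)" and b: "b \<in> carrier (V_monoid R)"
    and eq: "a \<otimes>\<^bsub>V_monoid R\<^esub> b = \<one>\<^bsub>V_monoid R\<^esub>"
  shows "a = \<one>\<^bsub>V_monoid R\<^esub>" "b = \<one>\<^bsub>V_monoid R\<^esub>"
proof -
  obtain A B where AB: "dsum R M {\<zero>\<^bsub>M\<^esub>} A B" "rmod_class R (M \<restriction> A) = a" "rmod_class R (M \<restriction> B) = b"
    by (rule class_split[OF fgsub_zero a b]) (simp add: class_zero eq)
  have "A = {\<zero>\<^bsub>M\<^esub>}" "B = {\<zero>\<^bsub>M\<^esub>}"
    using dsumD(4,5)[OF AB(1)] rsubmodule_zero[OF fgsub_rsubmodule[OF dsumD(1)[OF AB(1)]]]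
      rsubmodule_zero[OF fgsub_rsubmodule[OF dsumD(2)[OF AB(1)]]] by blast+
  then show "a = \<one>\<^bsub>V_monoid R\<^esub>" "b = \<one>\<^bsub>V_monoid R\<^esub>" using AB class_zero by auto
qed

text \<open>
  By refinement in \<open>V(R)\<close>, a splitting of the total class induces splittings of the classes of
  the members of \<open>N\<close>, and these come from decompositions of the members themselves.
\<close>

lemma sum_class_split:
  assumes "set_mset N \<subseteq> fgsub R M" "a \<in> carrier (V_monoid R)" "b \<in> carrier (V_monoid R)"
    and "sum_class N = a \<otimes>\<^bsub>V_monoid R\<^esub> b"
  shows "\<exists>N' N''. set_mset N' \<subseteq> fgsub R M \<and> set_mset N'' \<subseteq> fgsub R M \<and> sum_class N' = a \<and> sum_class N'' = b
    \<and> dim_cong (fg_submodules R M) (submodule_gen N) (submodule_gen N' + submodule_gen N'')"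
  using assms
proof (induction N arbitrary: a b)
  case empty
  then have "a = \<one>\<^bsub>V_monoid R\<^esub>" "b = \<one>\<^bsub>V_monoid R\<^esub>" using one_eq_multD[of a b] by auto
  then show ?case by (intro exI[of _ "{#}"]) (simp add: dim_cong.refl)
next
  case (add X N)
  then have X: "X \<in> fgsub R M" and N: "set_mset N \<subseteq> fgsub R M" by auto
  note V = class_in_V[OF X] sum_class_in_V[OF N]
  have "a \<otimes>\<^bsub>V_monoid R\<^esub> b = rmod_class R (M \<restriction> X) \<otimes>\<^bsub>V_monoid R\<^esub> sum_class N"
    using add.prems(4) sum_class_add_mset[OF X N] by simp
  then obtain y' a' y'' d'' where v: "y' \<in> carrier (V_monoid R)" "a' \<in> carrier (V_monoid R)"
    "y'' \<in> carrier (V_monoid R)" "d'' \<in> carrier (V_monoid R)"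
    and r: "a = y' \<otimes>\<^bsub>V_monoid R\<^esub> a'" "b = y'' \<otimes>\<^bsub>V_monoid R\<^esub> d''"
    "rmod_class R (M \<restriction> X) = y' \<otimes>\<^bsub>V_monoid R\<^esub> y''" "sum_class N = a' \<otimes>\<^bsub>V_monoid R\<^esub> d''"
    by (rule V_refinement[OF add.prems(2,3) V])
  obtain X' X'' where XX: "dsum R M X X' X''" "rmod_class R (M \<restriction> X') = y'" "rmod_class R (M \<restriction> X'') = y''"
    by (rule class_split[OF X v(1,3) r(3)])
  note D = dsumD[OF XX(1)]
  obtain N' N'' where NN: "set_mset N' \<subseteq> fgsub R M" "set_mset N'' \<subseteq> fgsub R M" "sum_class N' = a'" "sum_class N'' = d''"
    and c: "dim_cong (fg_submodules R M) (submodule_gen N) (submodule_gen N' + submodule_gen N'')"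
    using add.IH[OF N v(2,4) r(4)] by blast
  have "dim_cong (fg_submodules R M) (submodule_gen (add_mset X N)) (submodule_gen (add_mset X' N') + submodule_gen (add_mset X'' N''))"
    using dim_cong.add[OF dim_cong_dsum[OF XX(1)] c] by (simp add: add_mset_commute)
  moreover have "sum_class (add_mset X' N') = a" "sum_class (add_mset X'' N'') = b"
    using sum_class_add_mset D(1,2) NN XX r by auto
  ultimately show ?case using D(1,2) NN(1,2)
    by (intro exI[of _ "add_mset X' N'"] exI[of _ "add_mset X'' N''"]) simp
qed

end

text \<open>
  Cutting along the coordinates decomposes \<open>A\<close> into modules isomorphic to finitely generated right
  ideals, which \<open>\<iota>\<close> embeds into \<open>G\<close>.
\<close>

lemma (in regular_free_module) free_class_sum:
  fixes G :: "('a, 'm, 's) rmodule_scheme"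
  assumes A: "A \<in> fgsub R F" and G: "free_retract R G"
    and \<iota>: "\<iota> \<in> rmod_hom R (ring_rmod R) G" "inj_on \<iota> (carrier R)"
  shows "\<exists>N. set_mset N \<subseteq> fgsub R G \<and> regular_module.sum_class R G N = rmod_class R (F \<restriction> A)"
proof -
  interpret G: regular_module R G using G by unfold_locales
  interpret R1: regular_module R "ring_rmod R" using free_retract_ring by unfold_locales
  show ?thesis using A
  proof (induction A rule: coordinate_induct)
    case zero
    show ?case by (rule exI[of _ "{#}"]) (simp add: class_zero)
  next
    case (split A A1 K i)
    note D = dsumD[OF split.hyps(1)]
    have p: "(\<lambda>x. x i) \<in> rmod_hom R (F \<restriction> A1) (ring_rmod R)" by (rule coord_hom_restr[OF split.hyps(2) D(1)])
    let ?I = "(\<lambda>x. x i) ` A1"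
    have I: "?I \<in> fgsub R (ring_rmod R)" by (rule fgsub_image[OF D(1) right_module_ring p])
    have IR: "?I \<subseteq> carrier R" using fgsub_subset[OF I] by simp
    have \<iota>I: "\<iota> \<in> rmod_hom R (ring_rmod R \<restriction> ?I) G" using IR by (intro rmod_hom_restr[OF \<iota>(1)]) simp
    have 1: "\<iota> ` ?I \<in> fgsub R G" by (rule R1.fgsub_image[OF I G.right_module_axioms \<iota>I])
    have 2: "rmod_class R (G \<restriction> \<iota> ` ?I) = rmod_class R (F \<restriction> A1)"
      using R1.class_image[OF I \<iota>I inj_on_subset[OF \<iota>(2) IR]] class_image[OF D(1) p split.hyps(3)] by simp
    obtain N where N: "set_mset N \<subseteq> fgsub R G" "G.sum_class N = rmod_class R (F \<restriction> K)" using split.IH by blast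
    show ?case
      using G.sum_class_add_mset[OF 1 N(1)] 1 2 N class_dsum[OF split.hyps(1)]
      by (intro exI[of _ "add_mset (\<iota> ` ?I) N"]) simp
  qed
qed

context regular_free_module_ge2
begin

lemma sum_class_surj:
  assumes v: "v \<in> carrier (V_monoid R)"
  obtains N where "set_mset N \<subseteq> fgsub R F" "sum_class N = v"
proof -
  obtain C :: "('a, nat \<Rightarrow> 'a) rmodule" where C: "free_retract R C" "v = rmod_class R C"
    using v by (rule V_carrierE)
  obtain m i q where iq: "i \<in> rmod_hom R C (free_rmod R m)" "q \<in> rmod_hom R (free_rmod R m) C"
    "\<And>x. x \<in> carrier C \<Longrightarrow> q (i x) = x" by (rule free_retractE[OF C(1)]) (erule (1) that, assumption)
  interpret C: regular_module R C using C(1) by unfold_locales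
  interpret Fm: regular_free_module R m ..
  have "inj_on i (carrier C)" by (rule inj_on_inverseI[of _ q]) (rule iq(3))
  then have cls: "rmod_class R (free_rmod R m \<restriction> i ` carrier C) = v"
    using C.class_image[OF C.fgsub_carrier, of i "free_rmod R m"] iq(1) C(2) by simp
  have A: "i ` carrier C \<in> fgsub R (free_rmod R m)"
    by (rule fgsub_hom_image[OF C(1) right_module_free iq(1)])
  have inj: "inj_on (unit_vec R n 0) (carrier R)"
  proof (rule inj_onI)
    fix x y assume "unit_vec R n 0 x = unit_vec R n 0 y"
    then have "unit_vec R n 0 x 0 = unit_vec R n 0 y 0" by simp
    then show "x = y" using n_ge2 by simp
  qed
  show thesis
    using Fm.free_class_sum[OF A free_retract_free unit_vec_hom inj] that cls by auto
qed

text \<open>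
  Decompose \<open>X\<close> into submodules isomorphic to the members of \<open>N\<close> and apply
  \<open>isomorphic_submodule_cong\<close> to each of them.
\<close>

lemma sum_class_eq_class:
  assumes "set_mset N \<subseteq> fgsub R F" "X \<in> fgsub R F" "sum_class N = rmod_class R (F \<restriction> X)"
  shows "dim_cong (fg_submodules R F) {#({\<zero>\<^bsub>F\<^esub>}, X)#} (submodule_gen N)"
  using assms
proof (induction N arbitrary: X)
  case empty
  then have "X \<approx> {\<zero>\<^bsub>F\<^esub>}" using class_zero by (intro isomorphic_submodule_cong fgsub_zero) auto
  then show ?case
    using dim_cong.D0[of "{\<zero>\<^bsub>F\<^esub>}" "fg_submodules R F"] fgsub_zero unfolding submodule_cong_def
    by (auto intro: dim_cong.trans)
next
  case (add Y N)
  then have Y: "Y \<in> fgsub R F" and N: "set_mset N \<subseteq> fgsub R F" by auto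
  have eq: "rmod_class R (F \<restriction> X) = rmod_class R (F \<restriction> Y) \<otimes>\<^bsub>V_monoid R\<^esub> sum_class N"
    using add.prems(3) sum_class_add_mset[OF Y N] by simp
  obtain X1 X2 where XX: "dsum R F X X1 X2" "rmod_class R (F \<restriction> X1) = rmod_class R (F \<restriction> Y)"
    "rmod_class R (F \<restriction> X2) = sum_class N"
    by (rule class_split[OF add.prems(2) class_in_V[OF Y] sum_class_in_V[OF N] eq])
  have "dim_cong (fg_submodules R F) {#({\<zero>\<^bsub>F\<^esub>}, X1)#} {#({\<zero>\<^bsub>F\<^esub>}, Y)#}"
    using isomorphic_submodule_cong[OF dsum_left[OF XX(1)] Y XX(2)] unfolding submodule_cong_def .
  moreover have "dim_cong (fg_submodules R F) {#({\<zero>\<^bsub>F\<^esub>}, X2)#} (submodule_gen N)"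
    by (rule add.IH[OF N dsum_right[OF XX(1)] XX(3)[symmetric]])
  ultimately show ?case
    using dim_cong.trans[OF dim_cong_dsum[OF XX(1)] dim_cong.add] by fastforce
qed

text \<open>
  Induction on \<open>N\<close>: given a member \<open>X\<close>, refinement splits \<open>N'\<close> into a part with the class of \<open>X\<close> and
  one with the class of what is left of \<open>N\<close>.
\<close>

lemma sum_class_inj:
  assumes "set_mset N \<subseteq> fgsub R F" "set_mset N' \<subseteq> fgsub R F" "sum_class N = sum_class N'"
  shows "dim_cong (fg_submodules R F) (submodule_gen N) (submodule_gen N')"
  using assms
proof (induction N arbitrary: N')
  case empty
  then have "dim_cong (fg_submodules R F) {#({\<zero>\<^bsub>F\<^esub>}, {\<zero>\<^bsub>F\<^esub>})#} (submodule_gen N')"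
    using class_zero by (intro sum_class_eq_class fgsub_zero) auto
  moreover have "dim_cong (fg_submodules R F) {#} {#({\<zero>\<^bsub>F\<^esub>}, {\<zero>\<^bsub>F\<^esub>})#}"
    by (intro dim_cong.sym[OF dim_cong.D0] fgsub_zero)
  ultimately show ?case using dim_cong.trans by fastforce
next
  case (add X N)
  then have X: "X \<in> fgsub R F" and N: "set_mset N \<subseteq> fgsub R F" by auto
  have eq: "sum_class N' = rmod_class R (F \<restriction> X) \<otimes>\<^bsub>V_monoid R\<^esub> sum_class N"
    using add.prems(3) sum_class_add_mset[OF X N] by simp
  obtain N1 N2 where NN: "set_mset N1 \<subseteq> fgsub R F" "set_mset N2 \<subseteq> fgsub R F"
    "sum_class N1 = rmod_class R (F \<restriction> X)" "sum_class N2 = sum_class N"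
    and c: "dim_cong (fg_submodules R F) (submodule_gen N') (submodule_gen N1 + submodule_gen N2)"
    using sum_class_split[OF add.prems(2) class_in_V[OF X] sum_class_in_V[OF N] eq] by blast
  have "dim_cong (fg_submodules R F) ({#({\<zero>\<^bsub>F\<^esub>}, X)#} + submodule_gen N) (submodule_gen N1 + submodule_gen N2)"
    by (rule dim_cong.add[OF sum_class_eq_class[OF NN(1) X NN(3)] add.IH[OF N NN(2) NN(4)[symmetric]]])
  from dim_cong.trans[OF this dim_cong.sym[OF c]] show ?case by simp
qed

lemma total_class_eq_iff:
  assumes m: "set_mset m \<subseteq> dim_gens (fg_submodules R F)" and m': "set_mset m' \<subseteq> dim_gens (fg_submodules R F)"
  shows "total_class m = total_class m' \<longleftrightarrow> dim_cong (fg_submodules R F) m m'"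
proof
  assume eq: "total_class m = total_class m'"
  obtain N where N: "set_mset N \<subseteq> fgsub R F" "dim_cong (fg_submodules R F) m (submodule_gen N)"
    by (rule dim_cong_submodules[OF m])
  obtain N' where N': "set_mset N' \<subseteq> fgsub R F" "dim_cong (fg_submodules R F) m' (submodule_gen N')"
    by (rule dim_cong_submodules[OF m'])
  have "dim_cong (fg_submodules R F) (submodule_gen N) (submodule_gen N')"
    using total_class_cong[OF N(2)] total_class_cong[OF N'(2)] eq by (intro sum_class_inj N(1) N'(1)) simp
  then show "dim_cong (fg_submodules R F) m m'" using N(2) N'(2) by (meson dim_cong.sym dim_cong.trans)
qed (rule total_class_cong)

end

context regular_module
begin

definition natural_map :: "('m set \<times> 'm set) multiset set \<Rightarrow> ('a, nat \<Rightarrow> 'a) rmodule set"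
  where "natural_map =
    (\<lambda>X\<in>carrier (Dim (fg_submodules R M)). total_class (SOME m. set_mset m \<subseteq> dim_gens (fg_submodules R M) \<and> X = dim_class (fg_submodules R M) m))"

lemma natural_map_extensional: "natural_map \<in> extensional (carrier (Dim (fg_submodules R M)))"
  by (simp add: natural_map_def)

lemma natural_map_dim_class:
  assumes m: "set_mset m \<subseteq> dim_gens (fg_submodules R M)"
  shows "natural_map (dim_class (fg_submodules R M) m) = total_class m"
proof -
  define k where "k = (SOME k. set_mset k \<subseteq> dim_gens (fg_submodules R M) \<and> dim_class (fg_submodules R M) m = dim_class (fg_submodules R M) k)"
  have "set_mset k \<subseteq> dim_gens (fg_submodules R M) \<and> dim_class (fg_submodules R M) m = dim_class (fg_submodules R M) k"
    unfolding k_def by (rule someI[of _ m]) (simp add: m)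
  then have "dim_cong (fg_submodules R M) m k" using dim_class_eqD by blast
  then have "total_class k = total_class m" using total_class_cong by simp
  then show ?thesis unfolding natural_map_def k_def[symmetric] using dim_class_in_Dim[OF m] by (simp add: k_def)
qed

text \<open>
  The dimension monoid is generated by the elements \<open>\<Delta>(X)\<close>, by \<open>dim_cong_submodules\<close>.
\<close>

lemma hom_eq_total_class:
  assumes \<phi>: "\<phi> \<in> hom (Dim (fg_submodules R M)) (V_monoid R)" and one: "\<phi> \<one>\<^bsub>Dim (fg_submodules R M)\<^esub> = \<one>\<^bsub>V_monoid R\<^esub>"
    and el: "\<And>X. X \<in> fgsub R M \<Longrightarrow> \<phi> (dim_elem (fg_submodules R M) X) = rmod_class R (M \<restriction> X)"
    and m: "set_mset m \<subseteq> dim_gens (fg_submodules R M)"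
  shows "\<phi> (dim_class (fg_submodules R M) m) = total_class m"
proof -
  have N: "\<phi> (dim_class (fg_submodules R M) (submodule_gen N)) = sum_class N" if "set_mset N \<subseteq> fgsub R M" for N
    using that
  proof (induction N)
    case empty
    then show ?case using one by (simp add: Dim_one)
  next
    case (add X N)
    then have X: "X \<in> fgsub R M" and N: "set_mset N \<subseteq> fgsub R M" by auto
    have g: "set_mset {#({\<zero>\<^bsub>M\<^esub>}, X)#} \<subseteq> dim_gens (fg_submodules R M)" using submodule_gens[OF X] by simp
    have "\<phi> (dim_class (fg_submodules R M) ({#({\<zero>\<^bsub>M\<^esub>}, X)#} + submodule_gen N))
        = \<phi> (dim_class (fg_submodules R M) {#({\<zero>\<^bsub>M\<^esub>}, X)#}) \<otimes>\<^bsub>V_monoid R\<^esub> \<phi> (dim_class (fg_submodules R M) (submodule_gen N))"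
      unfolding Dim_mult[OF g submodule_gen_gens[OF N], symmetric]
      by (rule hom_mult[OF \<phi> dim_class_in_Dim[OF g] dim_class_in_Dim[OF submodule_gen_gens[OF N]]])
    then show ?case
      using el[OF X] add.IH[OF N] sum_class_add_mset[OF X N]
      by (simp add: dim_elem_def dim_interval_def lattice_bottom)
  qed
  obtain N where *: "set_mset N \<subseteq> fgsub R M" "dim_cong (fg_submodules R M) m (submodule_gen N)"
    by (rule dim_cong_submodules[OF m])
  show ?thesis
    using dim_class_eqI[OF *(2)] N[OF *(1)] total_class_cong[OF *(2)] by simp
qed

lemma natural_map_hom: "natural_map \<in> hom (Dim (fg_submodules R M)) (V_monoid R)"
proof (rule homI)
  fix X assume "X \<in> carrier (Dim (fg_submodules R M))"
  then show "natural_map X \<in> carrier (V_monoid R)"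
    by (elim Dim_carrierE) (simp add: natural_map_dim_class total_class_in_V)
next
  fix X Y assume "X \<in> carrier (Dim (fg_submodules R M))" "Y \<in> carrier (Dim (fg_submodules R M))"
  then show "natural_map (X \<otimes>\<^bsub>Dim (fg_submodules R M)\<^esub> Y) = natural_map X \<otimes>\<^bsub>V_monoid R\<^esub> natural_map Y"
    by (elim Dim_carrierE) (simp add: natural_map_dim_class Dim_mult total_class_union)
qed

lemma natural_map_one: "natural_map \<one>\<^bsub>Dim (fg_submodules R M)\<^esub> = \<one>\<^bsub>V_monoid R\<^esub>"
  by (simp add: Dim_one natural_map_dim_class)

lemma natural_map_dim_elem: "X \<in> fgsub R M \<Longrightarrow> natural_map (dim_elem (fg_submodules R M) X) = rmod_class R (M \<restriction> X)"
  unfolding dim_elem_def dim_interval_def lattice_bottom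
  using submodule_gens[of X] quotient_class_zero[of X]
  by (subst natural_map_dim_class) (simp_all add: total_class_single)

end

lemma (in regular_free_module) is_natural_hom_iff: "is_natural_hom R n \<pi> \<longleftrightarrow> \<pi> = natural_map"
proof
  assume \<pi>: "is_natural_hom R n \<pi>"
  show "\<pi> = natural_map"
  proof (rule extensionalityI[where A = "carrier (Dim (fg_submodules R F))"])
    show "\<pi> \<in> extensional (carrier (Dim (fg_submodules R F)))" using \<pi> by (simp add: is_natural_hom_def Let_def)
    show "natural_map \<in> extensional (carrier (Dim (fg_submodules R F)))" by (rule natural_map_extensional)
    fix X assume "X \<in> carrier (Dim (fg_submodules R F))"
    then obtain m where m: "set_mset m \<subseteq> dim_gens (fg_submodules R F)" "X = dim_class (fg_submodules R F) m" by (rule Dim_carrierE)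
    show "\<pi> X = natural_map X"
      unfolding m(2) natural_map_dim_class[OF m(1)]
      using \<pi> by (intro hom_eq_total_class m(1)) (simp_all add: is_natural_hom_def Let_def)
  qed
next
  assume "\<pi> = natural_map"
  then show "is_natural_hom R n \<pi>"
    using natural_map_hom natural_map_one natural_map_dim_elem
    by (simp add: is_natural_hom_def Let_def natural_map_extensional)
qed

lemma (in regular_free_module_ge2) natural_map_iso: "natural_map \<in> iso (Dim (fg_submodules R F)) (V_monoid R)"
proof -
  have "bij_betw natural_map (carrier (Dim (fg_submodules R F))) (carrier (V_monoid R))"
    unfolding bij_betw_def
  proof
    show "inj_on natural_map (carrier (Dim (fg_submodules R F)))"
    proof (rule inj_onI)
      fix X Y assume X: "X \<in> carrier (Dim (fg_submodules R F))" and Y: "Y \<in> carrier (Dim (fg_submodules R F))"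
        and eq: "natural_map X = natural_map Y"
      obtain m where m: "set_mset m \<subseteq> dim_gens (fg_submodules R F)" "X = dim_class (fg_submodules R F) m" using X by (rule Dim_carrierE)
      obtain k where k: "set_mset k \<subseteq> dim_gens (fg_submodules R F)" "Y = dim_class (fg_submodules R F) k" using Y by (rule Dim_carrierE)
      have "dim_cong (fg_submodules R F) m k"
        using eq m k by (simp add: natural_map_dim_class total_class_eq_iff)
      then show "X = Y" unfolding m(2) k(2) by (rule dim_class_eqI)
    qed
    show "natural_map ` carrier (Dim (fg_submodules R F)) = carrier (V_monoid R)"
    proof
      show "natural_map ` carrier (Dim (fg_submodules R F)) \<subseteq> carrier (V_monoid R)"
        using hom_in_carrier[OF natural_map_hom] by blast
      show "carrier (V_monoid R) \<subseteq> natural_map ` carrier (Dim (fg_submodules R F))"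
      proof
        fix v assume "v \<in> carrier (V_monoid R)"
        then obtain N where N: "set_mset N \<subseteq> fgsub R F" "sum_class N = v" by (rule sum_class_surj)
        note g = submodule_gen_gens[OF N(1)]
        show "v \<in> natural_map ` carrier (Dim (fg_submodules R F))"
          using natural_map_dim_class[OF g] N(2) dim_class_in_Dim[OF g] by (metis imageI)
      qed
    qed
  qed
  then show ?thesis using natural_map_hom by (simp add: iso_def)
qed

theorem proposition10p26:
  fixes R :: "('a, 'r) ring_scheme" and n :: nat
  assumes "vn_regular R" and "n \<ge> 2"
  shows "(\<exists>!\<pi>. is_natural_hom R n \<pi>) \<and>
    (\<forall>\<pi>. is_natural_hom R n \<pi> \<longrightarrow>
      \<pi> \<in> iso (Dim (fg_submodules R (free_rmod R n))) (V_monoid R))"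
proof -
  interpret regular_free_module_ge2 R n
    using assms
    by (intro regular_free_module_ge2.intro regular_free_module.intro regular_ring.intro
        regular_ring_axioms.intro regular_free_module_ge2_axioms.intro) (auto simp: vn_regular_def)
  show ?thesis using natural_map_iso by (simp add: is_natural_hom_iff)
qed

end
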